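(* Let $p$ be an odd prime, and let $u_p:\mathbb{Z}/p\mathbb{Z}\to\mathbb{C}$ be the Björck sequence of length $p$. Then the ambiguity function $A_p(u_p)$, defined on $\mathbb{Z}/p\mathbb{Z}\times\mathbb{Z}/p\mathbb{Z}$ by $$A_p(u_p)[m,n]=\frac{1}{p}\sum_{k\in\mathbb{Z}/p\mathbb{Z}}u_p[k+m]\,\overline{u_p[k]}\,e^{-2\pi i kn/p},$$ satisfies the estimate $$|A_p(u_p)[m,n]|<\frac{2}{\sqrt{p}}+\begin{cases}\dfrac{4}{p} & \text{if } p\equiv 1\pmod 4,\\[2mm] \dfrac{4}{p^{3/2}} & \text{if } p\equiv 3\pmod 4,\end{cases}$$ for all $(m,n)\in(\mathbb{Z}/p\mathbb{Z}\times\mathbb{Z}/p\mathbb{Z})\smallsetminus\{(0,0)\}$.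
   Context: For an odd prime $p$, let $\chi=\left(\frac{\cdot}{p}\right):\mathbb{Z}/p\mathbb{Z}\to\{+1,0,-1\}$ be the Legendre symbol modulo $p$: $\chi[k]=1$ if $k$ is a nonzero square mod $p$, $\chi[0]=0$, and $\chi[k]=-1$ if $k$ is not a square mod $p$. The Björck sequence $u_p:\mathbb{Z}/p\mathbb{Z}\to\mathbb{C}$ of length $p$ is defined as follows. If $p\equiv 1\pmod 4$: $u_p[k]=\exp(i\theta\chi[k])$ for all $k\in\mathbb{Z}/p\mathbb{Z}$, where $\theta=\arccos\left(\frac{1}{1+\sqrt p}\right)$. If $p\equiv 3\pmod 4$: $u_p[k]=\exp(i\phi)$ if $\chi[k]=-1$, and $u_p[k]=1$ otherwise (that is, if $\chi[k]\in\{0,1\}$), where $\phi=\arccos\left(\frac{1-p}{1+p}\right)$. *)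

theory Defs
  imports "HOL-Analysis.Analysis" "HOL-Number_Theory.Number_Theory"
begin

text \<open>
  A function on \<open>\<int>/p\<int>\<close> is represented by a \<open>p\<close>-periodic function on \<open>int\<close>. The
  lemmas below show that the sequence and its ambiguity function are \<open>p\<close>-periodic in each
  argument, and that the sum may be taken over any complete residue system modulo \<open>p\<close>.
\<close>

definition bjorck :: "nat \<Rightarrow> int \<Rightarrow> complex" where
  \<comment> \<open>meant for odd primes, so the second case is \<open>p mod 4 = 3\<close>\<close>
  "bjorck p k =
    (if p mod 4 = 1
     then exp (\<i> * complex_of_real (arccos (1 / (1 + sqrt (real p)))) * of_int (Legendre k (int p)))
     else if Legendre k (int p) = -1
          then exp (\<i> * complex_of_real (arccos ((1 - real p) / (1 + real p))))
          else 1)"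

definition ambiguity :: "nat \<Rightarrow> (int \<Rightarrow> complex) \<Rightarrow> int \<Rightarrow> int \<Rightarrow> complex" where
  "ambiguity p u m n =
    1 / of_nat p * (\<Sum>k\<in>{0..<int p}. u (k + m) * cnj (u k) *
      exp (- (2 * complex_of_real pi * \<i> * of_int k * of_int n / of_nat p)))"

lemma Legendre_cong: "[a = b] (mod p) \<Longrightarrow> Legendre a p = Legendre b p"
  unfolding Legendre_def QuadRes_def cong_def by simp

lemma bjorck_cong: "[k = l] (mod int p) \<Longrightarrow> bjorck p k = bjorck p l"
  unfolding bjorck_def by (simp only: Legendre_cong)

lemma exp_character_cong:
  assumes "p > 0" "[a = b] (mod int p)"
  shows "exp (- (2 * complex_of_real pi * \<i> * of_int a / of_nat p)) =
         exp (- (2 * complex_of_real pi * \<i> * of_int b / of_nat p))"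
proof -
  obtain c where "a = b + int p * c"
    using assms(2) by (metis cong_iff_lin cong_sym)
  then have "- (2 * complex_of_real pi * \<i> * of_int a / of_nat p) =
      - (2 * complex_of_real pi * \<i> * of_int b / of_nat p) + 2 * complex_of_real pi * \<i> * of_int (- c)"
    using assms(1) by (simp add: field_simps)
  then show ?thesis
    by (subst exp_eq) (auto intro!: exI[of _ "- c"])
qed

lemma ambiguity_cong:
  assumes "p > 0" "\<And>k l. [k = l] (mod int p) \<Longrightarrow> u k = u l"
    and "[m = m'] (mod int p)" "[n = n'] (mod int p)"
  shows "ambiguity p u m n = ambiguity p u m' n'"
proof -
  have "u (k + m) = u (k + m')" for k
    using assms(2,3) by (simp add: cong_add_lcancel)
  moreover have "exp (- (2 * complex_of_real pi * \<i> * of_int k * of_int n / of_nat p)) =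
      exp (- (2 * complex_of_real pi * \<i> * of_int k * of_int n' / of_nat p))" for k
    using exp_character_cong[OF assms(1), of "k * n" "k * n'"] assms(4)
    by (simp add: cong_scalar_left mult.assoc)
  ultimately show ?thesis
    unfolding ambiguity_def by simp
qed

lemma ambiguity_residue_system:
  assumes "p > 0" "\<And>k l. [k = l] (mod int p) \<Longrightarrow> u k = u l"
    and "bij_betw (\<lambda>k. k mod int p) R {0..<int p}"
  shows "ambiguity p u m n =
    1 / of_nat p * (\<Sum>k\<in>R. u (k + m) * cnj (u k) *
      exp (- (2 * complex_of_real pi * \<i> * of_int k * of_int n / of_nat p)))"
proof -
  have red: "[k mod int p = k] (mod int p)" for k
    by (simp add: cong_def)
  have "u (k mod int p + m) = u (k + m)" "u (k mod int p) = u k" for k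
    using assms(2) red by (simp_all add: cong_add)
  moreover have "exp (- (2 * complex_of_real pi * \<i> * of_int (k mod int p) * of_int n / of_nat p)) =
      exp (- (2 * complex_of_real pi * \<i> * of_int k * of_int n / of_nat p))" for k
    using exp_character_cong[OF assms(1), of "k mod int p * n" "k * n"] red
    by (simp add: cong_scalar_right mult.assoc)
  ultimately show ?thesis
    unfolding ambiguity_def
    by (subst sum.reindex_bij_betw[OF assms(3), symmetric]) simp
qed

end

(*
  Expanding u(k+m) cnj(u(k)), where u = a + b chi + d delta_0, reduces the claim to Gauss sums and
  to the correlations of chi(k) chi(k+m) with an additive character. Parametrizing the conic
  y^2 = k(k+m) by a unit turns such a correlation into a unimodular factor times a Kloosterman
  sum K, and the point is Weil's bound |K| <= 2 sqrt p.

  For that bound, x |-> psi(Tr(x + b/x)) is extended to a multiplicative function on the monic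
  polynomials over F_p, whose L-function is 1 + K T + p T^2 because longer coefficient sums cancel.
  Hence the analogous sum over F_q with q = p^r is -(u^r + v^r), where u v = p and u + v = -K.
  For q = Q^2, Q = p^s, write w for the sum of the first s conjugates of z = x + b/x; on
  Tr z = t one has w^Q = t - w. Stepanov's method: a combination of the x^(i+jQ) w^k which is
  nonzero, but whose Q-th power vanishes identically after substituting x^(Q^2) = x and
  w^Q = t - w, shows that each fibre of the trace has at most q/p + 4Q points. The fibres have q - 1
  points altogether, so the sums are O(Q) for fixed p, and letting s grow forces |u|, |v| <= sqrt p.

  Finite fields are modelled as int poly modulo the ideal generated by p and a polynomial P that is
  irreducible modulo p: HOL has no type depending on the variable p.
*)
theory Submission
  imports Defs
begin

hide_const (open) up_ring.coeff up_ring.monom module.smult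

section \<open>Prime ideals of commutative rings\<close>

text \<open>Only even \<open>r = 2 * s\<close> have to be estimated: if
  \<open>|K| > 2 sqrt p\<close>, then \<open>u\<close> and \<open>v\<close> are real, because
  \<open>K\<close> is, and \<open>u ^ r\<close>, \<open>v ^ r\<close> cannot cancel. Upper bounds on
  the fibres suffice: the values of \<open>psi\<close> sum to 0, so the common bound may be
  subtracted from every fibre size, and the known total then controls the remainder. Why the powers
  of \<open>w\<close> help: put \<open>e = Q / p\<close>. At infinity
  \<open>x ^ i * w ^ k * x ^ (j * Q)\<close> grows like \<open>x ^ (i + e * k + Q * j)\<close>, so
  \<open>i < e\<close> and \<open>k < p\<close> fill the gaps between the powers of
  \<open>x ^ Q\<close>, with distinct rates of growth. On a fibre, \<open>Q\<close>-th powers turn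
  \<open>x ^ i\<close> into \<open>x ^ (i * Q)\<close> and \<open>x ^ (j * Q)\<close> into
  \<open>x ^ j\<close>, while \<open>w ^ k\<close> stays small; this lowers the degree below the
  number of functions and yields the relation. A function whose \<open>Q\<close>-th power vanishes
  at a point vanishes there, so its degree, about \<open>q / p\<close>, bounds the fibre. The points
  of the field with \<open>q\<close> elements are encoded by pairs \<open>(P, j)\<close> with
  \<open>j * degree P = r\<close>; each computation takes place in the residue field of
  \<open>P\<close>, where conjugates repeat with period \<open>degree P\<close>.\<close>

locale prime_ideal_set =
  fixes I :: "'a::comm_ring_1 set"
  assumes zero_mem: "0 \<in> I"
    and add_mem: "\<lbrakk>a \<in> I; b \<in> I\<rbrakk> \<Longrightarrow> a + b \<in> I"
    and mult_mem: "a \<in> I \<Longrightarrow> c * a \<in> I"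
    and one_not_mem: "1 \<notin> I"
    and prime_mem: "a * b \<in> I \<Longrightarrow> a \<in> I \<or> b \<in> I"
begin

definition eqm :: "'a \<Rightarrow> 'a \<Rightarrow> bool" (infix "\<triangleq>" 50) where
  "a \<triangleq> b \<longleftrightarrow> a - b \<in> I"

lemma mult_mem': "a \<in> I \<Longrightarrow> a * c \<in> I"
  using mult_mem[of a c] by (simp add: mult.commute)

lemma uminus_mem: "a \<in> I \<Longrightarrow> - a \<in> I"
  using mult_mem[of a "-1"] by simp

lemma diff_mem: "\<lbrakk>a \<in> I; b \<in> I\<rbrakk> \<Longrightarrow> a - b \<in> I"
  using add_mem[of a "-b"] uminus_mem[of b] by simp

lemma sum_mem: "(\<And>x. x \<in> A \<Longrightarrow> f x \<in> I) \<Longrightarrow> sum f A \<in> I"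
  by (induction A rule: infinite_finite_induct) (auto intro: zero_mem add_mem)

lemma eqm_refl [simp]: "a \<triangleq> a"
  by (simp add: eqm_def zero_mem)

lemma eqm_sym: "a \<triangleq> b \<Longrightarrow> b \<triangleq> a"
  using uminus_mem[of "a - b"] by (simp add: eqm_def)

lemma eqm_trans [trans]: "\<lbrakk>a \<triangleq> b; b \<triangleq> c\<rbrakk> \<Longrightarrow> a \<triangleq> c"
  using add_mem[of "a - b" "b - c"] by (simp add: eqm_def)

lemma eqm_0_iff: "a \<triangleq> 0 \<longleftrightarrow> a \<in> I"
  by (simp add: eqm_def)

lemma eqm_mem: "a \<triangleq> b \<Longrightarrow> a \<in> I \<longleftrightarrow> b \<in> I"
  by (metis eqm_0_iff eqm_sym eqm_trans)

lemma eqm_add: "\<lbrakk>a \<triangleq> b; c \<triangleq> d\<rbrakk> \<Longrightarrow> a + c \<triangleq> b + d"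
  using add_mem[of "a - b" "c - d"] by (simp add: eqm_def algebra_simps)

lemma eqm_diff: "\<lbrakk>a \<triangleq> b; c \<triangleq> d\<rbrakk> \<Longrightarrow> a - c \<triangleq> b - d"
  using diff_mem[of "a - b" "c - d"] by (simp add: eqm_def algebra_simps)

lemma eqm_uminus: "a \<triangleq> b \<Longrightarrow> - a \<triangleq> - b"
  using eqm_diff[of 0 0 a b] by simp

lemma eqm_mult: "\<lbrakk>a \<triangleq> b; c \<triangleq> d\<rbrakk> \<Longrightarrow> a * c \<triangleq> b * d"
  using add_mem[OF mult_mem[of "c - d" a] mult_mem[of "a - b" d]]
  by (simp add: eqm_def algebra_simps)

lemma eqm_power: "a \<triangleq> b \<Longrightarrow> a ^ n \<triangleq> b ^ n"
  by (induction n) (auto intro: eqm_mult)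

lemma eqm_sum: "(\<And>x. x \<in> A \<Longrightarrow> f x \<triangleq> g x) \<Longrightarrow> sum f A \<triangleq> sum g A"
  by (induction A rule: infinite_finite_induct) (auto intro: eqm_add)

lemma power_mem: "a ^ n \<in> I \<Longrightarrow> a \<in> I"
  by (induction n) (use one_not_mem prime_mem in auto)

lemma eqm_cancel: "\<lbrakk>c * a \<triangleq> c * b; c \<notin> I\<rbrakk> \<Longrightarrow> a \<triangleq> b"
  using prime_mem[of c "a - b"] by (auto simp: eqm_def algebra_simps)

text \<open>Root counting in the domain obtained modulo \<open>I\<close>, with pairwise incongruent
  representatives as roots. Synthetic division at one root \<open>a\<close> leaves
  \<open>(b - a) * poly g b\<close> at the others, and primality removes \<open>b - a\<close>, so
  the quotient falls under the induction.\<close>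

lemma too_many_roots:
  assumes "finite A" "\<And>a. a \<in> A \<Longrightarrow> poly f a \<in> I"
    and "\<And>a b. \<lbrakk>a \<in> A; b \<in> A; a \<triangleq> b\<rbrakk> \<Longrightarrow> a = b" "degree f < card A"
  shows "coeff f i \<in> I"
  using assms
proof (induction "card A" arbitrary: A f i rule: less_induct)
  case less
  obtain a where a: "a \<in> A"
    using less.prems by fastforce
  define g where "g = synthetic_div f a"
  have f: "f + smult a g = pCons (poly f a) g"
    using synthetic_div_correct[of f a] by (simp add: g_def)
  have fb: "poly f b = poly f a + (b - a) * poly g b" for b
    using arg_cong[OF f, of "\<lambda>h. poly h b"] by (simp add: algebra_simps)
  show ?case
  proof (cases "degree f = 0")
    case True
    then obtain c where "f = [:c:]"
      by (meson degree_eq_zeroE)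
    then show ?thesis
      using less.prems(2)[OF a] zero_mem by (auto simp: coeff_pCons split: nat.splits)
  next
    case False
    have cg: "coeff g j \<in> I" for j
    proof (rule less.hyps)
      show "card (A - {a}) < card A" "finite (A - {a})"
        using a less.prems(1) card_Diff1_less[of A a] by auto
      show "degree g < card (A - {a})"
        using False less.prems a by (simp add: g_def degree_synthetic_div)
      show "poly g b \<in> I" if "b \<in> A - {a}" for b
      proof -
        have "(b - a) * poly g b = poly f b - poly f a"
          by (simp add: fb[of b])
        then have "(b - a) * poly g b \<in> I"
          using less.prems(2) a that by (metis DiffD1 diff_mem)
        moreover have "b - a \<notin> I"
          using less.prems(3)[of b a] a that by (auto simp: eqm_def)
        ultimately show ?thesis
          using prime_mem by blast
      qed
    qed (use less.prems in auto)
    have "f = pCons (poly f a) g - smult a g"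
      using f by (simp add: algebra_simps)
    then have "coeff f i = coeff (pCons (poly f a) g) i - a * coeff g i"
      by (metis coeff_diff coeff_smult)
    moreover have "coeff (pCons (poly f a) g) i \<in> I"
      using cg less.prems(2)[OF a] by (auto simp: coeff_pCons split: nat.splits)
    ultimately show ?thesis
      using cg by (simp add: diff_mem mult_mem)
  qed
qed

end

text \<open>The claims share one induction: the second coefficient changes by \<open>a\<close> times
  the leading coefficient of the smaller product, whose degree bound keeps the new product
  monic.\<close>

lemma coeffs_prod_linear:
  fixes A :: "'a::comm_ring_1 set"
  assumes "finite A"
  shows "degree (\<Prod>a\<in>A. [:- a, 1:]) \<le> card A \<and> coeff (\<Prod>a\<in>A. [:- a, 1:]) (card A) = 1 \<and>
    (\<forall>n. card A = Suc n \<longrightarrow> coeff (\<Prod>a\<in>A. [:- a, 1:]) n = - \<Sum>A)"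
  using assms
proof (induction A rule: finite_induct)
  case (insert a A)
  define h where "h = (\<Prod>a\<in>A. [:- a, 1:])"
  have h: "degree h \<le> card A" "coeff h (card A) = 1"
    "\<And>n. card A = Suc n \<Longrightarrow> coeff h n = - \<Sum>A"
    using insert.IH by (auto simp: h_def)
  have e: "(\<Prod>a\<in>insert a A. [:- a, 1:]) = pCons 0 h - smult a h"
    using insert.hyps by (simp add: h_def)
  have z: "coeff h (Suc (card A)) = 0"
    using h(1) by (simp add: coeff_eq_0)
  have "degree (pCons 0 h - smult a h) \<le> Suc (card A)"
    using h(1) by (intro degree_diff_le) (auto intro: order.trans[OF degree_pCons_le] order.trans[OF degree_smult_le])
  moreover have "coeff (pCons 0 h - smult a h) (card A) = - (a + \<Sum>A)"
  proof (cases "card A")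
    case 0
    then have "A = {}"
      using insert.hyps by simp
    then show ?thesis
      by (simp add: h_def)
  next
    case (Suc n)
    then show ?thesis
      using h(2) h(3)[OF Suc] by simp
  qed
  ultimately show ?case
    unfolding e using insert.hyps h z by simp
qed simp

context prime_ideal_set
begin

text \<open>Subtracting the multiple of the product of linear factors that cancels the top
  coefficient leaves a degree below the number of roots, so \<open>too_many_roots\<close> kills the
  difference modulo \<open>I\<close>.\<close>

lemma vieta:
  assumes "degree f \<le> Suc n" "finite A" "card A = Suc n"
    and "\<And>a. a \<in> A \<Longrightarrow> poly f a \<in> I"
    and "\<And>a b. \<lbrakk>a \<in> A; b \<in> A; a \<triangleq> b\<rbrakk> \<Longrightarrow> a = b"
  shows "coeff f n \<triangleq> - (coeff f (Suc n) * \<Sum>A)"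
proof -
  define h where "h = (\<Prod>a\<in>A. [:- a, 1:])"
  define g where "g = f - smult (coeff f (Suc n)) h"
  have h: "degree h \<le> Suc n" "coeff h (Suc n) = 1" "coeff h n = - \<Sum>A"
    using coeffs_prod_linear[OF assms(2)] assms(3) by (auto simp: h_def)
  have "degree g \<le> Suc n"
    unfolding g_def using assms(1) h(1)
    by (intro degree_diff_le) (auto intro: order.trans[OF degree_smult_le])
  moreover have "coeff g (Suc n) = 0"
    by (simp add: g_def h)
  ultimately have "degree g < card A"
    using assms(3) by (metis eq_zero_or_degree_less less_Suc_eq_le degree_0 zero_less_Suc le_imp_less_Suc)
  moreover have "poly g a \<in> I" if "a \<in> A" for a
  proof -
    have "poly h a = 0"
      using that assms(2) by (auto simp: h_def poly_prod intro!: prod_zero)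
    then show ?thesis
      using assms(4)[OF that] by (simp add: g_def)
  qed
  ultimately have "coeff g n \<in> I"
    using too_many_roots[of A g] assms(2,5) by blast
  then show ?thesis
    by (simp add: g_def h eqm_def)
qed

end

section \<open>Frobenius modulo a prime ideal containing \<open>p\<close>\<close>

locale prime_ideal_char = prime_ideal_set +
  fixes p :: nat
  assumes prime_p: "prime p" and p_mem: "of_nat p \<in> I"
begin

lemma dream: "(a + b) ^ p \<triangleq> a ^ p + b ^ p"
proof -
  have p1: "p > 1"
    using prime_p by (rule prime_gt_1_nat)
  have "(\<Sum>k\<in>{1..<p}. of_nat (p choose k) * a ^ k * b ^ (p - k)) \<in> I"
  proof (rule sum_mem)
    fix k assume "k \<in> {1..<p}"
    then have "p dvd p choose k"
      using prime_p by (intro dvd_choose_prime) auto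
    then obtain c where "p choose k = p * c"
      by blast
    then show "of_nat (p choose k) * a ^ k * b ^ (p - k) \<in> I"
      using p_mem by (simp add: mult_mem mult_mem')
  qed
  moreover have "{..p} = insert 0 (insert p {1..<p})"
    using p1 by auto
  then have "(a + b) ^ p = b ^ p + a ^ p + (\<Sum>k\<in>{1..<p}. of_nat (p choose k) * a ^ k * b ^ (p - k))"
    using p1 by (simp add: binomial_ring)
  ultimately show ?thesis
    by (simp add: eqm_def)
qed

lemma dream_power: "(a + b) ^ (p ^ k) \<triangleq> a ^ (p ^ k) + b ^ (p ^ k)"
proof (induction k)
  case (Suc k)
  have "(a + b) ^ (p ^ Suc k) = ((a + b) ^ (p ^ k)) ^ p"
    by (metis power_mult power_Suc mult.commute)
  also have "\<dots> \<triangleq> (a ^ (p ^ k) + b ^ (p ^ k)) ^ p"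
    by (intro eqm_power Suc)
  also have "\<dots> \<triangleq> (a ^ (p ^ k)) ^ p + (b ^ (p ^ k)) ^ p"
    by (rule dream)
  also have "\<dots> = a ^ (p ^ Suc k) + b ^ (p ^ Suc k)"
    by (metis power_mult power_Suc mult.commute)
  finally show ?case .
qed simp

lemma dream_sum: "(\<Sum>x\<in>A. f x) ^ (p ^ k) \<triangleq> (\<Sum>x\<in>A. f x ^ (p ^ k))"
proof (induction A rule: infinite_finite_induct)
  case (insert x A)
  then show ?case
    using eqm_trans[OF dream_power eqm_add[OF eqm_refl insert.IH]] by simp
qed (use prime_p in \<open>auto simp: prime_gt_0_nat zero_power\<close>)

text \<open>Additivity, applied to \<open>(a - b) + b\<close>, reduces the claim to a power of
  \<open>a - b\<close> lying in a prime ideal. It serves to cancel a Frobenius power from both sides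
  of a congruence.\<close>

lemma power_inj: "a ^ (p ^ k) \<triangleq> b ^ (p ^ k) \<Longrightarrow> a \<triangleq> b"
proof -
  assume *: "a ^ (p ^ k) \<triangleq> b ^ (p ^ k)"
  have "a ^ (p ^ k) \<triangleq> (a - b) ^ (p ^ k) + b ^ (p ^ k)"
    using dream_power[of "a - b" b k] by simp
  with * have "(a - b) ^ (p ^ k) + b ^ (p ^ k) \<triangleq> b ^ (p ^ k)"
    using eqm_sym eqm_trans by blast
  then have "(a - b) ^ (p ^ k) \<in> I"
    by (simp add: eqm_def)
  then show ?thesis
    by (simp add: eqm_def power_mem)
qed

lemma of_int_mem: "int p dvd c \<Longrightarrow> of_int c \<in> I"
  by (auto elim!: dvdE intro!: mult_mem'[OF p_mem])

lemma of_int_eqm: "[c = d] (mod int p) \<Longrightarrow> of_int c \<triangleq> of_int d"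
  using of_int_mem[of "c - d"] by (simp add: eqm_def cong_iff_dvd_diff)

lemma of_int_mem_iff: "of_int c \<in> I \<longleftrightarrow> int p dvd c"
proof
  assume c: "of_int c \<in> I"
  show "int p dvd c"
  proof (rule ccontr)
    assume "\<not> int p dvd c"
    then have "coprime (int p) c"
      using prime_p by (intro prime_imp_coprime) auto
    then obtain u v where "u * int p + v * c = 1"
      using bezout_int[of "int p" c] by auto
    then have "of_int (u * int p + v * c) = (1::'a)"
      by simp
    then have "of_int u * of_nat p + of_int v * of_int c = (1::'a)"
      by simp
    then show False
      using one_not_mem add_mem[OF mult_mem[OF p_mem] mult_mem[OF c]] by metis
  qed
qed (rule of_int_mem)

lemma fermat_int: "of_int c ^ (p ^ k) \<triangleq> of_int c"
proof (induction k)
  case (Suc k)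
  have "[c ^ p = c] (mod int p)"
  proof -
    define a where "a = nat (c mod int p)"
    have a: "[c = int a] (mod int p)"
      using prime_p by (simp add: a_def cong_def prime_gt_0_nat)
    have "[a ^ p = a] (mod p)"
    proof (cases "p dvd a")
      case True
      then have "p dvd a ^ p"
        using prime_p by (simp add: dvd_power prime_gt_0_nat dvd_trans)
      then show ?thesis
        using True by (simp add: cong_def mod_eq_0_iff_dvd)
    next
      case False
      then have "[a * a ^ (p - 1) = a * 1] (mod p)"
        using prime_p by (intro cong_scalar_left fermat_theorem)
      moreover have "a * a ^ (p - 1) = a ^ p"
        using prime_p by (metis power_eq_if not_prime_0)
      ultimately show ?thesis
        by simp
    qed
    then have "[int a ^ p = int a] (mod int p)"
      by (metis cong_int_iff of_nat_power)
    then show ?thesis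
      using a by (meson cong_pow cong_sym cong_trans)
  qed
  then have *: "of_int c ^ p \<triangleq> of_int c"
    using of_int_eqm by fastforce
  have "of_int c ^ (p ^ Suc k) = (of_int c ^ (p ^ k)) ^ p"
    by (metis power_mult power_Suc mult.commute)
  also have "\<dots> \<triangleq> of_int c ^ p"
    by (intro eqm_power Suc)
  also note *
  finally show ?case .
qed simp

end

section \<open>Integer polynomials modulo a prime\<close>

locale prime_modulus =
  fixes p :: nat
  assumes prime_p: "prime p"
begin

definition modp :: "int poly set" where
  "modp = {f. [:int p:] dvd f}"

definition pideal :: "int poly \<Rightarrow> int poly set" where
  "pideal P = {f. \<exists>g h. f = P * g + [:int p:] * h}"

definition red :: "int poly \<Rightarrow> int poly" where
  "red f = map_poly (\<lambda>c. c mod int p) f"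

definition reduced :: "nat \<Rightarrow> int poly set" where
  "reduced d = {f. (\<forall>i. coeff f i \<in> {0..<int p}) \<and> (\<forall>i\<ge>d. coeff f i = 0)}"

definition monics :: "nat \<Rightarrow> int poly set" where
  "monics d = {f. (\<forall>i. coeff f i \<in> {0..<int p}) \<and> degree f = d \<and> lead_coeff f = 1}"

text \<open>\<open>P\<close> itself is the canonical representative of its class modulo
  \<open>p\<close>, so different members are different primes. Divisibility modulo \<open>p\<close>
  is membership in \<open>pideal Q\<close>, tested for every monic integer polynomial
  \<open>Q\<close> of smaller positive degree.\<close>

definition Irr :: "int poly set" where
  "Irr = {P. P \<in> monics (degree P) \<and> 0 < degree P \<and>
     (\<forall>Q. lead_coeff Q = 1 \<longrightarrow> 0 < degree Q \<longrightarrow> degree Q < degree P \<longrightarrow> P \<notin> pideal Q)}"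

lemma p_gt_0: "0 < int p" and p_gt_1: "1 < int p"
  using prime_gt_1_nat[OF prime_p] by auto

lemma modp_iff: "f \<in> modp \<longleftrightarrow> (\<forall>i. int p dvd coeff f i)"
  by (simp add: modp_def const_poly_dvd_iff)

lemma modp_prime: "f * g \<in> modp \<Longrightarrow> f \<in> modp \<or> g \<in> modp"
proof -
  have "prime_elem [:int p:]"
    using prime_p by (simp add: prime_elem_const_poly_iff)
  then show "f * g \<in> modp \<Longrightarrow> f \<in> modp \<or> g \<in> modp"
    by (simp add: modp_def prime_elem_dvd_mult_iff)
qed

lemma of_nat_p: "of_nat p = [:int p:]"
  by (simp add: of_nat_poly)

lemma prime_ideal_modp: "prime_ideal_char modp p"
proof
  show "1 \<notin> modp"
    using p_gt_1 by (auto simp: modp_iff coeff_1 intro!: exI[of _ 0])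
qed (use modp_prime prime_p in \<open>auto simp: modp_def of_nat_p\<close>)

lemma coeff_red: "coeff (red f) i = coeff f i mod int p"
  by (simp add: red_def coeff_map_poly)

lemma red_diff: "f - red f \<in> modp"
  by (auto simp: modp_iff coeff_red)

lemma red_eq_iff: "red f = red g \<longleftrightarrow> f - g \<in> modp"
  by (auto simp: modp_iff poly_eq_iff coeff_red mod_eq_dvd_iff)

lemma red_range: "coeff (red f) i \<in> {0..<int p}"
  using p_gt_0 by (simp add: coeff_red)

lemma red_id: "(\<And>i. coeff f i \<in> {0..<int p}) \<Longrightarrow> red f = f"
  by (auto simp: poly_eq_iff coeff_red)

lemma degree_red_le: "degree (red f) \<le> degree f"
  by (intro degree_le) (auto simp: coeff_red coeff_eq_0)

lemma red_eq_0_iff: "red f = 0 \<longleftrightarrow> f \<in> modp"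
  using red_eq_iff[of f 0] by (simp add: red_def[of 0])

lemma red_monic:
  assumes "lead_coeff f = 1"
  shows "red f \<in> monics (degree f)"
proof -
  have "coeff (red f) (degree f) = 1"
    using assms p_gt_1 by (simp add: coeff_red)
  moreover from this have "degree (red f) = degree f"
    using degree_red_le[of f] le_degree[of "red f" "degree f"] by simp
  ultimately show ?thesis
    using red_range by (simp add: monics_def)
qed

lemma monicsD:
  assumes "f \<in> monics d"
  shows "degree f = d" "lead_coeff f = 1" "red f = f" "coeff f d = 1" "f \<noteq> 0"
  using assms by (auto simp: monics_def intro!: red_id)

lemma modp_subset: "f \<in> modp \<Longrightarrow> f \<in> pideal P"
proof -
  assume "f \<in> modp"
  then obtain h where "f = P * 0 + [:int p:] * h"
    by (metis modp_def dvd_def mem_Collect_eq mult_zero_right add_0)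
  then show "f \<in> pideal P"
    unfolding pideal_def by blast
qed

lemma pideal_self: "P * g \<in> pideal P"
proof -
  have "P * g = P * g + [:int p:] * 0"
    by simp
  then show ?thesis
    unfolding pideal_def by blast
qed

lemma pideal_add:
  assumes "f \<in> pideal P" "g \<in> pideal P"
  shows "f + g \<in> pideal P"
proof -
  obtain a b c d where "f = P * a + [:int p:] * b" "g = P * c + [:int p:] * d"
    using assms by (auto simp: pideal_def)
  then have "f + g = P * (a + c) + [:int p:] * (b + d)"
    by (simp only: algebra_simps)
  then show ?thesis
    unfolding pideal_def by blast
qed

lemma pideal_mult:
  assumes "f \<in> pideal P"
  shows "g * f \<in> pideal P"
proof -
  obtain a b where "f = P * a + [:int p:] * b"
    using assms by (auto simp: pideal_def)
  then have "g * f = P * (g * a) + [:int p:] * (g * b)"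
    by (simp only: algebra_simps)
  then show ?thesis
    unfolding pideal_def by blast
qed

lemma pideal_diff: "\<lbrakk>f \<in> pideal P; g \<in> pideal P\<rbrakk> \<Longrightarrow> f - g \<in> pideal P"
  using pideal_add[OF _ pideal_mult[of g P "-1"]] by simp

lemma pideal_cong: "f - g \<in> modp \<Longrightarrow> f \<in> pideal P \<longleftrightarrow> g \<in> pideal P"
  using pideal_add[of g P "f - g"] pideal_diff[of f P "f - g"] modp_subset[of "f - g" P] by auto

lemma pideal_red: "red f \<in> pideal P \<longleftrightarrow> f \<in> pideal P"
  using pideal_cong[OF red_diff] by blast

lemma pideal_trans:
  assumes "P \<in> pideal Q" "f \<in> pideal P"
  shows "f \<in> pideal Q"
proof -
  obtain g h where "f = P * g + [:int p:] * h"
    using assms(2) by (auto simp: pideal_def)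
  moreover have "[:int p:] * h \<in> pideal Q"
    by (intro modp_subset) (simp add: modp_def del: mult_pCons_left)
  moreover have "P * g \<in> pideal Q"
    using pideal_mult[OF assms(1), of g] by (simp only: mult.commute)
  ultimately show ?thesis
    by (simp only: pideal_add)
qed

lemma pideal_gen_cong:
  assumes "P - Q \<in> modp"
  shows "pideal P = pideal Q"
proof -
  have *: "P - Q \<in> modp \<Longrightarrow> P \<in> pideal Q" for P Q
    using pideal_cong[of P Q Q] pideal_self[of Q 1] by simp
  have "Q - P \<in> modp"
    using assms by (metis minus_diff_eq modp_iff coeff_minus dvd_minus_iff)
  then show ?thesis
    using *[OF assms] *[of Q P] pideal_trans by blast
qed

lemma pideal_iff: "f \<in> pideal P \<longleftrightarrow> (\<exists>g. f - P * g \<in> modp)"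
proof
  assume "f \<in> pideal P"
  then obtain g h where "f = P * g + [:int p:] * h"
    by (auto simp: pideal_def)
  then have "f - P * g = [:int p:] * h"
    by simp
  then have "f - P * g \<in> modp"
    unfolding modp_def by (metis dvd_triv_left mem_Collect_eq)
  then show "\<exists>g. f - P * g \<in> modp" ..
next
  assume "\<exists>g. f - P * g \<in> modp"
  then show "f \<in> pideal P"
    using pideal_cong pideal_self by blast
qed

lemma monic_division:
  assumes "lead_coeff (Q::int poly) = 1"
  obtains g r where "f = Q * g + r" "r = 0 \<or> degree r < degree Q"
proof -
  have Q: "Q \<noteq> 0"
    using assms by auto
  obtain g r where gr: "pseudo_divmod f Q = (g, r)"
    by fastforce
  show thesis
    using pseudo_divmod[OF Q gr] assms that by auto
qed

text \<open>Once the cofactor is reduced, its leading coefficient is nonzero modulo \<open>p\<close>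
  and, \<open>Q\<close> being monic, is the top coefficient of the product, which therefore cannot
  drop below the degree of \<open>Q\<close>. This converts congruence modulo \<open>Q\<close> of
  small representatives into congruence modulo \<open>p\<close>.\<close>

lemma pideal_small:
  assumes "lead_coeff Q = 1" "f \<in> pideal Q" "f = 0 \<or> degree f < degree Q"
  shows "f \<in> modp"
proof (rule ccontr)
  assume f: "f \<notin> modp"
  obtain g where g: "f - Q * g \<in> modp"
    using assms(2) pideal_iff by blast
  interpret prime_ideal_char modp p
    by (rule prime_ideal_modp)
  have "Q * (g - red g) \<in> modp"
    by (intro mult_mem red_diff)
  from add_mem[OF g this] have fg: "f - Q * red g \<in> modp"
    by (simp add: algebra_simps)
  have "red g \<noteq> 0"
    using f fg by auto
  define n where "n = degree Q + degree (red g)"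
  have "coeff (Q * red g) n = lead_coeff (red g)"
    using assms(1) by (simp add: n_def coeff_mult_degree_sum)
  moreover have "coeff f n = 0"
    using assms(3) f zero_mem by (auto simp: n_def intro!: coeff_eq_0)
  ultimately have "int p dvd lead_coeff (red g)"
    using fg by (metis modp_iff coeff_diff diff_0 dvd_minus_iff)
  moreover have "lead_coeff (red g) \<in> {0..<int p}"
    by (rule red_range)
  ultimately show False
    using \<open>red g \<noteq> 0\<close> zdvd_imp_le[of "int p" "lead_coeff (red g)"]
    by (metis atLeastLessThan_iff leading_coeff_0_iff linorder_not_less order_le_less)
qed

lemma monic_associate:
  assumes "f \<notin> modp"
  obtains u v g where "lead_coeff g = 1" "degree g \<le> degree f"
    "smult u f - g \<in> modp" "f - smult v g \<in> modp"
proof -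
  interpret prime_ideal_char modp p
    by (rule prime_ideal_modp)
  have nz: "red f \<noteq> 0"
    using assms red_eq_0_iff by blast
  define c where "c = lead_coeff (red f)"
  have c: "c \<in> {0..<int p}" "c \<noteq> 0"
    using red_range nz by (auto simp: c_def)
  then have "\<not> int p dvd c"
    using zdvd_imp_le[of "int p" c] by auto
  then have "coprime c (int p)"
    using prime_p by (metis coprime_commute prime_imp_coprime prime_nat_int_transfer)
  then obtain u where u: "[c * u = 1] (mod int p)"
    using cong_solve_coprime_int by blast
  define g where "g = red (smult u (red f))"
  have lc: "coeff g (degree (red f)) = 1"
    using u p_gt_1 by (simp add: g_def coeff_red c_def cong_def mult.commute)
  have deg: "degree g \<le> degree (red f)"
    unfolding g_def by (rule order.trans[OF degree_red_le degree_smult_le])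
  show thesis
  proof (rule that[of g u c])
    show "lead_coeff g = 1"
      using lc deg by (metis le_degree order_antisym zero_neq_one)
    show "degree g \<le> degree f"
      using deg degree_red_le[of f] by linarith
    have ug: "smult u (red f) - g \<in> modp"
      unfolding g_def by (rule red_diff)
    have uf: "smult u (f - red f) \<in> modp"
      using mult_mem[OF red_diff, of "[:u:]" f] by simp
    show *: "smult u f - g \<in> modp"
      using add_mem[OF ug uf] by (simp add: smult_diff_right)
    have "smult (c * u - 1) f \<in> modp"
      using u by (auto simp: modp_iff cong_iff_dvd_diff)
    moreover have "smult c (smult u f - g) \<in> modp"
      using mult_mem[OF *, of "[:c:]"] by simp
    ultimately show "f - smult c g \<in> modp"
      using diff_mem[of "smult c (smult u f - g)" "smult (c * u - 1) f"]
      by (simp add: smult_diff_right smult_diff_left)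
  qed
qed

lemma IrrD:
  assumes "P \<in> Irr"
  shows "lead_coeff P = 1" "0 < degree P" "red P = P" "P \<in> monics (degree P)"
  using assms monicsD[of P "degree P"] by (auto simp: Irr_def)

text \<open>Euclidean argument modulo \<open>p\<close>: a monic combination \<open>h\<close> of
  least degree divides every combination, in particular \<open>P\<close> and \<open>f\<close>. If
  \<open>h\<close> were nonconstant, irreducibility would force it to agree with \<open>P\<close>
  modulo \<open>p\<close>, and \<open>P\<close> would divide \<open>f\<close>. Division over the
  integers wants a monic divisor, hence the normalization built into \<open>S\<close>.\<close>

lemma Irr_bezout:
  assumes P: "P \<in> Irr" and f: "f \<notin> pideal P"
  obtains u v where "1 - (P * u + f * v) \<in> modp"
proof -
  interpret prime_ideal_char modp p
    by (rule prime_ideal_modp)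
  define S where "S = {h. lead_coeff h = 1 \<and> (\<exists>u v. h - (P * u + f * v) \<in> modp)}"
  have PS: "P \<in> S"
  proof -
    have "P - (P * 1 + f * 0) \<in> modp"
      by (simp add: zero_mem)
    then show ?thesis
      using IrrD(1)[OF P] unfolding S_def by blast
  qed
  obtain h where hS: "h \<in> S" and hmin: "\<And>k. k \<in> S \<Longrightarrow> degree h \<le> degree k"
    using arg_min_nat_lemma[of "\<lambda>h. h \<in> S", OF PS] by metis
  obtain u v where h1: "lead_coeff h = 1" and uv: "h - (P * u + f * v) \<in> modp"
    using hS by (auto simp: S_def)
  have div: "g \<in> pideal h" if ab: "g = P * a + f * b" for g a b
  proof -
    obtain q r where qr: "g = h * q + r" "r = 0 \<or> degree r < degree h"
      using monic_division[OF h1] by blast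
    \<comment> \<open>Otherwise the remainder, rescaled to be monic, would be a combination of
      degree below that of \<open>h\<close>.\<close>
    have "r \<in> modp"
    proof (rule ccontr)
      assume r: "r \<notin> modp"
      then obtain w w' k where k: "lead_coeff k = 1" "degree k \<le> degree r" "smult w r - k \<in> modp"
        by (rule monic_associate)
      define W where "W = [:w:]"
      have "- ((h - (P * u + f * v)) * (W * q) + (smult w r - k)) \<in> modp"
        by (intro add_mem mult_mem' uminus_mem uv k)
      moreover have "smult w r = W * (P * a + f * b - h * q)"
        using qr(1) ab by (simp add: W_def)
      ultimately have "k - (P * (W * (a - u * q)) + f * (W * (b - v * q))) \<in> modp"
        by (simp add: algebra_simps)
      then have "k \<in> S"
        using k(1) unfolding S_def by blast
      then show False
        using hmin[of k] k(2) qr(2) r zero_mem by auto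
    qed
    then show ?thesis
      using qr(1) by (simp add: pideal_add pideal_self modp_subset)
  qed
  have Ph: "P \<in> pideal h" and fh: "f \<in> pideal h"
    using div[of P 1 0] div[of f 0 1] by auto
  have "degree h = 0"
  proof (rule ccontr)
    assume "degree h \<noteq> 0"
    then have "\<not> degree h < degree P"
      using P Ph h1 by (auto simp: Irr_def)
    then have deg: "degree h = degree P"
      using hmin[OF PS] by simp
    have "P - h \<in> modp"
    proof (rule pideal_small[OF h1])
      show "P - h \<in> pideal h"
        using pideal_diff[OF Ph pideal_self[of h 1]] by simp
      have "degree (P - h) \<le> degree h"
        using deg by (intro degree_diff_le) auto
      moreover have "coeff (P - h) (degree h) = 0"
        using h1 deg IrrD(1)[OF P] by simp
      ultimately show "P - h = 0 \<or> degree (P - h) < degree h"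
        using eq_zero_or_degree_less by blast
    qed
    then show False
      using fh f pideal_gen_cong by blast
  qed
  then have "h = 1"
    using h1 by (metis degree_eq_zeroE lead_coeff_pCons(2) one_pCons pCons_0_0)
  with uv that show thesis
    by blast
qed

lemma prime_ideal_Irr:
  assumes P: "P \<in> Irr"
  shows "prime_ideal_char (pideal P) p"
proof
  show "0 \<in> pideal P"
    using pideal_self[of P 0] by simp
  show "1 \<notin> pideal P"
  proof
    assume "1 \<in> pideal P"
    then have "1 \<in> modp"
      using IrrD[OF P] by (intro pideal_small[of P]) auto
    then show False
      using prime_ideal_set.one_not_mem prime_ideal_modp prime_ideal_char.axioms(1) by blast
  qed
  show "a \<in> pideal P \<or> b \<in> pideal P" if ab: "a * b \<in> pideal P" for a b
  proof (rule disjCI)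
    assume "b \<notin> pideal P"
    then obtain u v where uv: "1 - (P * u + b * v) \<in> modp"
      by (rule Irr_bezout[OF P])
    have "a * (1 - (P * u + b * v)) + P * (a * u) + v * (a * b) \<in> pideal P"
      by (intro pideal_add pideal_mult ab pideal_self modp_subset uv)
    moreover have "a * (1 - (P * u + b * v)) + P * (a * u) + v * (a * b) = a"
      by (simp add: algebra_simps)
    ultimately show "a \<in> pideal P"
      by simp
  qed
  show "of_nat p \<in> pideal P"
    by (intro modp_subset) (simp add: of_nat_p modp_def)
qed (use prime_p in \<open>auto intro: pideal_add pideal_mult\<close>)

end

lemma degree_monic_mult: "\<lbrakk>lead_coeff (f :: 'a::idom poly) = 1; g \<noteq> 0\<rbrakk> \<Longrightarrow> degree (f * g) = degree f + degree g"
  by (intro degree_mult_eq) auto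

lemma degree_monic_power: "lead_coeff (f :: 'a::idom poly) = 1 \<Longrightarrow> degree (f ^ j) = j * degree f"
  by (intro degree_power_eq) auto

lemma lead_coeff_monic_mult:
  "\<lbrakk>lead_coeff (f :: 'a::idom poly) = 1; lead_coeff g = 1\<rbrakk> \<Longrightarrow> lead_coeff (f * g) = 1"
  by (metis lead_coeff_mult mult_1)

lemma lead_coeff_monic_power: "lead_coeff (f :: 'a::idom poly) = 1 \<Longrightarrow> lead_coeff (f ^ j) = 1"
  by (metis lead_coeff_power power_one)

context prime_modulus
begin

section \<open>Counting residues, and factors of monic polynomials\<close>

lemma bij_reduced: "bij_betw (\<lambda>f. restrict (coeff f) {..<d}) (reduced d) ({..<d} \<rightarrow>\<^sub>E {0..<int p})"
proof (rule bij_betw_imageI)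
  show "inj_on (\<lambda>f. restrict (coeff f) {..<d}) (reduced d)"
  proof (rule inj_onI)
    fix f g
    assume fg: "f \<in> reduced d" "g \<in> reduced d" "restrict (coeff f) {..<d} = restrict (coeff g) {..<d}"
    have "coeff f i = coeff g i" for i
    proof (cases "i < d")
      case True
      then show ?thesis
        using fun_cong[OF fg(3), of i] by simp
    next
      case False
      then show ?thesis
        using fg by (simp add: reduced_def)
    qed
    then show "f = g"
      by (simp add: poly_eq_iff)
  qed
  show "(\<lambda>f. restrict (coeff f) {..<d}) ` reduced d = {..<d} \<rightarrow>\<^sub>E {0..<int p}"
  proof (intro equalityI subsetI)
    fix h assume h: "h \<in> {..<d} \<rightarrow>\<^sub>E {0..<int p}"
    define f where "f = (\<Sum>i<d. monom (h i) i)"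
    have c: "coeff f i = (if i < d then h i else 0)" for i
      by (simp add: f_def coeff_sum if_distrib cong: if_cong)
    have "f \<in> reduced d"
      using h p_gt_0 by (auto simp: reduced_def c PiE_iff)
    moreover have "restrict (coeff f) {..<d} = h"
      using h by (auto simp: c fun_eq_iff restrict_def PiE_iff extensional_def)
    ultimately show "h \<in> (\<lambda>f. restrict (coeff f) {..<d}) ` reduced d"
      by blast
  qed (auto simp: reduced_def split: if_splits)
qed

lemma finite_reduced: "finite (reduced d)"
  using bij_betw_finite[OF bij_reduced] by (simp add: finite_PiE)

lemma card_reduced: "card (reduced d) = p ^ d"
  using bij_betw_same_card[OF bij_reduced, of d] by (simp add: card_PiE)

lemma monics_eq: "monics d = (\<lambda>g. monom 1 d + g) ` reduced d"
proof (intro equalityI subsetI)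
  fix f assume f: "f \<in> monics d"
  have "coeff f i \<in> {0..<int p}" for i
    using f by (auto simp: monics_def)
  moreover have "coeff f i = 0" if "i > d" for i
    using f that by (auto simp: monics_def intro: coeff_eq_0)
  ultimately have "f - monom 1 d \<in> reduced d"
    using monicsD(4)[OF f] p_gt_0 by (auto simp: reduced_def le_less)
  then show "f \<in> (\<lambda>g. monom 1 d + g) ` reduced d"
    by (intro image_eqI[of _ _ "f - monom 1 d"]) auto
next
  fix f assume "f \<in> (\<lambda>g. monom 1 d + g) ` reduced d"
  then obtain g where g: "g \<in> reduced d" "f = monom 1 d + g"
    by blast
  have "coeff f d = 1" "\<And>i. i > d \<Longrightarrow> coeff f i = 0"
    using g by (auto simp: reduced_def)
  then have "degree f = d"
    by (metis degree_le le_antisym le_degree zero_neq_one)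
  moreover have "coeff f i \<in> {0..<int p}" for i
    using g p_gt_1 by (auto simp: reduced_def)
  ultimately show "f \<in> monics d"
    using \<open>coeff f d = 1\<close> by (simp add: monics_def)
qed

lemma finite_monics: "finite (monics d)"
  by (simp add: monics_eq finite_reduced)

lemma card_monics: "card (monics d) = p ^ d"
  by (simp add: monics_eq card_image inj_on_def card_reduced)

lemma reduced_eqI: "\<lbrakk>f \<in> reduced d; g \<in> reduced e; f - g \<in> modp\<rbrakk> \<Longrightarrow> f = g"
  using red_eq_iff[of f g] red_id[of f] red_id[of g] by (auto simp: reduced_def)

lemma monics_eqI: "\<lbrakk>f \<in> monics d; g \<in> monics e; f - g \<in> modp\<rbrakk> \<Longrightarrow> f = g"
  using red_eq_iff[of f g] monicsD(3) by metis

lemma monic_notin_modp: "lead_coeff f = 1 \<Longrightarrow> f \<notin> modp"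
  using p_gt_1 by (auto simp: modp_iff intro!: exI[of _ "degree f"])

lemma modp_cancel: "\<lbrakk>f * g \<in> modp; lead_coeff f = 1\<rbrakk> \<Longrightarrow> g \<in> modp"
  using modp_prime monic_notin_modp by blast

lemma monics_0 [simp]: "monics 0 = {1}"
proof -
  have "f = 1" if "f \<in> monics 0" for f
    using that by (auto simp: monics_def elim!: degree_eq_zeroE)
  moreover have "1 \<in> monics 0"
    using p_gt_1 by (auto simp: monics_def coeff_1)
  ultimately show ?thesis
    by blast
qed

text \<open>A monic divisor of least positive degree, reduced modulo \<open>p\<close>, will do: a
  smaller divisor of it would also divide \<open>f\<close>.\<close>

lemma Irr_factor:
  assumes "lead_coeff f = 1" "0 < degree f"
  obtains P where "P \<in> Irr" "f \<in> pideal P"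
proof -
  define S where "S = {Q. lead_coeff Q = 1 \<and> 0 < degree Q \<and> f \<in> pideal Q}"
  have "f \<in> S"
    using assms pideal_self[of f 1] by (simp add: S_def)
  then obtain Q where Q: "Q \<in> S" "\<And>R. R \<in> S \<Longrightarrow> degree Q \<le> degree R"
    using arg_min_nat_lemma[of "\<lambda>h. h \<in> S"] by metis
  have red: "red Q \<in> monics (degree Q)"
    using Q(1) by (intro red_monic) (simp add: S_def)
  have id: "pideal (red Q) = pideal Q"
    using pideal_gen_cong[OF red_diff] by simp
  have "red Q \<in> Irr"
    unfolding Irr_def
  proof (safe intro!: CollectI)
    show "red Q \<in> monics (degree (red Q))" "0 < degree (red Q)"
      using red monicsD(1)[OF red] Q(1) by (auto simp: S_def)
    fix R assume R: "lead_coeff R = 1" "0 < degree R" "degree R < degree (red Q)" "red Q \<in> pideal R"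
    have "f \<in> pideal R"
      using pideal_trans[OF R(4)] Q(1) id by (auto simp: S_def)
    then have "R \<in> S"
      using R by (simp add: S_def)
    then show False
      using Q(2)[of R] R(3) monicsD(1)[OF red] by simp
  qed
  with that show thesis
    using Q(1) id by (auto simp: S_def)
qed

text \<open>Supplies a canonical cofactor, so that divisibility becomes an equality of
  representatives and sums over multiples can be reindexed. The remainder of the integral division
  lies in \<open>modp\<close> by \<open>pideal_small\<close>; degree and leading coefficient of the
  quotient are read off from \<open>f\<close>.\<close>

lemma cofactor:
  assumes f: "f \<in> monics r" and Q: "lead_coeff Q = 1" and fQ: "f \<in> pideal Q"
  obtains g where "degree Q \<le> r" "g \<in> monics (r - degree Q)" "red (Q * g) = f"
proof -
  interpret prime_ideal_char modp p
    by (rule prime_ideal_modp)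
  have deg: "degree Q \<le> r"
    using pideal_small[OF Q fQ] monic_notin_modp[of f] monicsD[OF f] by force
  obtain q t where qt: "f = Q * q + t" "t = 0 \<or> degree t < degree Q"
    using monic_division[OF Q] by blast
  have "t \<in> pideal Q"
    using pideal_diff[OF fQ pideal_self[of Q q]] qt(1) by simp
  then have t: "t \<in> modp"
    using pideal_small[OF Q _ qt(2)] by blast
  have "q \<noteq> 0"
    using qt(1) t monic_notin_modp[of f] monicsD[OF f] by auto
  then have dq: "degree (Q * q) = degree Q + degree q"
    using Q by (intro degree_mult_eq) auto
  have "degree f = degree (Q * q) \<and> lead_coeff f = lead_coeff (Q * q)"
  proof (cases "t = 0")
    case False
    then have "degree t < degree (Q * q)"
      using qt(2) dq by simp
    then show ?thesis
      unfolding qt(1) by (simp add: degree_add_eq_left coeff_eq_0)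
  qed (simp add: qt)
  then have q: "degree q = r - degree Q" "lead_coeff q = 1"
    using dq monicsD[OF f] Q lead_coeff_mult[of Q q] by auto
  have "Q * red q - f = - (Q * (q - red q) + t)"
    using qt(1) by (simp add: algebra_simps)
  then have "Q * red q - f \<in> modp"
    by (simp add: uminus_mem add_mem mult_mem red_diff t del: minus_add_distrib)
  then have "red (Q * red q) = f"
    using red_eq_iff monicsD(3)[OF f] by metis
  with that deg red_monic[OF q(2)] q(1) show thesis
    by auto
qed

lemma red_mult_monics:
  assumes "lead_coeff f = 1" "g \<in> monics b"
  shows "red (f * g) \<in> monics (degree f + b)"
proof -
  have "degree (f * g) = degree f + b" "lead_coeff (f * g) = 1"
    using lead_coeff_monic_mult[OF assms(1) monicsD(2)[OF assms(2)]]
      degree_monic_mult[OF assms(1) monicsD(5)[OF assms(2)]] monicsD(1)[OF assms(2)] by simp_all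
  then show ?thesis
    using red_monic[of "f * g"] by simp
qed

section \<open>Unique factorization and power sums\<close>

text \<open>Multiplicities without valuations: a prime \<open>P\<close> occurs in exactly as many
  pairs as its exponent in \<open>f\<close>.\<close>

definition prime_powers_dividing :: "int poly \<Rightarrow> (int poly \<times> nat) set" where
  "prime_powers_dividing f = {(P, j). P \<in> Irr \<and> 1 \<le> j \<and> f \<in> pideal (P ^ j)}"

lemma pideal_mult_cancel: 
  assumes "lead_coeff Q = 1"
  shows "Q * g \<in> pideal (Q * R) \<longleftrightarrow> g \<in> pideal R"
proof -
  interpret prime_ideal_char modp p
    by (rule prime_ideal_modp)
  have "Q * g - Q * R * h \<in> modp \<longleftrightarrow> g - R * h \<in> modp" for h
  proof -
    have e: "Q * g - Q * R * h = Q * (g - R * h)"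
      by (simp add: algebra_simps)
    show ?thesis
      unfolding e using modp_cancel[OF _ assms] mult_mem by blast
  qed
  then show ?thesis
    by (simp add: pideal_iff)
qed

lemma Irr_notin_pideal:
  assumes "P \<in> Irr" "Q \<in> Irr" "P \<noteq> Q"
  shows "Q \<notin> pideal P"
proof
  assume Q: "Q \<in> pideal P"
  have "\<not> degree P < degree Q"
    using Q assms IrrD[OF assms(1)] by (auto simp: Irr_def)
  moreover have "\<not> degree Q < degree P"
    using pideal_small[OF IrrD(1)[OF assms(1)] Q] monic_notin_modp IrrD[OF assms(2)] by blast
  ultimately have deg: "degree P = degree Q"
    by simp
  have "Q - P \<in> modp"
  proof (rule pideal_small[OF IrrD(1)[OF assms(1)]])
    show "Q - P \<in> pideal P"
      using pideal_diff[OF Q pideal_self[of P 1]] by simp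
    have "degree (Q - P) \<le> degree P"
      using deg by (intro degree_diff_le) auto
    moreover have "coeff (Q - P) (degree P) = 0"
      using deg IrrD(1)[OF assms(1)] IrrD(1)[OF assms(2)] by simp
    ultimately show "Q - P = 0 \<or> degree (Q - P) < degree P"
      using eq_zero_or_degree_less by blast
  qed
  then show False
    using monics_eqI IrrD(4) assms by metis
qed

text \<open>Euclid's lemma for prime powers: one factor \<open>P\<close> is split off at a time, and
  primality applies to the remaining cofactor.\<close>

lemma pideal_power_cancel:
  assumes "P \<in> Irr" "Q \<notin> pideal P" "Q * g \<in> pideal (P ^ j)"
  shows "g \<in> pideal (P ^ j)"
  using assms(3)
proof (induction j)
  case 0
  then show ?case
    using pideal_self[of 1 g] by simp
next
  case (Suc j)
  interpret prime_ideal_char "pideal P" p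
    using assms(1) by (rule prime_ideal_Irr)
  have lc: "lead_coeff (P ^ j) = 1"
    using IrrD(1)[OF assms(1)] by (simp add: lead_coeff_power)
  have "Q * g \<in> pideal (P ^ j)"
    using pideal_trans[OF _ Suc.prems] pideal_self[of "P ^ j" P] by (simp add: mult.commute)
  then have "g \<in> pideal (P ^ j)"
    by (rule Suc.IH)
  then obtain h where h: "g - P ^ j * h \<in> modp"
    using pideal_iff by blast
  then have "Q * (g - P ^ j * h) \<in> modp"
    using prime_ideal_set.mult_mem[OF prime_ideal_char.axioms(1)[OF prime_ideal_modp]] by blast
  then have "Q * g - P ^ j * (Q * h) \<in> modp"
    by (simp add: algebra_simps)
  then have "P ^ j * (Q * h) \<in> pideal (P ^ j * P)"
    using Suc.prems pideal_cong by (simp add: mult.commute)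
  then have "Q * h \<in> pideal P"
    using pideal_mult_cancel[OF lc] by blast
  then have "h \<in> pideal P"
    using assms(2) prime_mem by blast
  then have "P ^ j * h \<in> pideal (P ^ j * P)"
    using pideal_mult_cancel[OF lc] by blast
  then show ?case
    using pideal_cong[OF h] by (simp add: mult.commute)
qed

text \<open>Counterpart of the identity that the von Mangoldt function, summed over the divisors of
  a number, is its logarithm; the degree plays the logarithm. The induction removes one prime factor
  \<open>Q\<close> of \<open>f\<close>.\<close>

lemma sum_prime_powers_dividing:
  assumes "f \<in> monics r"
  shows "finite (prime_powers_dividing f) \<and> (\<Sum>(P, j)\<in>prime_powers_dividing f. degree P) = r"
  using assms
proof (induction r arbitrary: f rule: less_induct)
  case (less r)
  show ?case
  proof (cases "r = 0")
    case True
    then have f: "f = 1"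
      using less.prems by simp
    have "f \<notin> pideal (P ^ j)" if "P \<in> Irr" "1 \<le> j" for P j
    proof
      assume *: "f \<in> pideal (P ^ j)"
      have "f \<in> modp"
      proof (rule pideal_small[OF _ *])
        show "lead_coeff (P ^ j) = 1"
          using IrrD(1)[OF that(1)] by (simp add: lead_coeff_power)
        show "f = 0 \<or> degree f < degree (P ^ j)"
          using IrrD[OF that(1)] that(2) by (auto simp: f degree_monic_power)
      qed
      then show False
        using monic_notin_modp[of f] f by simp
    qed
    then have "prime_powers_dividing f = {}"
      by (auto simp: prime_powers_dividing_def)
    then show ?thesis
      using True by simp
  next
    case False
    obtain Q where Q: "Q \<in> Irr" "f \<in> pideal Q"
      using Irr_factor[of f] monicsD[OF less.prems] False by auto
    obtain g where g: "degree Q \<le> r" "g \<in> monics (r - degree Q)" "red (Q * g) = f"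
      using cofactor[OF less.prems IrrD(1)[OF Q(1)] Q(2)] by blast
    have lt: "r - degree Q < r"
      using IrrD(2)[OF Q(1)] False by simp
    \<comment> \<open>Dividing by \<open>Q\<close> lowers the exponents at \<open>Q\<close> by one
      and leaves the other primes alone. This map undoes the shift, and \<open>(Q, 1)\<close> is the
      only pair it misses.\<close>
    define \<phi> where "\<phi> = (\<lambda>(P, j). (P, if P = Q then Suc j else j))"
    have f_iff: "f \<in> pideal R \<longleftrightarrow> Q * g \<in> pideal R" for R
      using pideal_red[of "Q * g" R] g(3) by simp
    have own: "f \<in> pideal (Q ^ Suc j) \<longleftrightarrow> g \<in> pideal (Q ^ j)" for j
      using pideal_mult_cancel[OF IrrD(1)[OF Q(1)]] by (simp add: f_iff)
    have other: "f \<in> pideal (P ^ j) \<longleftrightarrow> g \<in> pideal (P ^ j)" if "P \<in> Irr" "P \<noteq> Q" for P j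
      using pideal_power_cancel[OF that(1) Irr_notin_pideal[OF that(1) Q(1) that(2)]]
        pideal_mult[of g] f_iff by blast
    have eq: "prime_powers_dividing f = insert (Q, 1) (\<phi> ` prime_powers_dividing g)"
    proof (intro equalityI subsetI; clarify?)
      fix P j assume Pj: "(P, j) \<in> prime_powers_dividing f" "(P, j) \<notin> \<phi> ` prime_powers_dividing g"
      show "P = Q \<and> j = 1"
      proof (rule ccontr)
        assume *: "\<not> (P = Q \<and> j = 1)"
        show False
        proof (cases "P = Q")
          case True
          with * Pj(1) obtain i where i: "j = Suc i" "1 \<le> i"
            by (cases j) (auto simp: prime_powers_dividing_def)
          then have "(Q, i) \<in> prime_powers_dividing g"
            using Pj(1) own True Q(1) by (auto simp: prime_powers_dividing_def)
          then have "\<phi> (Q, i) \<in> \<phi> ` prime_powers_dividing g"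
            by (rule imageI)
          then show False
            using Pj(2) i True by (simp add: \<phi>_def)
        next
          case False
          then have "(P, j) \<in> prime_powers_dividing g"
            using Pj(1) other by (auto simp: prime_powers_dividing_def)
          then have "\<phi> (P, j) \<in> \<phi> ` prime_powers_dividing g"
            by (rule imageI)
          then show False
            using Pj(2) False by (simp add: \<phi>_def)
        qed
      qed
    next
      fix P j assume "(P, j) \<in> insert (Q, 1) (\<phi> ` prime_powers_dividing g)"
      then show "(P, j) \<in> prime_powers_dividing f"
        using Q own other by (auto simp: prime_powers_dividing_def \<phi>_def split: if_splits)
    qed
    have inj: "inj_on \<phi> (prime_powers_dividing g)"
      by (auto simp: inj_on_def \<phi>_def split: if_splits)
    have notin: "(Q, 1) \<notin> \<phi> ` prime_powers_dividing g"
      by (auto simp: \<phi>_def prime_powers_dividing_def)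
    have fin: "finite (prime_powers_dividing g)"
      and sum: "(\<Sum>(P, j)\<in>prime_powers_dividing g. degree P) = r - degree Q"
      using less.IH[OF lt g(2)] by auto
    have "(\<Sum>(P, j)\<in>prime_powers_dividing f. degree P) =
        degree Q + (\<Sum>x\<in>prime_powers_dividing g. (\<lambda>(P, j). degree P) (\<phi> x))"
      unfolding eq using fin notin inj by (simp add: sum.reindex)
    also have "(\<Sum>x\<in>prime_powers_dividing g. (\<lambda>(P, j). degree P) (\<phi> x)) = r - degree Q"
      unfolding sum[symmetric] by (intro sum.cong) (auto simp: \<phi>_def)
    finally show ?thesis
      using g(1) fin eq by simp
  qed
qed

text \<open>A pair \<open>(P, j)\<close> in \<open>power_sum_index k\<close> stands for the \<open>degree P\<close> elements of the field
  with \<open>p ^ k\<close> elements that are roots of \<open>P\<close>, so \<open>Psum lam k\<close> is a sum over that field. The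
  identity \<open>von_mangoldt\<close> below is the logarithmic derivative of the Euler product.\<close>

definition power_sum_index :: "nat \<Rightarrow> (int poly \<times> nat) set" where
  "power_sum_index k = {(P, j). P \<in> Irr \<and> j * degree P = k}"

definition Lcoeff :: "(int poly \<Rightarrow> complex) \<Rightarrow> nat \<Rightarrow> complex" where
  "Lcoeff lam d = (\<Sum>f\<in>monics d. lam f)"

definition Psum :: "(int poly \<Rightarrow> complex) \<Rightarrow> nat \<Rightarrow> complex" where
  "Psum lam k = (\<Sum>(P, j)\<in>power_sum_index k. of_nat (degree P) * lam P ^ j)"

text \<open>Gives finiteness. It would fail for \<open>k = 0\<close>, where \<open>j = 0\<close> is
  allowed with every \<open>P\<close>; for positive \<open>k\<close> both \<open>degree P\<close>
  and \<open>j\<close> are at most \<open>k\<close>.\<close>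

lemma power_sum_index_subset:
  assumes "1 \<le> k"
  shows "power_sum_index k \<subseteq> (\<Union>d\<le>k. monics d) \<times> {1..k}"
proof clarify
  fix P j assume "(P, j) \<in> power_sum_index k"
  then have P: "P \<in> Irr" "j * degree P = k"
    by (auto simp: power_sum_index_def)
  then have "j \<noteq> 0"
    using assms by (auto intro: Nat.gr0I)
  have "degree P \<le> k" "j \<le> k"
    using P \<open>j \<noteq> 0\<close> IrrD(2)[OF P(1)] by auto
  then show "P \<in> (\<Union>d\<le>k. monics d) \<and> j \<in> {1..k}"
    using IrrD(4)[OF P(1)] \<open>j \<noteq> 0\<close> by auto
qed

lemma finite_power_sum_index: "1 \<le> k \<Longrightarrow> finite (power_sum_index k)"
  by (rule finite_subset[OF power_sum_index_subset]) (auto simp: finite_monics)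

text \<open>Sending a cofactor \<open>g\<close> to the canonical representative of
  \<open>Q * g\<close> is a bijection onto the multiples, and \<open>lam\<close> sees only classes
  modulo \<open>p\<close>, so multiplicativity applies.\<close>

lemma sum_multiples:
  assumes lam: "\<And>f. lead_coeff f = 1 \<Longrightarrow> lam (red f) = lam f"
      "\<And>f g. \<lbrakk>lead_coeff f = 1; lead_coeff g = 1\<rbrakk> \<Longrightarrow> lam (f * g) = lam f * lam g"
    and Q: "lead_coeff Q = 1" "degree Q \<le> r"
  shows "(\<Sum>f | f \<in> monics r \<and> f \<in> pideal Q. lam f) = lam Q * Lcoeff lam (r - degree Q)"
proof -
  have "bij_betw (\<lambda>g. red (Q * g)) (monics (r - degree Q)) {f. f \<in> monics r \<and> f \<in> pideal Q}"
  proof (rule bij_betw_imageI)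
    show "inj_on (\<lambda>g. red (Q * g)) (monics (r - degree Q))"
    proof (rule inj_onI)
      fix g h assume gh: "g \<in> monics (r - degree Q)" "h \<in> monics (r - degree Q)" "red (Q * g) = red (Q * h)"
      have "Q * (g - h) \<in> modp"
        using gh(3) by (simp add: red_eq_iff right_diff_distrib)
      then show "g = h"
        using modp_cancel[OF _ Q(1)] monics_eqI[OF gh(1,2)] by blast
    qed
    show "(\<lambda>g. red (Q * g)) ` monics (r - degree Q) = {f. f \<in> monics r \<and> f \<in> pideal Q}"
    proof (intro equalityI subsetI)
      fix f assume "f \<in> {f. f \<in> monics r \<and> f \<in> pideal Q}"
      then show "f \<in> (\<lambda>g. red (Q * g)) ` monics (r - degree Q)"
        using cofactor[OF _ Q(1)] by (metis (mono_tags, lifting) image_eqI mem_Collect_eq)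
    next
      fix f assume "f \<in> (\<lambda>g. red (Q * g)) ` monics (r - degree Q)"
      then obtain g where g: "g \<in> monics (r - degree Q)" "f = red (Q * g)"
        by blast
      show "f \<in> {f. f \<in> monics r \<and> f \<in> pideal Q}"
        using red_mult_monics[OF Q(1) g(1)] Q(2) g(2) pideal_self pideal_red by simp
    qed
  qed
  from sum.reindex_bij_betw[OF this, of lam, symmetric]
  have "(\<Sum>f | f \<in> monics r \<and> f \<in> pideal Q. lam f) = (\<Sum>g\<in>monics (r - degree Q). lam (red (Q * g)))" .
  also have "\<dots> = (\<Sum>g\<in>monics (r - degree Q). lam Q * lam g)"
  proof (rule sum.cong[OF refl])
    fix g assume "g \<in> monics (r - degree Q)"
    then have "lead_coeff g = 1"
      by (rule monicsD)
    then show "lam (red (Q * g)) = lam Q * lam g"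
      using lam Q(1) by (simp add: lead_coeff_mult)
  qed
  finally show ?thesis
    by (simp add: Lcoeff_def sum_distrib_left)
qed

theorem von_mangoldt:
  assumes lam: "\<And>f. lead_coeff f = 1 \<Longrightarrow> lam (red f) = lam f"
      "\<And>f g. \<lbrakk>lead_coeff f = 1; lead_coeff g = 1\<rbrakk> \<Longrightarrow> lam (f * g) = lam f * lam g" "lam 1 = 1"
  shows "of_nat r * Lcoeff lam r = (\<Sum>k=1..r. Psum lam k * Lcoeff lam (r - k))"
proof -
  define U where "U = (\<Union>k\<in>{1..r}. power_sum_index k)"
  have finU: "finite U"
    by (auto simp: U_def finite_power_sum_index)
  have sub: "prime_powers_dividing f \<subseteq> U" if f: "f \<in> monics r" for f
  proof clarify
    fix P j assume "(P, j) \<in> prime_powers_dividing f"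
    then have Pj: "P \<in> Irr" "1 \<le> j" "f \<in> pideal (P ^ j)"
      by (auto simp: prime_powers_dividing_def)
    have "lead_coeff (P ^ j) = 1" "degree (P ^ j) = j * degree P"
      by (rule lead_coeff_monic_power[OF IrrD(1)[OF Pj(1)]], rule degree_monic_power[OF IrrD(1)[OF Pj(1)]])
    then have "j * degree P \<le> r"
      using cofactor[OF f _ Pj(3)] by metis
    then show "(P, j) \<in> U"
      using IrrD(2)[OF Pj(1)] Pj by (auto simp: U_def power_sum_index_def)
  qed
  have lamP: "lam (P ^ j) = lam P ^ j" if "lead_coeff P = 1" for P j
    by (induction j) (use that lam(2)[OF that lead_coeff_monic_power[OF that]] lam(3) in simp_all)
  have "of_nat r * Lcoeff lam r = (\<Sum>f\<in>monics r. of_nat r * lam f)"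
    by (simp add: Lcoeff_def sum_distrib_left)
  \<comment> \<open>\<open>r\<close> is replaced by the degrees of the prime powers dividing
    \<open>f\<close>; the index set is enlarged to \<open>U\<close>, which does not depend on
    \<open>f\<close>, so that the sums can be exchanged.\<close>
  also have "\<dots> = (\<Sum>f\<in>monics r. \<Sum>(P, j)\<in>U. if f \<in> pideal (P ^ j) then of_nat (degree P) * lam f else 0)"
  proof (rule sum.cong[OF refl])
    fix f assume f: "f \<in> monics r"
    have "of_nat r * lam f = (\<Sum>(P, j)\<in>prime_powers_dividing f. of_nat (degree P) * lam f)"
      unfolding conjunct2[OF sum_prime_powers_dividing[OF f], symmetric]
      by (simp add: sum_distrib_right of_nat_sum case_prod_unfold)
    also have "\<dots> = (\<Sum>(P, j)\<in>U. if f \<in> pideal (P ^ j) then of_nat (degree P) * lam f else 0)"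
    proof (rule sum.mono_neutral_cong_left[OF finU sub[OF f]])
      show "\<forall>x\<in>U - prime_powers_dividing f. (case x of (P, j) \<Rightarrow>
          if f \<in> pideal (P ^ j) then of_nat (degree P) * lam f else 0) = 0"
      proof clarify
        fix P j assume "(P, j) \<in> U" "(P, j) \<notin> prime_powers_dividing f"
        moreover from this(1) have "P \<in> Irr \<and> 1 \<le> j"
          by (cases j) (auto simp: U_def power_sum_index_def)
        ultimately show "(if f \<in> pideal (P ^ j) then of_nat (degree P) * lam f else 0) = 0"
          by (auto simp: prime_powers_dividing_def)
      qed
    qed (auto simp: prime_powers_dividing_def)
    finally show "of_nat r * lam f = (\<Sum>(P, j)\<in>U. if f \<in> pideal (P ^ j) then of_nat (degree P) * lam f else 0)" .
  qed
  also have "\<dots> = (\<Sum>(P, j)\<in>U. \<Sum>f\<in>monics r. if f \<in> pideal (P ^ j) then of_nat (degree P) * lam f else 0)"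
    unfolding case_prod_unfold by (rule sum.swap)
  also have "\<dots> = (\<Sum>(P, j)\<in>U. of_nat (degree P) * lam P ^ j * Lcoeff lam (r - j * degree P))"
  proof (rule sum.cong[OF refl], clarify)
    fix P j assume "(P, j) \<in> U"
    then have Pj: "P \<in> Irr" "j * degree P \<le> r"
      by (auto simp: U_def power_sum_index_def)
    have lc: "lead_coeff (P ^ j) = 1" and deg: "degree (P ^ j) = j * degree P"
      by (rule lead_coeff_monic_power[OF IrrD(1)[OF Pj(1)]], rule degree_monic_power[OF IrrD(1)[OF Pj(1)]])
    have "(\<Sum>f\<in>monics r. if f \<in> pideal (P ^ j) then of_nat (degree P) * lam f else 0) =
        of_nat (degree P) * (\<Sum>f | f \<in> monics r \<and> f \<in> pideal (P ^ j). lam f)"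
      unfolding sum_distrib_left by (rule sum.inter_filter[OF finite_monics, symmetric])
    also have "\<dots> = of_nat (degree P) * (lam (P ^ j) * Lcoeff lam (r - j * degree P))"
      unfolding deg[symmetric] using Pj(2) deg
      by (intro arg_cong[where f = "\<lambda>x. _ * x"] sum_multiples lam lc) simp_all
    finally show "(\<Sum>f\<in>monics r. if f \<in> pideal (P ^ j) then of_nat (degree P) * lam f else 0) =
        of_nat (degree P) * lam P ^ j * Lcoeff lam (r - j * degree P)"
      by (simp only: lamP[OF IrrD(1)[OF Pj(1)]] mult.assoc)
  qed
  also have "\<dots> = (\<Sum>k=1..r. \<Sum>(P, j)\<in>power_sum_index k. of_nat (degree P) * lam P ^ j * Lcoeff lam (r - j * degree P))"
    unfolding U_def
  proof (rule sum.UNION_disjoint)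
    show "\<forall>i\<in>{1..r}. finite (power_sum_index i)"
      using finite_power_sum_index by simp
    show "\<forall>i\<in>{1..r}. \<forall>j\<in>{1..r}. i \<noteq> j \<longrightarrow> power_sum_index i \<inter> power_sum_index j = {}"
      unfolding power_sum_index_def by blast
  qed simp
  also have "\<dots> = (\<Sum>k=1..r. Psum lam k * Lcoeff lam (r - k))"
  proof (rule sum.cong[OF refl])
    fix k
    have "(\<Sum>(P, j)\<in>power_sum_index k. of_nat (degree P) * lam P ^ j * Lcoeff lam (r - j * degree P)) =
        (\<Sum>(P, j)\<in>power_sum_index k. of_nat (degree P) * lam P ^ j * Lcoeff lam (r - k))"
      by (rule sum.cong) (auto simp: power_sum_index_def)
    then show "(\<Sum>(P, j)\<in>power_sum_index k. of_nat (degree P) * lam P ^ j * Lcoeff lam (r - j * degree P)) =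
        Psum lam k * Lcoeff lam (r - k)"
      by (simp add: Psum_def sum_distrib_right case_prod_unfold)
  qed
  finally show ?thesis .
qed

text \<open>Counts the field with \<open>p ^ r\<close> elements. The L-coefficients for
  \<open>lam = 1\<close> are \<open>p ^ d\<close>, so \<open>p\<close> times the identity for
  \<open>r - 1\<close> contains all but the last term of the identity for \<open>r\<close>, and the
  difference is the claim.\<close>

lemma Psum_one:
  assumes "1 \<le> r"
  shows "Psum (\<lambda>_. 1) r = of_nat (p ^ r)"
proof -
  have L: "Lcoeff (\<lambda>_. 1) d = of_nat p ^ d" for d
    by (simp add: Lcoeff_def card_monics)
  have vm: "of_nat r * of_nat p ^ r = (\<Sum>k=1..r. Psum (\<lambda>_. 1) k * of_nat p ^ (r - k))" for r
    using von_mangoldt[of "\<lambda>_. 1" r] by (simp add: L)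
  obtain s where s: "r = Suc s"
    using assms by (cases r) auto
  have "(\<Sum>k=1..s. Psum (\<lambda>_. 1) k * of_nat p ^ (r - k)) = of_nat p * (\<Sum>k=1..s. Psum (\<lambda>_. 1) k * of_nat p ^ (s - k))"
    unfolding sum_distrib_left by (rule sum.cong) (auto simp: s Suc_diff_le)
  also have "\<dots> = of_nat s * of_nat p ^ r"
    unfolding vm[symmetric] by (simp add: s)
  finally show ?thesis
    using vm[of r] by (simp add: s algebra_simps)
qed

end

section \<open>Conjugates and traces\<close>

locale irreducible_modulus = prime_modulus +
  fixes P :: "int poly"
  assumes P: "P \<in> Irr"
begin

sublocale K: prime_ideal_char "pideal P" p
  by (rule prime_ideal_Irr[OF P])

notation K.eqm (infix "\<doteq>" 50)

abbreviation X :: "int poly" where "X \<equiv> [:0, 1:]"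

abbreviation d :: nat where "d \<equiv> degree P"

text \<open>Views an integer polynomial as one with coefficients in \<open>int poly\<close>, so that
  \<open>P\<close> can be evaluated at powers of \<open>X\<close>, its own roots modulo
  \<open>pideal P\<close>.\<close>

abbreviation lift :: "int poly \<Rightarrow> int poly poly" where "lift \<equiv> map_poly (\<lambda>c. [:c:])"

lemma const_eq_of_int: "[:c:] = (of_int c :: int poly)"
  by (simp add: of_int_poly)

text \<open>Additivity of Frobenius together with Fermat's theorem for the integer
  coefficients.\<close>

lemma frobenius: "f ^ (p ^ k) \<doteq> pcompose f (X ^ (p ^ k))"
proof (induction f)
  case 0
  then show ?case
    using prime_gt_0_nat[OF prime_p] by (simp add: zero_power)
next
  case (pCons a f)
  have "pCons a f ^ (p ^ k) = ([:a:] + X * f) ^ (p ^ k)"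
    by simp
  also have "\<dots> \<doteq> [:a:] ^ (p ^ k) + (X * f) ^ (p ^ k)"
    by (rule K.dream_power)
  also have "\<dots> \<doteq> [:a:] + X ^ (p ^ k) * f ^ (p ^ k)"
    unfolding power_mult_distrib by (intro K.eqm_add K.eqm_refl) (simp add: const_eq_of_int K.fermat_int)
  also have "\<dots> \<doteq> [:a:] + X ^ (p ^ k) * pcompose f (X ^ (p ^ k))"
    by (intro K.eqm_add K.eqm_mult K.eqm_refl pCons.IH)
  finally show ?case
    by (simp add: pcompose_pCons)
qed

lemma pcompose_eqm: "g \<doteq> h \<Longrightarrow> pcompose f g \<doteq> pcompose f h"
  by (induction f) (auto simp: pcompose_pCons intro!: K.eqm_add K.eqm_mult)

lemma residue_exists:
  obtains r where "r \<in> reduced d" "f \<doteq> r"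
proof -
  obtain g r where gr: "f = P * g + r" "r = 0 \<or> degree r < d"
    using monic_division[OF IrrD(1)[OF P]] by blast
  have "red r \<in> reduced d"
    using gr(2) red_range by (auto simp: reduced_def coeff_red coeff_eq_0)
  moreover have "f - red r \<in> pideal P"
    unfolding gr(1) using pideal_add[OF pideal_self[of P g] modp_subset[OF red_diff[of r]]]
    by (simp add: add_diff_eq)
  ultimately show thesis
    using that by (simp add: K.eqm_def)
qed

lemma residues_distinct:
  assumes "f \<in> reduced d" "g \<in> reduced d" "f \<doteq> g"
  shows "f = g"
proof -
  have "degree (f - g) < d \<or> f - g = 0"
  proof (cases "f - g = 0")
    case False
    have "coeff (f - g) (degree (f - g)) = 0" if "degree (f - g) \<ge> d"
      using assms that by (simp add: reduced_def)
    then show ?thesis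
      using False by (metis leading_coeff_0_iff not_less)
  qed auto
  then have "f - g \<in> modp"
    using assms(3) by (intro pideal_small[OF IrrD(1)[OF P]]) (auto simp: K.eqm_def)
  then show ?thesis
    using reduced_eqI assms by blast
qed

lemma lift_P: "degree (lift P) = d" "coeff (lift P) d = 1"
  using IrrD(1)[OF P] by (auto simp: degree_map_poly coeff_map_poly one_pCons)

lemma power_power_p: "(a ^ (p ^ i)) ^ (p ^ k) = (a :: int poly) ^ (p ^ (i + k))"
  by (simp add: power_mult[symmetric] power_add)

text \<open>There are finitely many residues, so two Frobenius iterates of \<open>X\<close> agree;
  injectivity of Frobenius cancels the smaller exponent.\<close>

lemma order_exists: "\<exists>m\<ge>1. X ^ (p ^ m) \<doteq> X"
proof -
  define rep where "rep = (\<lambda>k. SOME r. r \<in> reduced d \<and> X ^ (p ^ k) \<doteq> r)"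
  have rep: "rep k \<in> reduced d \<and> X ^ (p ^ k) \<doteq> rep k" for k
    unfolding rep_def by (rule someI_ex) (metis residue_exists)
  have "\<not> inj_on rep UNIV"
    using rep finite_reduced finite_subset[of "range rep" "reduced d"] finite_imageD[of rep UNIV]
    by auto
  then obtain i j where ij: "rep i = rep j" "i < j"
    by (auto simp: inj_on_def) (metis linorder_neqE_nat)
  then have "X ^ (p ^ i) \<doteq> X ^ (p ^ j)"
    using rep[of i] rep[of j] K.eqm_sym K.eqm_trans by metis
  then have "(X ^ (p ^ 0)) ^ (p ^ i) \<doteq> (X ^ (p ^ (j - i))) ^ (p ^ i)"
    using ij(2) unfolding power_power_p by simp
  then have "X ^ (p ^ 0) \<doteq> X ^ (p ^ (j - i))"
    by (rule K.power_inj)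
  then show ?thesis
    using ij(2) K.eqm_sym by (intro exI[of _ "j - i"]) auto
qed

lemma conjugate_root: "poly (lift P) (X ^ (p ^ i)) \<in> pideal P"
proof -
  obtain n where "p ^ i = Suc n"
    using prime_gt_0_nat[OF prime_p] not0_implies_Suc[of "p ^ i"] by auto
  then have "P ^ (p ^ i) \<in> pideal P"
    using pideal_self[of P "P ^ n"] by simp
  then show ?thesis
    using K.eqm_mem[OF frobenius[of P i]] by (simp add: pcompose_altdef)
qed

text \<open>Let \<open>m\<close> be the least period of Frobenius on \<open>X\<close>. Every residue
  is then a root of \<open>T ^ (p ^ m) - T\<close>, so \<open>p ^ d\<close> is at most
  \<open>p ^ m\<close>; and the \<open>m\<close> distinct conjugates of \<open>X\<close> are roots
  of \<open>lift P\<close>, so \<open>m\<close> is at most \<open>d\<close>.\<close>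

lemma conjugates:
  shows X_order: "X ^ (p ^ d) \<doteq> X"
    and conjugates_distinct: "\<And>i j. \<lbrakk>i < d; j < d; X ^ (p ^ i) \<doteq> X ^ (p ^ j)\<rbrakk> \<Longrightarrow> i = j"
proof -
  define m where "m = (LEAST m. m \<ge> 1 \<and> X ^ (p ^ m) \<doteq> X)"
  have m: "m \<ge> 1" "X ^ (p ^ m) \<doteq> X"
    using LeastI_ex[OF order_exists] by (auto simp: m_def)
  have min: "m \<le> k" if "k \<ge> 1" "X ^ (p ^ k) \<doteq> X" for k
    unfolding m_def using that by (intro Least_le) auto
  have distinct: "i = j" if ij: "i < m" "j < m" "X ^ (p ^ i) \<doteq> X ^ (p ^ j)" for i j
  proof -
    have *: "\<not> i < j" if ij: "i < m" "j < m" "X ^ (p ^ i) \<doteq> X ^ (p ^ j)" for i j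
    proof
      assume "i < j"
      then have "(X ^ (p ^ 0)) ^ (p ^ i) \<doteq> (X ^ (p ^ (j - i))) ^ (p ^ i)"
        using ij(3) unfolding power_power_p by simp
      then have "X ^ (p ^ 0) \<doteq> X ^ (p ^ (j - i))"
        by (rule K.power_inj)
      then have "X ^ (p ^ (j - i)) \<doteq> X"
        using K.eqm_sym by simp
      then have "m \<le> j - i"
        using \<open>i < j\<close> by (intro min) auto
      then show False
        using ij(2) by simp
    qed
    show ?thesis
      using *[OF ij] *[OF ij(2,1) K.eqm_sym[OF ij(3)]] by simp
  qed
  have fix_all: "f ^ (p ^ m) \<doteq> f" for f
    using K.eqm_trans[OF frobenius pcompose_eqm[OF m(2), of f]] by (simp only: pcompose_idR)
  have "d \<le> m"
  proof (rule ccontr)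
    assume "\<not> d \<le> m"
    then have lt: "p ^ m < p ^ d"
      using prime_gt_1_nat[OF prime_p] by simp
    define F :: "int poly poly" where "F = monom 1 (p ^ m) - monom 1 1"
    have pm: "p ^ m \<noteq> 1"
      using prime_gt_1_nat[OF prime_p] m(1) by simp
    have "coeff F (p ^ m) \<in> pideal P"
    proof (rule K.too_many_roots[OF finite_reduced[of d]])
      show "poly F a \<in> pideal P" for a
        using fix_all[of a] by (simp add: F_def poly_monom K.eqm_def)
      have "1 \<le> p ^ m"
        using prime_gt_0_nat[OF prime_p] by (simp add: Suc_leI)
      then have "degree F \<le> p ^ m"
        unfolding F_def by (rule degree_diff_le[OF degree_monom_le order.trans[OF degree_monom_le]])
      then show "degree F < card (reduced d)"
        using lt by (simp add: card_reduced)
    qed (rule residues_distinct)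
    then show False
      using pm K.one_not_mem by (simp add: F_def)
  qed
  have "m \<le> d"
  proof (rule ccontr)
    assume "\<not> m \<le> d"
    define A where "A = (\<lambda>i. X ^ (p ^ i)) ` {..<m}"
    have "inj_on (\<lambda>i. X ^ (p ^ i)) {..<m}"
    proof (rule inj_onI)
      fix i j assume ij: "i \<in> {..<m}" "j \<in> {..<m}" "X ^ (p ^ i) = X ^ (p ^ j)"
      then show "i = j"
        using K.eqm_refl[of "X ^ (p ^ i)"] by (intro distinct) auto
    qed
    then have "card A = m"
      by (simp add: A_def card_image)
    have "coeff (lift P) d \<in> pideal P"
    proof (rule K.too_many_roots)
      show "finite A" "degree (lift P) < card A"
        using \<open>\<not> m \<le> d\<close> \<open>card A = m\<close> lift_P by (auto simp: A_def)
      show "poly (lift P) a \<in> pideal P" if "a \<in> A" for a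
      proof -
        obtain i where "a = X ^ (p ^ i)"
          using \<open>a \<in> A\<close> by (auto simp: A_def)
        then show ?thesis
          using conjugate_root by simp
      qed
      show "a = b" if "a \<in> A" "b \<in> A" "a \<doteq> b" for a b
      proof -
        obtain i j where ij: "a = X ^ (p ^ i)" "b = X ^ (p ^ j)" "i < m" "j < m"
          using \<open>a \<in> A\<close> \<open>b \<in> A\<close> by (auto simp: A_def)
        then have "i = j"
          using that(3) by (intro distinct) auto
        then show ?thesis
          using ij by simp
      qed
    qed
    then show False
      using K.one_not_mem lift_P by simp
  qed
  with \<open>d \<le> m\<close> have "m = d"
    by simp
  then show "X ^ (p ^ d) \<doteq> X"
    using m(2) by simp
  show "i = j" if "i < d" "j < d" "X ^ (p ^ i) \<doteq> X ^ (p ^ j)" for i j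
    using \<open>m = d\<close> that by (intro distinct) simp_all
qed

lemma vieta_family:
  assumes F: "degree F \<le> d" "\<And>i. i < d \<Longrightarrow> poly F (r i) \<in> pideal P"
    and r: "\<And>i j. \<lbrakk>i < d; j < d; r i \<doteq> r j\<rbrakk> \<Longrightarrow> i = j"
  shows "coeff F (d - 1) \<doteq> - (coeff F d * (\<Sum>i<d. r i))"
proof -
  obtain n where n: "d = Suc n"
    using IrrD(2)[OF P] gr0_conv_Suc by blast
  have inj: "inj_on r {..<d}"
  proof (rule inj_onI)
    fix i j assume ij: "i \<in> {..<d}" "j \<in> {..<d}" "r i = r j"
    then show "i = j"
      using K.eqm_refl[of "r i"] by (intro r) auto
  qed
  have "coeff F n \<doteq> - (coeff F (Suc n) * \<Sum>(r ` {..<d}))"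
  proof (rule K.vieta)
    show "degree F \<le> Suc n" "card (r ` {..<d}) = Suc n"
      using F n card_image[OF inj] by simp_all
    show "a = b" if "a \<in> r ` {..<d}" "b \<in> r ` {..<d}" "a \<doteq> b" for a b
    proof -
      obtain i j where "a = r i" "b = r j" "i < d" "j < d"
        using \<open>a \<in> r ` {..<d}\<close> \<open>b \<in> r ` {..<d}\<close> by auto
      then show ?thesis
        using that(3) r[of i j] by simp
    qed
  qed (use F in auto)
  then show ?thesis
    using n inj by (simp add: sum.reindex)
qed

lemma sum_conjugates: "(\<Sum>i<d. X ^ (p ^ i)) \<doteq> of_int (- coeff P (d - 1))"
proof -
  have "coeff (lift P) (d - 1) \<doteq> - (coeff (lift P) d * (\<Sum>i<d. X ^ (p ^ i)))"
    using conjugate_root conjugates_distinct lift_P by (intro vieta_family) auto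
  from K.eqm_uminus[OF this] show ?thesis
    using lift_P K.eqm_sym by (simp add: coeff_map_poly const_eq_of_int)
qed

lemma poly_altdef_le: "degree F \<le> n \<Longrightarrow> poly F a = (\<Sum>i\<le>n. coeff F i * a ^ i)" for F :: "'b::comm_ring_1 poly"
  unfolding poly_altdef by (intro sum.mono_neutral_left) (auto simp: coeff_eq_0)

lemma X_notin:
  assumes "\<not> int p dvd coeff P 0"
  shows "X \<notin> pideal P"
proof
  assume X: "X \<in> pideal P"
  obtain c g where P': "P = pCons c g"
    by (cases P)
  have "[:c:] = P - X * g"
    by (simp add: P')
  also have "\<dots> \<in> pideal P"
    using pideal_self[of P 1] by (intro K.diff_mem K.mult_mem' X) simp
  finally show False
    using assms K.of_int_mem_iff[of c] by (simp add: P' const_eq_of_int)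
qed

lemma inverse_exists:
  assumes "\<not> int p dvd coeff P 0"
  obtains Y where "X * Y \<doteq> 1"
proof -
  obtain u v where uv: "1 - (P * u + X * v) \<in> modp"
    using Irr_bezout[OF P X_notin[OF assms]] by blast
  have "1 - (P * u + X * v) + P * u \<in> pideal P"
    by (intro pideal_add pideal_self modp_subset uv)
  then have "1 \<doteq> X * v"
    unfolding K.eqm_def by (metis diff_add_eq_diff_diff_swap diff_add_cancel)
  with that K.eqm_sym show thesis
    by blast
qed

lemma inverse_power: "X * Y \<doteq> 1 \<Longrightarrow> X ^ n * Y ^ n \<doteq> 1"
  using K.eqm_power[of "X * Y" 1 n] by (simp only: power_mult_distrib power_one)

text \<open>The conjugates of \<open>1 / X\<close> are the roots of the reflected polynomial, to
  which Vieta applies; the exponent \<open>p - 2\<close> inverts \<open>coeff P 0\<close>.\<close>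

lemma sum_conjugates_inverse:
  assumes c0: "\<not> int p dvd coeff P 0" and Y: "X * Y \<doteq> 1"
  shows "(\<Sum>i<d. Y ^ (p ^ i)) \<doteq> of_int (- (coeff P 1 * coeff P 0 ^ (p - 2)))"
proof -
  have XY: "X ^ n * Y ^ n \<doteq> 1" for n
    using Y by (rule inverse_power)
  define F where "F = lift (reflect_poly P)"
  have degF: "degree F \<le> d"
    by (simp add: F_def degree_map_poly degree_reflect_poly_le)
  have cF: "coeff F i = [:coeff P (d - i):]" if "i \<le> d" for i
    using that by (simp add: F_def coeff_map_poly coeff_reflect_poly)
  have "coeff F (d - 1) \<doteq> - (coeff F d * (\<Sum>i<d. Y ^ (p ^ i)))"
  proof (rule vieta_family[OF degF])
    fix i
    define x y where "x = X ^ (p ^ i)" and "y = Y ^ (p ^ i)"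
    have xy: "x * y \<doteq> 1"
      using XY by (simp add: x_def y_def)
    \<comment> \<open>Reflection: with \<open>y\<close> inverse to \<open>x\<close>, the value of
      \<open>F\<close> at \<open>y\<close> times \<open>x ^ d\<close> is the value of
      \<open>P\<close> at \<open>x\<close>.\<close>
    have "x ^ d * poly F y = (\<Sum>k\<le>d. coeff F k * (x ^ d * y ^ k))"
      by (simp add: poly_altdef_le[OF degF] sum_distrib_left mult_ac)
    also have "\<dots> = (\<Sum>k\<le>d. [:coeff P (d - k):] * (x ^ (d - k) * (x * y) ^ k))"
    proof (rule sum.cong[OF refl])
      fix k assume k: "k \<in> {..d}"
      then have "x ^ d = x ^ (d - k) * x ^ k"
        by (simp add: power_add[symmetric])
      then show "coeff F k * (x ^ d * y ^ k) = [:coeff P (d - k):] * (x ^ (d - k) * (x * y) ^ k)"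
        using k cF[of k] by (simp add: power_mult_distrib mult.assoc)
    qed
    also have "\<dots> \<doteq> (\<Sum>k\<le>d. [:coeff P (d - k):] * (x ^ (d - k) * 1 ^ k))"
      by (intro K.eqm_sum K.eqm_mult K.eqm_refl K.eqm_power xy)
    also have "\<dots> = (\<Sum>k\<le>d. [:coeff P k:] * x ^ k)"
      by (rule sum.reindex_bij_witness[of _ "\<lambda>k. d - k" "\<lambda>k. d - k"]) auto
    also have "\<dots> = poly (lift P) x"
      using lift_P(1) by (simp add: poly_altdef coeff_map_poly)
    finally have "x ^ d * poly F y \<in> pideal P"
      using conjugate_root[of i] K.eqm_mem x_def by blast
    moreover have "x ^ d \<notin> pideal P"
      unfolding x_def using K.power_mem X_notin[OF c0] by blast
    ultimately show "poly F (Y ^ (p ^ i)) \<in> pideal P"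
      using K.prime_mem y_def by blast
  next
    fix i j assume ij: "i < d" "j < d" "Y ^ (p ^ i) \<doteq> Y ^ (p ^ j)"
    have "X ^ (p ^ i) = X ^ (p ^ i) * 1"
      by simp
    also have "\<dots> \<doteq> X ^ (p ^ i) * (X ^ (p ^ j) * Y ^ (p ^ j))"
      by (intro K.eqm_mult K.eqm_refl K.eqm_sym[OF XY])
    also have "\<dots> = X ^ (p ^ j) * (X ^ (p ^ i) * Y ^ (p ^ j))"
      by (simp add: mult_ac)
    also have "\<dots> \<doteq> X ^ (p ^ j) * (X ^ (p ^ i) * Y ^ (p ^ i))"
      by (intro K.eqm_mult K.eqm_refl K.eqm_sym[OF ij(3)])
    also have "\<dots> \<doteq> X ^ (p ^ j) * 1"
      by (intro K.eqm_mult K.eqm_refl XY)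
    finally show "i = j"
      using conjugates_distinct ij by simp
  qed
  moreover have "d - (d - 1) = 1"
    using IrrD(2)[OF P] by simp
  ultimately have V: "of_int (coeff P 1) \<doteq> - (of_int (coeff P 0) * (\<Sum>i<d. Y ^ (p ^ i)))"
    using cF[of "d - 1"] cF[of d] by (simp add: const_eq_of_int)
  have p2: "coeff P 0 ^ p = coeff P 0 * coeff P 0 * coeff P 0 ^ (p - 2)"
  proof -
    have "p = 2 + (p - 2)"
      using prime_ge_2_nat[OF prime_p] by simp
    then have "coeff P 0 ^ p = coeff P 0 ^ 2 * coeff P 0 ^ (p - 2)"
      by (metis power_add)
    then show ?thesis
      by (simp add: power2_eq_square)
  qed
  \<comment> \<open>Solves \<open>V\<close> for the sum: multiplying by \<open>coeff P 0\<close>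
    once more makes room for \<open>a ^ p = a\<close>, and both factors \<open>coeff P 0\<close> are
    then cancelled.\<close>
  have "of_int (coeff P 0) * (of_int (coeff P 0) * (\<Sum>i<d. Y ^ (p ^ i))) \<doteq>
      of_int (coeff P 0) * - of_int (coeff P 1)"
    using K.eqm_uminus[OF K.eqm_sym[OF V]] by (intro K.eqm_mult K.eqm_refl) simp
  also have "\<dots> \<doteq> of_int (coeff P 0 ^ p) * - of_int (coeff P 1)"
    using K.eqm_sym[OF K.fermat_int[of "coeff P 0" 1]] by (intro K.eqm_mult K.eqm_refl) simp
  also have "\<dots> = of_int (coeff P 0) * (of_int (coeff P 0) * of_int (- (coeff P 1 * coeff P 0 ^ (p - 2))))"
    unfolding p2 by simp
  finally show ?thesis
    using c0 by (blast intro: K.eqm_cancel dest: K.of_int_mem_iff[THEN iffD1])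
qed

end

context prime_modulus
begin

text \<open>The sum of \<open>x + b / x\<close> over the roots of a monic \<open>f\<close>, by Vieta; modulo \<open>p\<close> the power
  \<open>p - 2\<close> is inversion. Reflecting makes the second highest coefficient \<open>0\<close> for \<open>f = 1\<close>.\<close>

definition tr :: "int \<Rightarrow> int poly \<Rightarrow> int" where
  "tr b f = - (coeff (reflect_poly f) 1 + b * coeff f 1 * coeff f 0 ^ (p - 2))"

end

context irreducible_modulus
begin

lemma X_periodic: "X ^ (p ^ (j * d)) \<doteq> X"
proof (induction j)
  case (Suc j)
  have "X ^ (p ^ (Suc j * d)) = (X ^ (p ^ (j * d))) ^ (p ^ d)"
    unfolding power_power_p by (simp add: add.commute)
  also have "\<dots> \<doteq> X ^ (p ^ d)"
    by (intro K.eqm_power Suc)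
  also have "\<dots> \<doteq> X"
    by (rule X_order)
  finally show ?case .
qed simp

lemma Y_periodic:
  assumes Y: "X * Y \<doteq> 1"
  shows "Y ^ (p ^ (j * d)) \<doteq> Y"
proof -
  define n where "n = p ^ (j * d)"
  have "Y ^ n = 1 * Y ^ n"
    by simp
  also have "\<dots> \<doteq> (X * Y) * Y ^ n"
    by (intro K.eqm_mult K.eqm_refl K.eqm_sym[OF Y])
  also have "\<dots> = X * (Y * Y ^ n)"
    by (simp only: mult.assoc)
  also have "\<dots> \<doteq> X ^ n * (Y * Y ^ n)"
    unfolding n_def by (intro K.eqm_mult K.eqm_refl K.eqm_sym[OF X_periodic])
  also have "\<dots> = (X ^ n * Y ^ n) * Y"
    by (simp only: mult_ac)
  also have "\<dots> \<doteq> 1 * Y"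
    by (intro K.eqm_mult K.eqm_refl inverse_power[OF Y])
  finally show ?thesis
    by (simp add: n_def)
qed

text \<open>The first \<open>d\<close> conjugates give the trace from the residue field, which Vieta
  expresses by \<open>tr b P\<close>. As the conjugates repeat with period \<open>d\<close>, the
  trace from an extension of degree \<open>j\<close> is \<open>j\<close> times as large.\<close>

lemma trace:
  assumes c0: "\<not> int p dvd coeff P 0" and Y: "X * Y \<doteq> 1"
  shows "(\<Sum>i<j * d. X ^ (p ^ i) + of_int b * Y ^ (p ^ i)) \<doteq> of_int (int j * tr b P)"
proof (induction j)
  case (Suc j)
  define z where "z = (\<lambda>i. X ^ (p ^ i) + of_int b * Y ^ (p ^ i))"
  have "(\<Sum>i<Suc j * d. z i) = (\<Sum>i<j * d + d. z i)"
    by (simp add: add.commute)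
  also have "\<dots> = (\<Sum>i<j * d. z i) + (\<Sum>i<d. z (j * d + i))"
  proof -
    have "(\<Sum>i<j * d + n. z i) = (\<Sum>i<j * d. z i) + (\<Sum>i<n. z (j * d + i))" for n
      by (induction n) simp_all
    then show ?thesis .
  qed
  also have "\<dots> \<doteq> of_int (int j * tr b P) + (\<Sum>i<d. z i)"
  proof (intro K.eqm_add K.eqm_sum)
    show "(\<Sum>i<j * d. z i) \<doteq> of_int (int j * tr b P)"
      using Suc by (simp add: z_def)
    show "z (j * d + i) \<doteq> z i" for i
      unfolding z_def power_power_p[symmetric]
      by (intro K.eqm_add K.eqm_mult K.eqm_refl K.eqm_power X_periodic Y_periodic[OF Y])
  qed
  also have "(\<Sum>i<d. z i) = (\<Sum>i<d. X ^ (p ^ i)) + of_int b * (\<Sum>i<d. Y ^ (p ^ i))"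
    by (simp add: z_def sum.distrib sum_distrib_left)
  also have "of_int (int j * tr b P) + \<dots> \<doteq> of_int (int j * tr b P) +
      (of_int (- coeff P (d - 1)) + of_int b * of_int (- (coeff P 1 * coeff P 0 ^ (p - 2))))"
    by (intro K.eqm_add K.eqm_mult K.eqm_refl sum_conjugates sum_conjugates_inverse[OF c0 Y])
  also have "\<dots> = of_int (int (Suc j) * tr b P)"
    using IrrD(2)[OF P] by (simp add: tr_def coeff_reflect_poly algebra_simps)
  finally show ?case
    by (simp add: z_def)
qed simp

end

section \<open>The method of Stepanov\<close>

lemma degree_X_power_add:
  fixes R :: "'a::idom poly"
  assumes "degree R < n"
  shows "degree ([:0, 1:] ^ n + R) = n" "lead_coeff ([:0, 1:] ^ n + R) = 1"
proof -
  have d: "degree ([:0, 1:] ^ n :: 'a poly) = n"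
    by (simp add: degree_power_eq)
  then show deg: "degree ([:0, 1:] ^ n + R) = n"
    using degree_add_eq_left[of R "[:0, 1:] ^ n"] assms by simp
  have "lead_coeff ([:0, 1:] ^ n :: 'a poly) = 1"
    by (intro lead_coeff_monic_power) simp
  then show "lead_coeff ([:0, 1:] ^ n + R) = 1"
    unfolding deg using d assms by (simp add: coeff_eq_0)
qed

section \<open>Linear relations, independence and root counts modulo \<open>p\<close>\<close>

context prime_modulus
begin

text \<open>There are \<open>p ^ card J\<close> coefficient vectors and at most \<open>p ^ N\<close>
  combinations modulo \<open>p\<close>; the difference of two colliding vectors is the
  relation.\<close>

lemma pigeonhole_relation:
  fixes F :: "'b \<Rightarrow> int poly"
  assumes "finite J" "\<And>x. x \<in> J \<Longrightarrow> degree (F x) < N" "N < card J"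
  obtains c where "\<exists>x\<in>J. \<not> int p dvd c x" "(\<Sum>x\<in>J. of_int (c x) * F x) \<in> modp"
proof -
  define C where "C = J \<rightarrow>\<^sub>E {0..<int p}"
  define \<Phi> where "\<Phi> c = red (\<Sum>x\<in>J. of_int (c x) * F x)" for c
  have N: "0 < N"
    using assms by (cases "J = {}") fastforce+
  have "degree (\<Sum>x\<in>J. of_int (c x) * F x) < N" for c
  proof (rule degree_sum_less[OF _ N])
    fix x assume "x \<in> J"
    have "degree (of_int (c x) * F x) \<le> degree (F x)"
      by (simp add: of_int_poly degree_smult_le)
    then show "degree (of_int (c x) * F x) < N"
      using assms(2)[OF \<open>x \<in> J\<close>] by simp
  qed
  then have "coeff (\<Sum>x\<in>J. of_int (c x) * F x) i = 0" if "N \<le> i" for c i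
    using that less_le_trans by (intro coeff_eq_0) blast
  then have "\<Phi> c \<in> reduced N" for c
    using red_range by (simp add: reduced_def \<Phi>_def coeff_red)
  then have "card (\<Phi> ` C) \<le> p ^ N"
    using card_mono[OF finite_reduced[of N], of "\<Phi> ` C"] by (auto simp: card_reduced)
  also have "\<dots> < p ^ card J"
    using assms(3) prime_gt_1_nat[OF prime_p] by simp
  also have "\<dots> = card C"
    using assms(1) by (simp add: C_def card_PiE)
  finally have "\<not> inj_on \<Phi> C"
    by (rule pigeonhole)
  then obtain a b where ab: "a \<in> C" "b \<in> C" "\<Phi> a = \<Phi> b" "a \<noteq> b"
    by (auto simp: inj_on_def)
  obtain x where x: "x \<in> J" "a x \<noteq> b x"
    using ab PiE_ext[of a J _ b] unfolding C_def by blast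
  have "a x \<in> {0..<int p}" "b x \<in> {0..<int p}"
    using ab x by (auto simp: C_def)
  then have "\<not> int p dvd a x - b x"
    using x(2) by (metis atLeastLessThan_iff mod_eq_dvd_iff mod_pos_pos_trivial)
  moreover have "(\<Sum>x\<in>J. of_int (a x - b x) * F x) \<in> modp"
    using ab(3) by (simp add: \<Phi>_def red_eq_iff sum_subtractf algebra_simps)
  ultimately show thesis
    using that[of "\<lambda>x. a x - b x"] x(1) by blast
qed

text \<open>Among the terms whose coefficient is prime to \<open>p\<close>, the one of largest
  degree cannot be cancelled modulo \<open>p\<close>.\<close>

lemma distinct_degrees_independent:
  assumes "finite J" "\<And>x. x \<in> J \<Longrightarrow> lead_coeff (B x) = 1" "inj_on (\<lambda>x. degree (B x)) J"
    and c: "\<exists>x\<in>J. \<not> int p dvd c x"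
  shows "(\<Sum>x\<in>J. of_int (c x) * B x) \<notin> modp"
proof -
  define J' where "J' = {x\<in>J. \<not> int p dvd c x}"
  have J': "finite J'" "J' \<noteq> {}"
    using assms(1) c by (auto simp: J'_def)
  obtain x where x: "x \<in> J'" "\<And>y. y \<in> J' \<Longrightarrow> degree (B y) \<le> degree (B x)"
    using obtains_MAX[OF J', of "\<lambda>x. degree (B x)"]
    by (metis Max_ge finite_imageI imageI J'(1))
  define n where "n = degree (B x)"
  have coeff: "coeff (\<Sum>y\<in>J. of_int (c y) * B y) n = (\<Sum>y\<in>J. c y * coeff (B y) n)"
    by (simp add: coeff_sum of_int_poly)
  have "int p dvd (\<Sum>y\<in>J - {x}. c y * coeff (B y) n)"
  proof (rule dvd_sum)
    fix y assume y: "y \<in> J - {x}"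
    show "int p dvd c y * coeff (B y) n"
    proof (cases "y \<in> J'")
      case True
      then have "degree (B y) \<le> n" "degree (B y) \<noteq> n"
        using x assms(3) y by (auto simp: n_def J'_def inj_on_def)
      then show ?thesis
        by (simp add: coeff_eq_0)
    next
      case False
      then show ?thesis
        using y by (simp add: J'_def)
    qed
  qed
  moreover have "(\<Sum>y\<in>J. c y * coeff (B y) n) = c x + (\<Sum>y\<in>J - {x}. c y * coeff (B y) n)"
    using x(1) assms(1,2) by (subst sum.remove[of J x]) (auto simp: J'_def n_def)
  moreover have "\<not> int p dvd c x"
    using x(1) by (simp add: J'_def)
  ultimately have "\<not> int p dvd coeff (\<Sum>y\<in>J. of_int (c y) * B y) n"
    unfolding coeff by (simp add: dvd_add_left_iff)
  then show ?thesis
    unfolding modp_iff by blast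
qed

text \<open>Each \<open>P\<close> stands for \<open>degree P\<close> roots of \<open>H\<close>.
  Distinct irreducibles are coprime, so their product divides \<open>H\<close> modulo
  \<open>p\<close>; the induction also carries that no further irreducible divides the
  product.\<close>

lemma sum_degree_Irr_le:
  assumes "finite S" "S \<subseteq> Irr" "\<And>P. P \<in> S \<Longrightarrow> H \<in> pideal P" "H \<notin> modp"
  shows "(\<Sum>P\<in>S. degree P) \<le> degree H"
proof -
  have *: "H \<in> pideal (\<Prod>S) \<and> lead_coeff (\<Prod>S) = 1 \<and> degree (\<Prod>S) = (\<Sum>P\<in>S. degree P) \<and>
      (\<forall>Q\<in>Irr - S. \<Prod>S \<notin> pideal Q)"
    using assms(1-3)
  proof (induction S rule: finite_induct)
    case empty
    have "1 \<notin> pideal Q" if "Q \<in> Irr" for Q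
      using prime_ideal_set.one_not_mem prime_ideal_char.axioms(1) prime_ideal_Irr[OF that] by blast
    then show ?case
      using pideal_self[of 1 H] by simp
  next
    case (insert P S)
    have P: "P \<in> Irr" "lead_coeff P = 1" "H \<in> pideal P"
      using insert.prems IrrD by auto
    have IH: "H \<in> pideal (\<Prod>S)" "lead_coeff (\<Prod>S) = 1" "degree (\<Prod>S) = (\<Sum>P\<in>S. degree P)"
        "\<And>Q. Q \<in> Irr - S \<Longrightarrow> \<Prod>S \<notin> pideal Q"
      using insert by auto
    have prod: "\<Prod>(insert P S) = P * \<Prod>S"
      using insert.hyps by simp
    obtain g where g: "H - \<Prod>S * g \<in> modp"
      using IH(1) pideal_iff by blast
    have "\<Prod>S * g \<in> pideal P"
      using pideal_cong[OF g] P(3) by blast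
    then have "g \<in> pideal P"
      using prime_ideal_set.prime_mem[OF prime_ideal_char.axioms(1)[OF prime_ideal_Irr[OF P(1)]]]
        IH(4)[of P] P(1) insert.hyps by blast
    then have "\<Prod>S * g \<in> pideal (\<Prod>S * P)"
      using pideal_mult_cancel[OF IH(2)] by blast
    then have "H \<in> pideal (P * \<Prod>S)"
      using pideal_cong[OF g] by (simp add: mult.commute)
    moreover have "P * \<Prod>S \<notin> pideal Q" if Q: "Q \<in> Irr - insert P S" for Q
    proof -
      have "P \<notin> pideal Q"
        using Irr_notin_pideal[of Q P] Q P(1) by auto
      moreover have "\<Prod>S \<notin> pideal Q"
        using IH(4) Q by blast
      ultimately show ?thesis
        using prime_ideal_set.prime_mem[OF prime_ideal_char.axioms(1)[OF prime_ideal_Irr]] Q by blast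
    qed
    moreover have "\<Prod>S \<noteq> 0"
      using IH(2) by auto
    ultimately show ?case
      unfolding prod
      using lead_coeff_monic_mult[OF P(2) IH(2)] degree_monic_mult[OF P(2)] IH(3) insert.hyps by auto
  qed
  show ?thesis
  proof (rule ccontr)
    assume "\<not> ?thesis"
    then have "H \<in> modp"
      using * by (intro pideal_small[of "\<Prod>S"]) auto
    with assms(4) show False ..
  qed
qed

abbreviation X :: "int poly" where "X \<equiv> [:0, 1:]"

text \<open>With \<open>e = p ^ (s - 1)\<close>, the polynomial \<open>half_trace b s\<close> is \<open>x ^ e\<close> times the sum \<open>w\<close> of the
  first \<open>s\<close> conjugates of \<open>x + b / x\<close>, and \<open>aux_basis\<close> consists of the \<open>x ^ (i + j * p ^ s) * w ^ k\<close>,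
  cleared of denominators. The entries of \<open>aux_reduced\<close> are, up to powers of \<open>x\<close>, their
  \<open>p ^ s\<close>-th powers after the substitutions \<open>x ^ (p ^ (2 * s)) = x\<close> and \<open>w ^ (p ^ s) = t - w\<close>.\<close>

definition half_trace :: "int \<Rightarrow> nat \<Rightarrow> int poly" where
  "half_trace b s = (\<Sum>i<s. X ^ (p ^ (s - 1) + p ^ i) + of_int b * X ^ (p ^ (s - 1) - p ^ i))"

text \<open>In a triple \<open>(i, k, j)\<close>, \<open>i\<close> and \<open>k\<close> are digits
  to the bases \<open>p ^ (s - 1)\<close> and \<open>p\<close>, which makes the degrees of the basis
  distinct. The range of \<open>j\<close>, three values longer than that of \<open>i\<close>, leaves
  more unknowns than coefficients.\<close>

definition aux_index :: "nat \<Rightarrow> (nat \<times> nat \<times> nat) set" where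
  "aux_index s = {..<p ^ (s - 1)} \<times> {..<p} \<times> {..<p ^ (s - 1) + 3}"

definition aux_basis :: "int \<Rightarrow> nat \<Rightarrow> nat \<times> nat \<times> nat \<Rightarrow> int poly" where
  "aux_basis b s = (\<lambda>(i, k, j).
     X ^ (i + j * p ^ s) * half_trace b s ^ k * X ^ (p ^ (s - 1) * (p - 1 - k)))"

definition aux_reduced :: "int \<Rightarrow> int \<Rightarrow> nat \<Rightarrow> nat \<times> nat \<times> nat \<Rightarrow> int poly" where
  "aux_reduced b t s = (\<lambda>(i, k, j).
     X ^ (i * p ^ s + j + p ^ (s - 1) * (p - 1 - k)) *
     (of_int t * X ^ (p ^ (s - 1)) - half_trace b s) ^ k)"

lemma half_trace_monic:
  assumes "1 \<le> s"
  shows "degree (half_trace b s) = 2 * p ^ (s - 1)" "lead_coeff (half_trace b s) = 1"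
proof -
  obtain u where u: "s = Suc u"
    using assms by (cases s) auto
  define e where "e = p ^ u"
  have e: "0 < e"
    using prime_gt_0_nat[OF prime_p] by (simp add: e_def)
  \<comment> \<open>\<open>R\<close> is what remains after the top term. For
    \<open>i = s - 1\<close> the second exponent is \<open>0\<close>, which gives the constant
    \<open>b\<close>.\<close>
  define R where "R = of_int b + (\<Sum>i<u. X ^ (e + p ^ i) + of_int b * X ^ (e - p ^ i))"
  have degX: "degree (X ^ n) = n" for n
    by (simp add: degree_power_eq)
  have degb: "degree (of_int b * f) \<le> degree f" for f :: "int poly"
    by (simp add: of_int_poly degree_smult_le)
  have eq: "half_trace b s = X ^ (2 * e) + R"
    by (simp add: half_trace_def u R_def e_def mult_2)
  have "degree (\<Sum>i<u. X ^ (e + p ^ i) + of_int b * X ^ (e - p ^ i)) < 2 * e"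
  proof (rule degree_sum_less)
    fix i assume "i \<in> {..<u}"
    then have "p ^ i < e"
      using prime_gt_1_nat[OF prime_p] by (simp add: e_def)
    then show "degree (X ^ (e + p ^ i) + of_int b * X ^ (e - p ^ i)) < 2 * e"
      using degb[of "X ^ (e - p ^ i)"] degX[of "e + p ^ i"] degX[of "e - p ^ i"] e
      by (intro degree_add_less) linarith+
  qed (use e in simp)
  then have "degree R < 2 * e"
    unfolding R_def using e by (intro degree_add_less) (auto simp: of_int_poly)
  from degree_X_power_add[OF this]
  show "degree (half_trace b s) = 2 * p ^ (s - 1)" "lead_coeff (half_trace b s) = 1"
    unfolding eq by (simp_all add: u e_def)
qed

lemma p_power_pred: "1 \<le> s \<Longrightarrow> p ^ s = p ^ (s - 1) * p"
  by (cases s) auto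

lemma aux_basis_monic:
  assumes s: "1 \<le> s" and x: "(i, k, j) \<in> aux_index s"
  shows "lead_coeff (aux_basis b s (i, k, j)) = 1"
    "degree (aux_basis b s (i, k, j)) = p ^ (s - 1) * (p - 1) + (i + p ^ (s - 1) * (k + p * j))"
proof -
  have X: "lead_coeff (X ^ n) = 1" "degree (X ^ n) = n" for n
    using lead_coeff_monic_power[of X n] by (simp_all add: degree_power_eq)
  have W: "lead_coeff (half_trace b s ^ k) = 1" "degree (half_trace b s ^ k) = k * (2 * p ^ (s - 1))"
    using lead_coeff_monic_power[OF half_trace_monic(2)[OF s]]
      degree_monic_power[OF half_trace_monic(2)[OF s]] half_trace_monic(1)[OF s] by auto
  have nz: "half_trace b s ^ k \<noteq> 0" "X ^ n \<noteq> 0" for n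
  proof -
    have "half_trace b s \<noteq> 0"
      using half_trace_monic(2)[OF s, of b] by (metis coeff_0 zero_neq_one)
    then show "half_trace b s ^ k \<noteq> 0" "X ^ n \<noteq> 0"
      by simp_all
  qed
  have XW: "lead_coeff (X ^ (i + j * p ^ s) * half_trace b s ^ k) = 1"
    by (rule lead_coeff_monic_mult[OF X(1) W(1)])
  show "lead_coeff (aux_basis b s (i, k, j)) = 1"
    unfolding aux_basis_def prod.case by (rule lead_coeff_monic_mult[OF XW X(1)])
  have "degree (aux_basis b s (i, k, j)) =
      i + j * p ^ s + k * (2 * p ^ (s - 1)) + p ^ (s - 1) * (p - 1 - k)"
    unfolding aux_basis_def prod.case degree_monic_mult[OF XW nz(2)] degree_monic_mult[OF X(1) nz(1)] X(2) W(2) ..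
  \<comment> \<open>Naming the complement \<open>l\<close> removes the truncated
    subtraction.\<close>
  moreover obtain l where "p = k + l + 1"
    using x by (auto simp: aux_index_def dest: less_imp_Suc_add)
  ultimately show "degree (aux_basis b s (i, k, j)) = p ^ (s - 1) * (p - 1) + (i + p ^ (s - 1) * (k + p * j))"
    using p_power_pred[OF s] by (simp add: algebra_simps)
qed

lemma aux_reduced_degree:
  assumes s: "1 \<le> s" and x: "(i, k, j) \<in> aux_index s"
  shows "degree (aux_reduced b t s (i, k, j)) < p ^ (s - 1) * p ^ s + p ^ s + 3"
proof -
  define e where "e = p ^ (s - 1)"
  define Q where "Q = p ^ s"
  define V where "V = of_int t * X ^ e - half_trace b s"
  obtain l where l: "p = k + l + 1"
    using x by (auto simp: aux_index_def dest: less_imp_Suc_add)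
  have i: "i + 1 \<le> e" and j: "j \<le> e + 2"
    using x by (auto simp: aux_index_def e_def)
  have "degree (of_int t * X ^ e) \<le> 2 * e"
    by (simp add: of_int_poly degree_power_eq order.trans[OF degree_smult_le])
  then have V: "degree V \<le> 2 * e"
    unfolding V_def using half_trace_monic(1)[OF s] by (intro degree_diff_le) (simp_all add: e_def)
  have "degree (aux_reduced b t s (i, k, j)) \<le> degree (X ^ (i * Q + j + e * (p - 1 - k))) + degree (V ^ k)"
    unfolding aux_reduced_def prod.case V_def e_def Q_def by (rule degree_mult_le)
  also have "degree (X ^ (i * Q + j + e * (p - 1 - k))) = i * Q + j + e * (p - 1 - k)"
    by (simp add: degree_power_eq)
  also have "degree (V ^ k) \<le> 2 * e * k"
    using degree_power_le[of V k] V by (meson mult_le_mono1 order.trans)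
  \<comment> \<open>As \<open>i < e\<close>, the first term is at most \<open>e * Q - Q\<close>. The
    terms with \<open>e\<close> amount to \<open>e * (p - 1 + k)\<close>, at most
    \<open>2 * Q - 2 * e\<close>, and the spare \<open>2 * e\<close> absorbs \<open>j\<close> up to
    the constant.\<close>
  also have "i * Q + j + e * (p - 1 - k) + 2 * e * k < e * Q + Q + 3"
  proof -
    have "i * Q + Q \<le> e * Q"
      using mult_le_mono1[OF i, of Q] by (simp add: algebra_simps)
    moreover have "e * (p - 1 - k) + 2 * e * k + 2 * e \<le> 2 * Q"
      using p_power_pred[OF s] l by (simp add: Q_def e_def algebra_simps)
    ultimately show ?thesis
      using j by linarith
  qed
  finally show ?thesis
    by (simp add: e_def Q_def)
qed

lemma aux_basis_degrees_inj:
  assumes "1 \<le> s"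
  shows "inj_on (\<lambda>x. degree (aux_basis b s x)) (aux_index s)"
proof (rule inj_onI)
  fix x' y'
  assume asm: "x' \<in> aux_index s" "y' \<in> aux_index s"
    "degree (aux_basis b s x') = degree (aux_basis b s y')"
  obtain i k j i' k' j' where xy: "x' = (i, k, j)" "y' = (i', k', j')"
    by (metis prod_cases3)
  note x = asm(1)[unfolded xy] and y = asm(2)[unfolded xy] and eq = asm(3)[unfolded xy]
  define e where "e = p ^ (s - 1)"
  have lt: "i < e" "i' < e" "k < p" "k' < p"
    using x y by (auto simp: aux_index_def e_def)
  have *: "i + e * (k + p * j) = i' + e * (k' + p * j')"
    using eq aux_basis_monic(2)[OF assms x] aux_basis_monic(2)[OF assms y] by (simp add: e_def)
  then have "(i + e * (k + p * j)) mod e = (i' + e * (k' + p * j')) mod e"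
      "(i + e * (k + p * j)) div e = (i' + e * (k' + p * j')) div e"
    by simp_all
  then have i: "i = i'" and kj: "k + p * j = k' + p * j'"
    using lt by simp_all
  from kj have "(k + p * j) mod p = (k' + p * j') mod p" "(k + p * j) div p = (k' + p * j') div p"
    by simp_all
  then show "x' = y'"
    using lt i xy by simp
qed

end

section \<open>Frobenius on a fibre of the trace\<close>

context irreducible_modulus
begin

text \<open>Raising \<open>w\<close> to the power \<open>p ^ s\<close> turns the first
  \<open>s\<close> of \<open>2 * s\<close> conjugates into the last \<open>s\<close>, so
  \<open>w\<close> and its power add up to the trace \<open>t\<close>. The extra powers of
  \<open>X\<close> clear the denominators on both sides.\<close>

lemma half_trace_power:
  assumes c0: "\<not> int p dvd coeff P 0" and s: "1 \<le> s" and j: "j * d = 2 * s"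
    and t: "[int j * tr b P = t] (mod int p)"
  shows "X ^ (p ^ (s - 1)) * half_trace b s ^ (p ^ s) \<doteq>
    X ^ (p ^ (s - 1) * p ^ s) * (of_int t * X ^ (p ^ (s - 1)) - half_trace b s)"
proof -
  obtain Y where Y: "X * Y \<doteq> 1"
    using inverse_exists[OF c0] .
  define e where "e = p ^ (s - 1)"
  define z where "z = (\<lambda>i. X ^ (p ^ i) + of_int b * Y ^ (p ^ i))"
  define w where "w = (\<Sum>i<s. z i)"
  have W: "half_trace b s \<doteq> X ^ e * w"
    unfolding half_trace_def w_def sum_distrib_left e_def[symmetric]
  proof (rule K.eqm_sum)
    fix i assume "i \<in> {..<s}"
    then have "p ^ i \<le> e"
      using prime_gt_0_nat[OF prime_p] by (auto simp: e_def intro!: power_increasing)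
    then have e: "e = (e - p ^ i) + p ^ i"
      by simp
    have "X ^ (e + p ^ i) + of_int b * X ^ (e - p ^ i) =
        X ^ e * X ^ (p ^ i) + of_int b * (X ^ (e - p ^ i) * 1)"
      by (simp only: power_add mult_1_right)
    also have "\<dots> \<doteq> X ^ e * X ^ (p ^ i) + of_int b * (X ^ (e - p ^ i) * (X ^ (p ^ i) * Y ^ (p ^ i)))"
      by (intro K.eqm_add K.eqm_mult K.eqm_refl K.eqm_sym[OF inverse_power[OF Y]])
    also have "X ^ (e - p ^ i) * (X ^ (p ^ i) * Y ^ (p ^ i)) = X ^ e * Y ^ (p ^ i)"
      by (metis e mult.assoc power_add)
    also have "X ^ e * X ^ (p ^ i) + of_int b * (X ^ e * Y ^ (p ^ i)) = X ^ e * z i"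
      by (simp only: z_def algebra_simps)
    finally show "X ^ (e + p ^ i) + of_int b * X ^ (e - p ^ i) \<doteq> X ^ e * z i" .
  qed
  have zs: "z i ^ (p ^ s) \<doteq> z (s + i)" for i
  proof -
    have "z i ^ (p ^ s) \<doteq> (X ^ (p ^ i)) ^ (p ^ s) + (of_int b * Y ^ (p ^ i)) ^ (p ^ s)"
      unfolding z_def by (rule K.dream_power)
    also have "\<dots> = X ^ (p ^ (s + i)) + of_int b ^ (p ^ s) * Y ^ (p ^ (s + i))"
      by (simp only: power_mult_distrib power_power_p add.commute)
    also have "\<dots> \<doteq> z (s + i)"
      unfolding z_def by (intro K.eqm_add K.eqm_mult K.eqm_refl K.fermat_int)
    finally show ?thesis .
  qed
  have "(\<Sum>i<s + n. z i) = w + (\<Sum>i<n. z (s + i))" for n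
    by (induction n) (simp_all add: w_def)
  then have tw: "w + (\<Sum>i<s. z (s + i)) = (\<Sum>i<j * d. z i)"
    unfolding j mult_2 by metis
  have "w ^ (p ^ s) \<doteq> (\<Sum>i<s. z i ^ (p ^ s))"
    unfolding w_def by (rule K.dream_sum)
  also have "\<dots> \<doteq> (\<Sum>i<s. z (s + i))"
    by (intro K.eqm_sum zs)
  also have "\<dots> = (\<Sum>i<j * d. z i) - w"
    unfolding tw[symmetric] by simp
  also have "\<dots> \<doteq> of_int (int j * tr b P) - w"
    unfolding z_def by (intro K.eqm_diff K.eqm_refl trace[OF c0 Y])
  also have "\<dots> \<doteq> of_int t - w"
    by (intro K.eqm_diff K.eqm_refl K.of_int_eqm t)
  finally have wQ: "w ^ (p ^ s) \<doteq> of_int t - w" .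
  have "X ^ e * half_trace b s ^ (p ^ s) \<doteq> X ^ e * (X ^ e * w) ^ (p ^ s)"
    by (intro K.eqm_mult K.eqm_power K.eqm_refl W)
  also have "\<dots> = X ^ e * (X ^ (e * p ^ s) * w ^ (p ^ s))"
    by (simp only: power_mult_distrib power_mult)
  also have "\<dots> \<doteq> X ^ e * (X ^ (e * p ^ s) * (of_int t - w))"
    by (intro K.eqm_mult K.eqm_refl wQ)
  also have "\<dots> = X ^ (e * p ^ s) * (of_int t * X ^ e - X ^ e * w)"
    by (simp only: algebra_simps)
  also have "\<dots> \<doteq> X ^ (e * p ^ s) * (of_int t * X ^ e - half_trace b s)"
    by (intro K.eqm_mult K.eqm_diff K.eqm_refl K.eqm_sym[OF W])
  finally show ?thesis
    by (simp only: e_def)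
qed

text \<open>The two monomials in \<open>X\<close> balance the clearing factors,
  \<open>X ^ (p ^ (s - 1) * (p - 1))\<close> in either family. They are the same for the whole index
  set, which lets a linear relation between the reduced entries carry over to the powers.\<close>

lemma aux_basis_power:
  assumes c0: "\<not> int p dvd coeff P 0" and s: "1 \<le> s" and j: "j * d = 2 * s"
    and t: "[int j * tr b P = t] (mod int p)" and x: "x \<in> aux_index s"
  shows "X ^ (p ^ (s - 1) * (p - 1)) * aux_basis b s x ^ (p ^ s) \<doteq>
    X ^ (p ^ s * (p ^ (s - 1) * (p - 1))) * aux_reduced b t s x"
proof -
  obtain i k h where x': "x = (i, k, h)"
    by (cases x)
  obtain l where "p = k + l + 1"
    using x by (auto simp: aux_index_def x' dest: less_imp_Suc_add)
  then have l: "p - 1 - k = l" "p - 1 = k + l"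
    by simp_all
  define e where "e = p ^ (s - 1)"
  define Q where "Q = p ^ s"
  define V where "V = of_int t * X ^ e - half_trace b s"
  have W: "X ^ e * half_trace b s ^ Q \<doteq> X ^ (e * Q) * V"
    using half_trace_power[OF c0 s j t] by (simp only: e_def Q_def V_def)
  have "X ^ (Q * Q) \<doteq> X"
    using X_periodic[of j] by (simp only: j mult_2 power_add Q_def)
  then have XQ: "X ^ (h * Q * Q) \<doteq> X ^ h"
    using K.eqm_power[of "X ^ (Q * Q)" X h] by (simp only: power_mult[symmetric] mult_ac)
  have "X ^ (e * (p - 1)) * aux_basis b s x ^ Q =
      X ^ (e * l + i * Q + e * l * Q) * (X ^ (h * Q * Q) * (X ^ e * half_trace b s ^ Q) ^ k)"
    unfolding x' aux_basis_def prod.case l e_def[symmetric] Q_def[symmetric]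
    by (simp only: power_mult_distrib power_mult[symmetric] power_add[symmetric]
        distrib_left distrib_right mult_ac add_ac diff_add_inverse)
  also have "\<dots> \<doteq> X ^ (e * l + i * Q + e * l * Q) * (X ^ h * (X ^ (e * Q) * V) ^ k)"
    by (intro K.eqm_mult K.eqm_refl K.eqm_power XQ W)
  also have "\<dots> = X ^ (Q * (e * (p - 1))) * aux_reduced b t s x"
    unfolding x' aux_reduced_def prod.case l e_def[symmetric] Q_def[symmetric] V_def[symmetric]
    by (simp only: power_mult_distrib power_mult[symmetric] power_add[symmetric]
        distrib_left distrib_right mult_ac add_ac diff_add_inverse)
  finally show ?thesis
    by (simp only: e_def Q_def)
qed

text \<open>Integers are fixed by Frobenius, so the \<open>p ^ s\<close>-th power of the combination
  is the combination of the powers with the same coefficients. It vanishes by the relation, and a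
  prime ideal containing a power contains its base.\<close>

lemma aux_vanishes:
  assumes c0: "\<not> int p dvd coeff P 0" and s: "1 \<le> s" and j: "j * d = 2 * s"
    and t: "[int j * tr b P = t] (mod int p)"
    and rel: "(\<Sum>x\<in>aux_index s. of_int (c x) * aux_reduced b t s x) \<in> modp"
  shows "(\<Sum>x\<in>aux_index s. of_int (c x) * aux_basis b s x) \<in> pideal P"
proof -
  define H where "H = (\<Sum>x\<in>aux_index s. of_int (c x) * aux_basis b s x)"
  define m n where "m = X ^ (p ^ (s - 1) * (p - 1))" and "n = X ^ (p ^ s * (p ^ (s - 1) * (p - 1)))"
  have "m * H ^ (p ^ s) \<doteq> m * (\<Sum>x\<in>aux_index s. (of_int (c x) * aux_basis b s x) ^ (p ^ s))"
    unfolding H_def by (intro K.eqm_mult K.eqm_refl K.dream_sum)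
  also have "\<dots> = (\<Sum>x\<in>aux_index s. of_int (c x) ^ (p ^ s) * (m * aux_basis b s x ^ (p ^ s)))"
    by (simp only: sum_distrib_left power_mult_distrib mult_ac)
  also have "\<dots> \<doteq> (\<Sum>x\<in>aux_index s. of_int (c x) * (n * aux_reduced b t s x))"
    unfolding m_def n_def
    by (intro K.eqm_sum K.eqm_mult K.fermat_int aux_basis_power[OF c0 s j t])
  also have "\<dots> = n * (\<Sum>x\<in>aux_index s. of_int (c x) * aux_reduced b t s x)"
    by (simp only: sum_distrib_left mult_ac)
  finally have "m * H ^ (p ^ s) \<in> pideal P"
    using K.eqm_mem K.mult_mem[OF modp_subset[OF rel]] by blast
  moreover have "m \<notin> pideal P"
    unfolding m_def using K.power_mem X_notin[OF c0] by blast
  ultimately show ?thesis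
    using K.prime_mem K.power_mem H_def by blast
qed

end

context prime_modulus
begin

text \<open>Encodes the nonzero \<open>x\<close> in the field with \<open>p ^ r\<close> elements at
  which \<open>x + b / x\<close> has trace \<open>t\<close>; the condition on
  \<open>coeff P 0\<close> excludes \<open>P = X\<close>, that is, the root
  \<open>0\<close>.\<close>

definition trace_fibre :: "int \<Rightarrow> nat \<Rightarrow> int \<Rightarrow> (int poly \<times> nat) set" where
  "trace_fibre b r t = {(P, j) \<in> power_sum_index r. \<not> int p dvd coeff P 0 \<and> [int j * tr b P = t] (mod int p)}"

theorem stepanov:
  assumes s: "1 \<le> s"
  shows "(\<Sum>(P, j)\<in>trace_fibre b (2 * s) t. degree P) \<le> p ^ (2 * s - 1) + 4 * p ^ s"
proof -
  define e where "e = p ^ (s - 1)"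
  define Q where "Q = p ^ s"
  have "p \<le> p ^ s"
    using prime_ge_2_nat[OF prime_p] s by (intro self_le_power) auto
  then have Q: "Q = e * p" "2 \<le> Q"
    using p_power_pred[OF s] prime_ge_2_nat[OF prime_p] unfolding Q_def e_def by linarith+
  have fin: "finite (aux_index s)" and card: "card (aux_index s) = Q * (e + 3)"
    using Q(1) by (simp_all add: aux_index_def e_def card_cartesian_product mult.assoc)
  \<comment> \<open>The excess of unknowns is \<open>2 * Q - 3\<close>, positive since
    \<open>Q\<close> is at least \<open>2\<close>.\<close>
  have big: "e * Q + Q + 3 < card (aux_index s)"
    unfolding card using Q(2) by (simp add: algebra_simps)
  have deg: "degree (aux_reduced b t s x) < e * Q + Q + 3" if "x \<in> aux_index s" for x
  proof -
    obtain i k j where "x = (i, k, j)"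
      by (metis prod_cases3)
    then show ?thesis
      using that aux_reduced_degree[OF s] by (simp add: e_def Q_def)
  qed
  obtain c where c: "\<exists>x\<in>aux_index s. \<not> int p dvd c x"
      "(\<Sum>x\<in>aux_index s. of_int (c x) * aux_reduced b t s x) \<in> modp"
    by (rule pigeonhole_relation[OF fin deg big])
  define H where "H = (\<Sum>x\<in>aux_index s. of_int (c x) * aux_basis b s x)"
  have H: "H \<notin> modp"
    unfolding H_def
  proof (rule distinct_degrees_independent[OF fin _ aux_basis_degrees_inj[OF s] c(1)])
    show "lead_coeff (aux_basis b s x) = 1" if "x \<in> aux_index s" for x
      using that aux_basis_monic(1)[OF s] by (metis prod_cases3)
  qed
  have "degree H \<le> e * Q + 4 * Q"
    unfolding H_def
  proof (rule degree_sum_le[OF fin])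
    fix x assume x: "x \<in> aux_index s"
    obtain i k j where ikj: "x = (i, k, j)"
      by (cases x)
    have lt: "i + 1 \<le> e" "k + 1 \<le> p" "j + 1 \<le> e + 3"
      using x by (auto simp: ikj aux_index_def e_def)
    have "degree (of_int (c x) * aux_basis b s x) \<le> degree (aux_basis b s x)"
      by (simp add: of_int_poly degree_smult_le)
    also have "\<dots> = e * (p - 1) + (i + e * (k + p * j))"
      using aux_basis_monic(2)[OF s] x by (simp add: ikj e_def)
    also have "\<dots> = e * (p - 1) + i + e * k + Q * j"
      by (simp add: Q algebra_simps)
    also have "\<dots> \<le> e * Q + 4 * Q"
    proof -
      have "e * (p - 1) \<le> Q"
        by (simp add: Q)
      moreover have "e * k + e \<le> Q"
        using mult_le_mono2[OF lt(2), of e] by (simp add: Q)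
      moreover have "Q * j + Q \<le> Q * e + 3 * Q"
        using mult_le_mono2[OF lt(3), of Q] by (simp add: algebra_simps)
      ultimately show ?thesis
        using lt(1) mult.commute[of Q e] by linarith
    qed
    finally show "degree (of_int (c x) * aux_basis b s x) \<le> e * Q + 4 * Q" .
  qed
  moreover have "e * Q = p ^ (2 * s - 1)"
  proof -
    have "s - 1 + s = 2 * s - 1"
      using s by simp
    then show ?thesis
      unfolding e_def Q_def by (metis power_add)
  qed
  moreover have "(\<Sum>(P, j)\<in>trace_fibre b (2 * s) t. degree P) \<le> degree H"
  proof -
    \<comment> \<open>\<open>j\<close> is determined by \<open>P\<close>, so the fibre can be
      counted by its polynomials.\<close>
    have inj: "inj_on fst (trace_fibre b (2 * s) t)"
    proof (rule inj_onI)
      fix x y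
      assume xy: "x \<in> trace_fibre b (2 * s) t" "y \<in> trace_fibre b (2 * s) t" "fst x = fst y"
      obtain P j j' where eq: "x = (P, j)" "y = (P, j')"
        using xy(3) by (metis prod.collapse)
      then have "P \<in> Irr" "j * degree P = j' * degree P"
        using xy by (auto simp: trace_fibre_def power_sum_index_def)
      then show "x = y"
        using IrrD(2)[of P] eq by simp
    qed
    have "finite (trace_fibre b (2 * s) t)"
      by (rule finite_subset[OF _ finite_power_sum_index[of "2 * s"]]) (use s in \<open>auto simp: trace_fibre_def\<close>)
    then have "(\<Sum>P\<in>fst ` trace_fibre b (2 * s) t. degree P) \<le> degree H"
    proof (intro sum_degree_Irr_le H)
      show "fst ` trace_fibre b (2 * s) t \<subseteq> Irr"
        by (auto simp: trace_fibre_def power_sum_index_def)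
      fix P assume "P \<in> fst ` trace_fibre b (2 * s) t"
      then obtain j where "(P, j) \<in> trace_fibre b (2 * s) t"
        by auto
      then have j: "P \<in> Irr" "j * degree P = 2 * s" "\<not> int p dvd coeff P 0"
          "[int j * tr b P = t] (mod int p)"
        unfolding trace_fibre_def power_sum_index_def by simp_all
      interpret irreducible_modulus p P
        by unfold_locales (rule j(1))
      show "H \<in> pideal P"
        unfolding H_def by (rule aux_vanishes[OF j(3) s j(2,4) c(2)])
    qed simp
    then show ?thesis
      unfolding sum.reindex[OF inj] comp_def case_prod_unfold .
  qed
  ultimately show ?thesis
    by (simp add: Q_def)
qed

end

context prime_modulus
begin

section \<open>The L-function of a Kloosterman sum\<close>

definition psi :: "int \<Rightarrow> complex" where
  "psi c = cis (2 * pi * of_int c / of_nat p)"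

lemma psi_add: "psi (a + b) = psi a * psi b"
  by (simp add: psi_def cis_mult add_divide_distrib distrib_left)

lemma psi_0 [simp]: "psi 0 = 1"
  by (simp add: psi_def)

lemma norm_psi [simp]: "cmod (psi a) = 1"
  by (simp add: psi_def)

lemma cnj_psi: "cnj (psi a) = psi (- a)"
  by (simp add: psi_def cis_cnj)

lemma psi_mult_nat: "psi (int j * a) = psi a ^ j"
  by (induction j) (simp_all add: psi_add distrib_right)

lemma psi_eq_1_iff: "psi a = 1 \<longleftrightarrow> int p dvd a"
proof
  assume "int p dvd a"
  then obtain c where "a = int p * c" ..
  then have "2 * pi * of_int a / of_nat p = 2 * pi * of_int c"
    using p_gt_0 by simp
  then show "psi a = 1"
    unfolding psi_def by (simp only: cis_multiple_2pi Ints_of_int)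
next
  assume "psi a = 1"
  then have "cos (2 * pi * of_int a / of_nat p) = 1"
    by (simp add: psi_def complex_eq_iff)
  then obtain n where "2 * pi * of_int a / of_nat p = of_int n * 2 * pi"
    by (auto simp: cos_one_2pi_int)
  then have "of_int a = (of_int (n * int p) :: real)"
    using p_gt_0 by (simp add: field_simps)
  then have "a = n * int p"
    by (simp only: of_int_eq_iff)
  then show "int p dvd a"
    by simp
qed

lemma psi_cong: "[a = b] (mod int p) \<Longrightarrow> psi a = psi b"
  using psi_add[of b "a - b"] psi_eq_1_iff[of "a - b"] by (simp add: cong_iff_dvd_diff)

lemma sum_shift:
  fixes f :: "int \<Rightarrow> 'a::comm_monoid_add"
  assumes f: "\<And>a b. [a = b] (mod int p) \<Longrightarrow> f a = f b"
  shows "(\<Sum>c\<in>{0..<int p}. f (c + m)) = (\<Sum>c\<in>{0..<int p}. f c)"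
proof (rule sum.reindex_bij_witness[of _ "\<lambda>c. (c - m) mod int p" "\<lambda>c. (c + m) mod int p"])
  fix c assume c: "c \<in> {0..<int p}"
  show "((c + m) mod int p - m) mod int p = c" "((c - m) mod int p + m) mod int p = c"
    using c by (simp_all add: mod_diff_left_eq mod_add_left_eq)
  show "(c + m) mod int p \<in> {0..<int p}" "(c - m) mod int p \<in> {0..<int p}"
    using p_gt_0 by simp_all
  show "f ((c + m) mod int p) = f (c + m)"
    by (rule f) (simp add: cong_def)
qed

lemma sum_negate:
  fixes f :: "int \<Rightarrow> 'a::comm_monoid_add"
  assumes f: "\<And>a b. [a = b] (mod int p) \<Longrightarrow> f a = f b"
  shows "(\<Sum>c\<in>{0..<int p}. f (- c)) = (\<Sum>c\<in>{0..<int p}. f c)"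
proof (rule sum.reindex_bij_witness[of _ "\<lambda>c. (- c) mod int p" "\<lambda>c. (- c) mod int p"])
  fix c assume c: "c \<in> {0..<int p}"
  show "- (- c mod int p) mod int p = c" "- (- c mod int p) mod int p = c"
    using c by (simp_all add: mod_minus_eq)
  show "(- c) mod int p \<in> {0..<int p}" "(- c) mod int p \<in> {0..<int p}"
    using p_gt_0 by simp_all
  show "f ((- c) mod int p) = f (- c)"
    by (rule f) (simp add: cong_def)
qed

lemma sum_psi:
  assumes "\<not> int p dvd a"
  shows "(\<Sum>c\<in>{0..<int p}. psi (a * c)) = 0"
proof -
  have "(\<Sum>c\<in>{0..<int p}. psi (a * c)) = (\<Sum>c\<in>{0..<int p}. psi (a * (c + 1)))"
    by (rule sum_shift[symmetric]) (auto intro: psi_cong cong_scalar_left)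
  also have "\<dots> = (\<Sum>c\<in>{0..<int p}. psi (a * c)) * psi a"
    by (simp add: distrib_left psi_add sum_distrib_right)
  finally show ?thesis
    using assms psi_eq_1_iff[of a] by simp
qed

lemma not_dvd_power: "\<not> int p dvd a \<Longrightarrow> \<not> int p dvd a ^ n"
  using prime_p by (metis prime_dvd_power prime_nat_int_transfer)

lemma inverse_mod:
  assumes "\<not> int p dvd a"
  shows "[a * a ^ (p - 2) = 1] (mod int p)"
proof -
  interpret K: prime_ideal_char modp p
    by (rule prime_ideal_modp)
  have "of_int (a ^ p - a) \<in> modp"
    using K.fermat_int[of a 1] by (simp add: K.eqm_def)
  then have "int p dvd a ^ p - a"
    using K.of_int_mem_iff by blast
  moreover have "a ^ p = a * (a * a ^ (p - 2))"
    using prime_ge_2_nat[OF prime_p] by (metis le_add_diff_inverse numeral_2_eq_2 plus_nat.simps power_Suc)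
  ultimately have "int p dvd a * (a * a ^ (p - 2) - 1)"
    by (simp add: right_diff_distrib)
  then show ?thesis
    using assms prime_p by (simp add: cong_iff_dvd_diff prime_dvd_mult_iff)
qed

text \<open>The value \<open>0\<close> when \<open>p\<close> divides the constant coefficient
  reflects the pole of \<open>b / x\<close> at \<open>0\<close> and keeps the function
  multiplicative.\<close>

definition kl_char :: "int \<Rightarrow> int poly \<Rightarrow> complex" where
  "kl_char b f = (if int p dvd coeff f 0 then 0 else psi (tr b f))"

lemma coeff_reflect_1: "coeff (reflect_poly f) 1 = (if degree f = 0 then 0 else coeff f (degree f - 1))"
  by (auto simp: coeff_reflect_poly)

lemma kl_char_red:
  assumes "lead_coeff f = 1"
  shows "kl_char b (red f) = kl_char b f"
proof -
  have deg: "degree (red f) = degree f"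
    using monicsD(1)[OF red_monic[OF assms]] .
  have c: "[coeff (red f) i = coeff f i] (mod int p)" for i
    by (simp add: coeff_red cong_def)
  have "[coeff (reflect_poly (red f)) 1 = coeff (reflect_poly f) 1] (mod int p)"
    unfolding coeff_reflect_1 deg using c by simp
  then have "[tr b (red f) = tr b f] (mod int p)"
    unfolding tr_def using c
    by (intro cong_minus_minus_iff[THEN iffD2] cong_add cong_mult cong_pow cong_refl)
  moreover have "int p dvd coeff (red f) 0 \<longleftrightarrow> int p dvd coeff f 0"
    using c[of 0] by (rule cong_dvd_iff[OF _, rotated 0]) 
  ultimately show ?thesis
    using psi_cong by (simp add: kl_char_def)
qed

lemma coeff_mult_1: "coeff (f * g) (Suc 0) = coeff f 0 * coeff g 1 + coeff f 1 * coeff g 0"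
  by (simp add: coeff_mult)

text \<open>Both parts of \<open>tr\<close> are additive on products of monic polynomials: the
  second highest coefficient, and the logarithmic derivative at \<open>0\<close>, which is
  \<open>coeff f 1 / coeff f 0\<close> modulo \<open>p\<close>.\<close>

lemma kl_char_mult:
  assumes f: "lead_coeff f = 1" and g: "lead_coeff g = 1"
  shows "kl_char b (f * g) = kl_char b f * kl_char b g"
proof (cases "int p dvd coeff f 0 \<or> int p dvd coeff g 0")
  case True
  then show ?thesis
    by (auto simp: kl_char_def coeff_mult_0)
next
  case False
  define f0 f1 g0 g1 where "f0 = coeff f 0" and "f1 = coeff f 1" and "g0 = coeff g 0" and "g1 = coeff g 1"
  have f0: "[f0 * f0 ^ (p - 2) = 1] (mod int p)" and g0: "[g0 * g0 ^ (p - 2) = 1] (mod int p)"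
    using False by (auto intro!: inverse_mod simp: f0_def g0_def)
  have r: "coeff (reflect_poly (f * g)) 1 = coeff (reflect_poly f) 1 + coeff (reflect_poly g) 1"
    using f g by (simp add: reflect_poly_mult coeff_mult_1)
  have "tr b (f * g) = - (coeff (reflect_poly f) 1 + coeff (reflect_poly g) 1) -
      b * (g1 * g0 ^ (p - 2) * (f0 * f0 ^ (p - 2)) + f1 * f0 ^ (p - 2) * (g0 * g0 ^ (p - 2)))"
    unfolding tr_def r by (simp add: coeff_mult_1 coeff_mult_0 f0_def f1_def g0_def g1_def power_mult_distrib algebra_simps)
  also have "[\<dots> = - (coeff (reflect_poly f) 1 + coeff (reflect_poly g) 1) -
      b * (g1 * g0 ^ (p - 2) * 1 + f1 * f0 ^ (p - 2) * 1)] (mod int p)"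
    by (intro cong_diff cong_mult cong_add cong_refl f0 g0)
  also have "- (coeff (reflect_poly f) 1 + coeff (reflect_poly g) 1) -
      b * (g1 * g0 ^ (p - 2) * 1 + f1 * f0 ^ (p - 2) * 1) = tr b f + tr b g"
    by (simp add: tr_def f0_def f1_def g0_def g1_def algebra_simps)
  finally have "psi (tr b (f * g)) = psi (tr b f) * psi (tr b g)"
    using psi_cong psi_add by metis
  moreover have "\<not> int p dvd coeff (f * g) 0"
    using False prime_p by (simp add: coeff_mult_0 prime_dvd_mult_iff)
  ultimately show ?thesis
    using False by (simp add: kl_char_def)
qed

lemma kl_char_1: "kl_char b 1 = 1"
  using p_gt_1 by (simp add: kl_char_def tr_def coeff_1)

lemma bij_monics_1: "bij_betw (\<lambda>c. [:c, 1:]) {0..<int p} (monics 1)"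
proof (rule bij_betw_imageI)
  show "(\<lambda>c. [:c, 1:]) ` {0..<int p} = monics 1"
  proof (intro equalityI subsetI)
    fix f assume f: "f \<in> monics 1"
    have "f = [:coeff f 0, 1:]"
      using monicsD[OF f] by (auto simp: poly_eq_iff coeff_pCons coeff_eq_0 split: nat.splits)
    moreover have "coeff f 0 \<in> {0..<int p}"
      using f by (simp add: monics_def)
    ultimately show "f \<in> (\<lambda>c. [:c, 1:]) ` {0..<int p}"
      by blast
  qed (use p_gt_1 in \<open>auto simp: monics_def coeff_pCons split: nat.splits\<close>)
qed (auto simp: inj_on_def)

lemma bij_monics_2: "bij_betw (\<lambda>(c, a). [:c, a, 1:]) ({0..<int p} \<times> {0..<int p}) (monics 2)"
proof (rule bij_betw_imageI)
  show "(\<lambda>(c, a). [:c, a, 1:]) ` ({0..<int p} \<times> {0..<int p}) = monics 2"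
  proof (intro equalityI subsetI)
    fix f assume f: "f \<in> monics 2"
    have "f = [:coeff f 0, coeff f 1, 1:]"
    proof (rule poly_eqI)
      fix n :: nat
      consider "n = 0" | "n = 1" | "n = 2" | "n > 2"
        by linarith
      then show "coeff f n = coeff [:coeff f 0, coeff f 1, 1:] n"
        using monicsD[OF f] by cases (auto simp: numeral_2_eq_2 coeff_eq_0 coeff_pCons split: nat.splits)
    qed
    moreover have "coeff f 0 \<in> {0..<int p}" "coeff f 1 \<in> {0..<int p}"
      using f by (simp_all add: monics_def)
    ultimately show "f \<in> (\<lambda>(c, a). [:c, a, 1:]) ` ({0..<int p} \<times> {0..<int p})"
      by (intro image_eqI[of _ _ "(coeff f 0, coeff f 1)"]) auto
  qed (use p_gt_1 in \<open>auto simp: monics_def coeff_pCons numeral_2_eq_2 split: nat.splits\<close>)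
qed (auto simp: inj_on_def)

definition kloosterman :: "int \<Rightarrow> complex" where
  "kloosterman b = (\<Sum>x\<in>{1..<int p}. psi (x + b * x ^ (p - 2)))"

lemma units_dvd: "x \<in> {1..<int p} \<Longrightarrow> \<not> int p dvd x"
  using zdvd_imp_le[of "int p" x] by auto

lemma residues_split: "{0..<int p} = insert 0 {1..<int p}"
  using p_gt_0 by auto

lemma Lcoeff_0: "Lcoeff (kl_char b) 0 = 1"
  by (simp add: Lcoeff_def kl_char_1)

text \<open>The root of \<open>X + c\<close> is \<open>- c\<close>, hence the complex
  conjugate.\<close>

lemma Lcoeff_1: "Lcoeff (kl_char b) 1 = cnj (kloosterman b)"
proof -
  have "Lcoeff (kl_char b) 1 = (\<Sum>c\<in>{0..<int p}. kl_char b [:c, 1:])"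
    unfolding Lcoeff_def by (rule sum.reindex_bij_betw[OF bij_monics_1, symmetric])
  also have "\<dots> = (\<Sum>c\<in>{1..<int p}. kl_char b [:c, 1:])"
    unfolding residues_split by (subst sum.insert) (auto simp: kl_char_def)
  also have "\<dots> = (\<Sum>c\<in>{1..<int p}. psi (- (c + b * c ^ (p - 2))))"
    by (rule sum.cong) (use units_dvd in \<open>auto simp: kl_char_def tr_def coeff_reflect_poly\<close>)
  finally show ?thesis
    by (simp only: kloosterman_def cnj_sum cnj_psi)
qed

text \<open>For \<open>X^2 + a * X + c\<close> the trace is \<open>- a * (1 + b / c)\<close>. The
  sum over \<open>a\<close> vanishes unless \<open>c = - b\<close>, when it is
  \<open>p\<close>.\<close>

lemma Lcoeff_2:
  assumes b: "\<not> int p dvd b"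
  shows "Lcoeff (kl_char b) 2 = of_nat p"
proof -
  define u where "u c = 1 + b * c ^ (p - 2)" for c
  have "Lcoeff (kl_char b) 2 = (\<Sum>(c, a)\<in>{0..<int p} \<times> {0..<int p}. kl_char b [:c, a, 1:])"
    unfolding Lcoeff_def sum.reindex_bij_betw[OF bij_monics_2, symmetric]
    by (simp only: case_prod_unfold)
  also have "\<dots> = (\<Sum>c\<in>{0..<int p}. \<Sum>a\<in>{0..<int p}. kl_char b [:c, a, 1:])"
    by (simp add: sum.cartesian_product)
  also have "\<dots> = (\<Sum>c\<in>{1..<int p}. \<Sum>a\<in>{0..<int p}. kl_char b [:c, a, 1:])"
    unfolding residues_split by (subst sum.insert) (auto simp: kl_char_def)
  also have "\<dots> = (\<Sum>c\<in>{1..<int p}. \<Sum>a\<in>{0..<int p}. psi (- u c * a))"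
  proof (intro sum.cong refl)
    fix c a assume "c \<in> {1..<int p}"
    moreover have "coeff (reflect_poly [:c, a, 1:]) 1 = a"
      by (simp add: coeff_reflect_poly)
    ultimately show "kl_char b [:c, a, 1:] = psi (- u c * a)"
      using units_dvd by (simp add: kl_char_def tr_def u_def algebra_simps)
  qed
  also have "\<dots> = (\<Sum>c\<in>{1..<int p}. if c = (- b) mod int p then of_nat p else 0)"
  proof (rule sum.cong[OF refl])
    fix c assume c: "c \<in> {1..<int p}"
    have nc: "\<not> int p dvd c"
      using c by (rule units_dvd)
    have "c * u c = c + b * (c * c ^ (p - 2))"
      by (simp add: u_def algebra_simps)
    also have "[\<dots> = c + b * 1] (mod int p)"
      by (intro cong_add cong_mult cong_refl inverse_mod nc)
    finally have "[c * u c = c + b] (mod int p)"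
      by simp
    then have "int p dvd c * u c \<longleftrightarrow> int p dvd c + b"
      by (rule cong_dvd_iff[OF _, rotated 0])
    then have dvd: "int p dvd u c \<longleftrightarrow> int p dvd c + b"
      using nc prime_p by (simp add: prime_dvd_mult_iff)
    have "c = (- b) mod int p \<longleftrightarrow> c mod int p = (- b) mod int p"
      using c by simp
    also have "\<dots> \<longleftrightarrow> int p dvd c + b"
      using mod_eq_dvd_iff[of c "int p" "- b"] by simp
    finally have iff: "c = (- b) mod int p \<longleftrightarrow> int p dvd u c"
      using dvd by simp
    show "(\<Sum>a\<in>{0..<int p}. psi (- u c * a)) = (if c = (- b) mod int p then of_nat p else 0)"
    proof (cases "int p dvd u c")
      case True
      then have "psi (- u c * a) = 1" for a
        by (simp add: psi_eq_1_iff)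
      then show ?thesis
        using iff True by simp
    next
      case False
      then show ?thesis
        using iff sum_psi[of "- u c"] by simp
    qed
  qed
  also have "\<dots> = of_nat p"
  proof -
    have "(- b) mod int p \<noteq> 0"
      using b by (simp add: mod_eq_0_iff_dvd)
    moreover have "(- b) mod int p \<ge> 0" "(- b) mod int p < int p"
      using p_gt_0 by simp_all
    ultimately have "(- b) mod int p \<in> {1..<int p}"
      by simp
    then show ?thesis
      by (simp add: sum.delta)
  qed
  finally show ?thesis .
qed

text \<open>Adding \<open>X ^ (d - 1)\<close> permutes the monic polynomials of degree
  \<open>d\<close> modulo \<open>p\<close>. As \<open>d - 1\<close> is at least \<open>2\<close>,
  the coefficients at \<open>0\<close> and \<open>1\<close> stay, so the character is multiplied by
  \<open>psi (- 1)\<close>, which is not \<open>1\<close>.\<close>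

lemma Lcoeff_ge_3:
  assumes d: "3 \<le> d"
  shows "Lcoeff (kl_char b) d = 0"
proof -
  define \<tau> where "\<tau> f = red (f + monom 1 (d - 1))" for f
  have facts: "degree (f + monom 1 (d - 1)) = d" "lead_coeff (f + monom 1 (d - 1)) = 1"
    if f: "f \<in> monics d" for f
  proof -
    have "degree (monom (1::int) (d - 1)) < degree f"
      using d monicsD(1)[OF f] by (simp add: degree_monom_eq)
    then show deg: "degree (f + monom 1 (d - 1)) = d"
      using monicsD(1)[OF f] by (simp add: degree_add_eq_left)
    show "lead_coeff (f + monom 1 (d - 1)) = 1"
      unfolding deg using d monicsD(4)[OF f] by simp
  qed
  have \<tau>: "\<tau> f \<in> monics d" if "f \<in> monics d" for f
    using red_monic[OF facts(2)[OF that]] facts(1)[OF that] by (simp add: \<tau>_def)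
  have inj: "inj_on \<tau> (monics d)"
  proof (rule inj_onI)
    fix f g assume fg: "f \<in> monics d" "g \<in> monics d" "\<tau> f = \<tau> g"
    then show "f = g"
      using monics_eqI[OF fg(1,2)] by (simp add: \<tau>_def red_eq_iff)
  qed
  have "bij_betw \<tau> (monics d) (monics d)"
    using inj \<tau> by (simp add: bij_betw_def endo_inj_surj finite_monics image_subset_iff)
  then have "Lcoeff (kl_char b) d = (\<Sum>f\<in>monics d. kl_char b (\<tau> f))"
    unfolding Lcoeff_def by (rule sum.reindex_bij_betw[symmetric])
  also have "\<dots> = (\<Sum>f\<in>monics d. psi (- 1) * kl_char b f)"
  proof (rule sum.cong[OF refl])
    fix f assume f: "f \<in> monics d"
    let ?g = "f + monom 1 (d - 1)"
    have c: "coeff ?g 0 = coeff f 0" "coeff ?g 1 = coeff f 1"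
      using d by simp_all
    have "coeff (reflect_poly ?g) 1 = coeff (reflect_poly f) 1 + 1"
      unfolding coeff_reflect_1 facts(1)[OF f] monicsD(1)[OF f] using d by simp
    then have "tr b ?g = - 1 + tr b f"
      unfolding tr_def c by simp
    then have "kl_char b ?g = psi (- 1) * kl_char b f"
      unfolding kl_char_def c by (simp only: psi_add mult_zero_right split: if_split) simp
    then show "kl_char b (\<tau> f) = psi (- 1) * kl_char b f"
      unfolding \<tau>_def using kl_char_red facts[OF f] by simp
  qed
  also have "\<dots> = psi (- 1) * Lcoeff (kl_char b) d"
    by (simp add: Lcoeff_def sum_distrib_left)
  finally have "(1 - psi (- 1)) * Lcoeff (kl_char b) d = 0"
    by (simp add: algebra_simps)
  moreover have "psi (- 1) \<noteq> 1"
    using psi_eq_1_iff[of "- 1"] p_gt_1 by (simp add: zdvd1_eq)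
  ultimately show ?thesis
    by simp
qed

end

section \<open>The Weil bound for Kloosterman sums\<close>

text \<open>Since the unit vectors \<open>z\<close> sum to \<open>0\<close>, the bound
  \<open>B\<close> can be subtracted from each \<open>n\<close>; the differences have constant sign,
  so their absolute values add up to an explicit number.\<close>

lemma norm_weighted_sum_le:
  fixes n :: "'a \<Rightarrow> nat" and z :: "'a \<Rightarrow> complex"
  assumes "finite A" "\<And>t. t \<in> A \<Longrightarrow> n t \<le> B" "\<And>t. t \<in> A \<Longrightarrow> cmod (z t) = 1" "(\<Sum>t\<in>A. z t) = 0"
  shows "cmod (\<Sum>t\<in>A. of_nat (n t) * z t) \<le> real (card A) * real B - real (\<Sum>t\<in>A. n t)"
proof -
  have "(\<Sum>t\<in>A. of_nat (n t) * z t) = (\<Sum>t\<in>A. (of_nat (n t) - of_nat B) * z t)"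
    using assms(4) by (simp add: left_diff_distrib sum_subtractf sum_distrib_left[symmetric])
  also have "cmod \<dots> \<le> (\<Sum>t\<in>A. real B - real (n t))"
  proof (rule sum_norm_le)
    fix t assume t: "t \<in> A"
    have "complex_of_nat (n t) - of_nat B = - complex_of_real (real B - real (n t))"
      by simp
    then have "cmod (of_nat (n t) - of_nat B) = \<bar>real B - real (n t)\<bar>"
      by (metis norm_minus_cancel norm_of_real)
    then show "cmod ((of_nat (n t) - of_nat B) * z t) \<le> real B - real (n t)"
      using assms(2,3)[OF t] by (simp add: norm_mult)
  qed
  finally show ?thesis
    by (simp add: sum_subtractf)
qed

lemma le_of_power_bound:
  fixes x p C :: real
  assumes "0 \<le> x" "0 < p" "\<And>s. 1 \<le> s \<Longrightarrow> x ^ s \<le> C * p ^ s"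
  shows "x \<le> p"
proof (rule ccontr)
  assume "\<not> x \<le> p"
  then have "1 < x / p"
    using assms by simp
  then obtain n where n: "C < (x / p) ^ n"
    using real_arch_pow by blast
  also have "\<dots> \<le> (x / p) ^ Suc n"
    using \<open>1 < x / p\<close> by (intro power_increasing) auto
  also have "\<dots> \<le> C"
    using assms(3)[of "Suc n"] assms(2) by (simp add: power_divide field_simps)
  finally show False
    by simp
qed

context prime_modulus
begin

lemma Irr_X: "\<lbrakk>P \<in> Irr; int p dvd coeff P 0\<rbrakk> \<Longrightarrow> P = X"
proof -
  assume P: "P \<in> Irr" and dvd: "int p dvd coeff P 0"
  have "coeff P 0 \<in> {0..<int p}"
    using IrrD(4)[OF P] by (simp add: monics_def)
  then have c0: "coeff P 0 = 0"
    using dvd by (auto dest: zdvd_not_zless[rotated] simp: order_le_less)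
  then obtain g where g: "P = X * g"
    by (cases P) auto
  then have "P \<in> pideal X"
    using pideal_self[of X g] by simp
  then have "\<not> 1 < degree P"
    using P by (auto simp: Irr_def dest: spec[of _ X])
  then have "degree P = 1"
    using IrrD(2)[OF P] by simp
  then show "P = X"
    using c0 IrrD(1)[OF P] by (auto simp: poly_eq_iff coeff_pCons coeff_eq_0 split: nat.splits)
qed

lemma disjoint_trace_fibres:
  assumes "1 \<le> r"
  shows "(\<Union>t\<in>{0..<int p}. trace_fibre b r t) = {(P, j) \<in> power_sum_index r. \<not> int p dvd coeff P 0}"
    and "\<And>t t'. \<lbrakk>t \<in> {0..<int p}; t' \<in> {0..<int p}; t \<noteq> t'\<rbrakk> \<Longrightarrow> trace_fibre b r t \<inter> trace_fibre b r t' = {}"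
    and "\<And>t. finite (trace_fibre b r t)"
proof -
  show "(\<Union>t\<in>{0..<int p}. trace_fibre b r t) = {(P, j) \<in> power_sum_index r. \<not> int p dvd coeff P 0}"
  proof (intro equalityI subsetI)
    fix x assume x: "x \<in> {(P, j) \<in> power_sum_index r. \<not> int p dvd coeff P 0}"
    obtain P j where Pj: "x = (P, j)"
      by (cases x)
    have "(int j * tr b P) mod int p \<in> {0..<int p}"
      using p_gt_0 by simp
    moreover have "x \<in> trace_fibre b r ((int j * tr b P) mod int p)"
      using x by (simp add: Pj trace_fibre_def cong_def)
    ultimately show "x \<in> (\<Union>t\<in>{0..<int p}. trace_fibre b r t)"
      by blast
  qed (auto simp: trace_fibre_def)
  show "trace_fibre b r t \<inter> trace_fibre b r t' = {}"
    if "t \<in> {0..<int p}" "t' \<in> {0..<int p}" "t \<noteq> t'" for t t'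
    using that by (auto simp: trace_fibre_def cong_def)
  show "finite (trace_fibre b r t)" for t
    by (rule finite_subset[OF _ finite_power_sum_index[OF assms]]) (auto simp: trace_fibre_def)
qed

lemma Psum_kl_char:
  assumes r: "1 \<le> r"
  shows "Psum (kl_char b) r = (\<Sum>t\<in>{0..<int p}. of_nat (\<Sum>(P, j)\<in>trace_fibre b r t. degree P) * psi t)"
proof -
  have "Psum (kl_char b) r =
      (\<Sum>(P, j)\<in>{(P, j) \<in> power_sum_index r. \<not> int p dvd coeff P 0}. of_nat (degree P) * kl_char b P ^ j)"
    unfolding Psum_def
  proof (rule sum.mono_neutral_right[OF finite_power_sum_index[OF r]])
    show "\<forall>x\<in>power_sum_index r - {(P, j) \<in> power_sum_index r. \<not> int p dvd coeff P 0}.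
        (case x of (P, j) \<Rightarrow> of_nat (degree P) * kl_char b P ^ j) = (0::complex)"
    proof
      fix x assume x: "x \<in> power_sum_index r - {(P, j) \<in> power_sum_index r. \<not> int p dvd coeff P 0}"
      obtain P j where Pj: "x = (P, j)"
        by (cases x)
      have "int p dvd coeff P 0" "j * degree P = r"
        using x by (simp_all add: Pj power_sum_index_def)
      moreover from this(2) r have "0 < j"
        by (cases j) simp_all
      ultimately show "(case x of (P, j) \<Rightarrow> of_nat (degree P) * kl_char b P ^ j) = (0::complex)"
        by (simp add: Pj kl_char_def)
    qed
  qed auto
  also have "\<dots> = (\<Sum>t\<in>{0..<int p}. \<Sum>(P, j)\<in>trace_fibre b r t. of_nat (degree P) * kl_char b P ^ j)"
    unfolding disjoint_trace_fibres(1)[OF r, of b, symmetric]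
    by (rule sum.UNION_disjoint) (use disjoint_trace_fibres(2,3)[OF r] in auto)
  also have "\<dots> = (\<Sum>t\<in>{0..<int p}. of_nat (\<Sum>(P, j)\<in>trace_fibre b r t. degree P) * psi t)"
  proof (rule sum.cong[OF refl])
    fix t
    have "(\<Sum>(P, j)\<in>trace_fibre b r t. of_nat (degree P) * kl_char b P ^ j) =
        (\<Sum>(P, j)\<in>trace_fibre b r t. of_nat (degree P) * psi t)"
    proof (rule sum.cong[OF refl], clarify)
      fix P j assume "(P, j) \<in> trace_fibre b r t"
      then have "\<not> int p dvd coeff P 0" "psi (int j * tr b P) = psi t"
        by (auto simp: trace_fibre_def intro: psi_cong)
      then show "of_nat (degree P) * kl_char b P ^ j = of_nat (degree P) * psi t"
        by (simp add: kl_char_def psi_mult_nat)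
    qed
    then show "(\<Sum>(P, j)\<in>trace_fibre b r t. of_nat (degree P) * kl_char b P ^ j) =
        of_nat (\<Sum>(P, j)\<in>trace_fibre b r t. degree P) * psi t"
      by (simp add: case_prod_unfold sum_distrib_right)
  qed
  finally show ?thesis .
qed

text \<open>The fibres miss only the point \<open>0\<close>, which is the pair
  \<open>(X, r)\<close>; it accounts for the \<open>1\<close>.\<close>

lemma sum_trace_fibres:
  assumes r: "1 \<le> r"
  shows "p ^ r \<le> (\<Sum>t\<in>{0..<int p}. \<Sum>(P, j)\<in>trace_fibre b r t. degree P) + 1"
proof -
  have fin: "finite (power_sum_index r)"
    by (rule finite_power_sum_index[OF r])
  have "of_nat (p ^ r) = (of_nat (\<Sum>(P, j)\<in>power_sum_index r. degree P) :: complex)"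
    using Psum_one[OF r] by (simp add: Psum_def case_prod_unfold)
  then have "p ^ r = (\<Sum>(P, j)\<in>power_sum_index r. degree P)"
    by (simp only: of_nat_eq_iff)
  also have "\<dots> \<le> (\<Sum>(P, j)\<in>insert (X, r) {(P, j) \<in> power_sum_index r. \<not> int p dvd coeff P 0}. degree P)"
  proof (rule sum_mono2)
    show "finite (insert (X, r) {(P, j) \<in> power_sum_index r. \<not> int p dvd coeff P 0})"
      by (rule finite.insertI[OF finite_subset[OF _ fin]]) auto
    show "power_sum_index r \<subseteq> insert (X, r) {(P, j) \<in> power_sum_index r. \<not> int p dvd coeff P 0}"
    proof
      fix x assume x: "x \<in> power_sum_index r"
      obtain P j where Pj: "x = (P, j)"
        by (cases x)
      show "x \<in> insert (X, r) {(P, j) \<in> power_sum_index r. \<not> int p dvd coeff P 0}"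
      proof (cases "int p dvd coeff P 0")
        case True
        then have "P = X"
          using x by (intro Irr_X) (simp_all add: Pj power_sum_index_def)
        then show ?thesis
          using x by (simp add: Pj power_sum_index_def)
      next
        case False
        then show ?thesis
          using x by (simp add: Pj)
      qed
    qed
  qed auto
  also have "\<dots> \<le> 1 + (\<Sum>(P, j)\<in>{(P, j) \<in> power_sum_index r. \<not> int p dvd coeff P 0}. degree P)"
  proof -
    have "finite {(P, j) \<in> power_sum_index r. \<not> int p dvd coeff P 0}"
      by (rule finite_subset[OF _ fin]) auto
    then show ?thesis
      by (subst sum.insert_if) auto
  qed
  also have "(\<Sum>(P, j)\<in>{(P, j) \<in> power_sum_index r. \<not> int p dvd coeff P 0}. degree P) =
      (\<Sum>t\<in>{0..<int p}. \<Sum>(P, j)\<in>trace_fibre b r t. degree P)"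
    unfolding disjoint_trace_fibres(1)[OF r, of b, symmetric]
    by (rule sum.UNION_disjoint) (use disjoint_trace_fibres(2,3)[OF r] in auto)
  finally show ?thesis
    by simp
qed

lemma norm_Psum_kl_char:
  assumes s: "1 \<le> s"
  shows "cmod (Psum (kl_char b) (2 * s)) \<le> 5 * real p * real p ^ s"
proof -
  define n where "n t = (\<Sum>(P, j)\<in>trace_fibre b (2 * s) t. degree P)" for t
  define B where "B = p ^ (2 * s - 1) + 4 * p ^ s"
  have "cmod (Psum (kl_char b) (2 * s)) = cmod (\<Sum>t\<in>{0..<int p}. of_nat (n t) * psi t)"
    using Psum_kl_char[of "2 * s" b] s by (simp add: n_def)
  also have "\<dots> \<le> real (card {0..<int p}) * real B - real (\<Sum>t\<in>{0..<int p}. n t)"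
  proof (rule norm_weighted_sum_le)
    show "n t \<le> B" for t
      unfolding n_def B_def by (rule stepanov[OF s])
    show "(\<Sum>t\<in>{0..<int p}. psi t) = 0"
      using sum_psi[of 1] p_gt_1 by (simp add: zdvd1_eq)
  qed simp_all
  also have "\<dots> \<le> real p * real B - (real p ^ (2 * s) - 1)"
  proof -
    have "p ^ (2 * s) \<le> (\<Sum>t\<in>{0..<int p}. n t) + 1"
      unfolding n_def by (rule sum_trace_fibres) (use s in simp)
    then have "real (p ^ (2 * s)) \<le> real ((\<Sum>t\<in>{0..<int p}. n t) + 1)"
      by (rule of_nat_mono)
    then show ?thesis
      by simp
  qed
  \<comment> \<open>The main terms \<open>p * p ^ (2 * s - 1)\<close> and \<open>p ^ (2 * s)\<close>
    cancel; the error term of \<open>stepanov\<close> and the omitted point survive.\<close>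
  also have "\<dots> = 4 * real p * real p ^ s + 1"
  proof -
    have "2 * s = Suc (2 * s - 1)"
      using s by simp
    then have "real p ^ (2 * s) = real p * real p ^ (2 * s - 1)"
      by (metis power_Suc)
    then show ?thesis
      by (simp add: B_def algebra_simps)
  qed
  also have "\<dots> \<le> 5 * real p * real p ^ s"
  proof -
    have "1 \<le> real p * real p ^ s"
      using p_gt_1 by (metis of_nat_1 of_nat_less_iff of_int_of_nat_eq int_ops(2) less_eq_real_def one_le_power power_Suc)
    then show ?thesis
      by simp
  qed
  finally show ?thesis .
qed

text \<open>Newton's identities for \<open>1 - (u + v) T + u v T^2\<close>: the L-coefficients
  beyond degree \<open>2\<close> vanish, so \<open>von_mangoldt\<close> becomes the recursion
  satisfied by power sums.\<close>

lemma Psum_kl_char_roots: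
  assumes b: "\<not> int p dvd b" and "u + v = - Lcoeff (kl_char b) 1" "u * v = of_nat p" "1 \<le> r"
  shows "Psum (kl_char b) r = - (u ^ r + v ^ r)"
  using assms(4)
proof (induction r rule: less_induct)
  case (less r)
  let ?S = "Psum (kl_char b)" and ?L = "Lcoeff (kl_char b)"
  have vm: "of_nat r * ?L r = (\<Sum>k=1..r. ?S k * ?L (r - k))"
    using von_mangoldt[of "kl_char b" r] kl_char_red kl_char_mult kl_char_1 by blast
  have L1: "?L 1 = - (u + v)"
    using assms(2) by simp
  consider "r = 1" | "r = 2" | "3 \<le> r"
    using less.prems by linarith
  then show ?case
  proof cases
    case 1
    then show ?thesis
      using vm L1 by (simp add: Lcoeff_0)
  next
    case 2
    have "{1..2::nat} = {1, 2}"
      by auto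
    then have "2 * of_nat p = ?S 1 * ?L 1 + ?S 2"
      using vm Lcoeff_2[OF b] by (simp add: 2 Lcoeff_0 numeral_2_eq_2)
    then have "?S 2 = 2 * of_nat p - ?S 1 * ?L 1"
      by (simp add: algebra_simps)
    moreover have "?S 1 = - (u + v)"
      using less.IH[of 1] 2 by simp
    ultimately have "?S 2 = 2 * (u * v) - - (u + v) * - (u + v)"
      by (simp only: L1 assms(3))
    then show ?thesis
      by (simp add: 2 power2_eq_square algebra_simps)
  next
    case 3
    then obtain q where q: "r = Suc (Suc (Suc q))"
      by (metis Suc_le_D numeral_3_eq_3 Suc_le_mono)
    \<comment> \<open>Only \<open>k = r - 2\<close>, \<open>r - 1\<close> and \<open>r\<close> leave
      a coefficient of index at most \<open>2\<close>.\<close>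
    have "(\<Sum>k=1..r. ?S k * ?L (r - k)) = (\<Sum>k\<in>{Suc q, Suc (Suc q), r}. ?S k * ?L (r - k))"
    proof (rule sum.mono_neutral_right)
      show "\<forall>k\<in>{1..r} - {Suc q, Suc (Suc q), r}. ?S k * ?L (r - k) = 0"
      proof
        fix k assume "k \<in> {1..r} - {Suc q, Suc (Suc q), r}"
        then have "3 \<le> r - k"
          using q by auto
        then show "?S k * ?L (r - k) = 0"
          by (simp add: Lcoeff_ge_3)
      qed
    qed (use q in auto)
    also have "\<dots> = ?S (Suc q) * of_nat p + ?S (Suc (Suc q)) * ?L 1 + ?S r"
      using Lcoeff_2[OF b] by (simp add: q Lcoeff_0 numeral_2_eq_2)
    finally have "?S (Suc q) * of_nat p + ?S (Suc (Suc q)) * ?L 1 + ?S r = 0"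
      using vm Lcoeff_ge_3[OF 3] by simp
    then have "?S r = - (?S (Suc q) * of_nat p) - ?S (Suc (Suc q)) * ?L 1"
      by (metis add_diff_cancel_left' diff_0 diff_diff_eq)
    moreover have "?S (Suc q) = - (u ^ Suc q + v ^ Suc q)" "?S (Suc (Suc q)) = - (u ^ Suc (Suc q) + v ^ Suc (Suc q))"
      using less.IH[of "Suc q"] less.IH[of "Suc (Suc q)"] q by simp_all
    ultimately have "?S r = - (- (u ^ Suc q + v ^ Suc q) * (u * v)) -
        - (u ^ Suc (Suc q) + v ^ Suc (Suc q)) * - (u + v)"
      by (simp only: L1 assms(3))
    then show ?thesis
      by (simp add: q algebra_simps)
  qed
qed

text \<open>Replacing \<open>x\<close> by \<open>- x\<close> negates \<open>x + b / x\<close>,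
  because \<open>p - 2\<close> is odd, and so conjugates each term.\<close>

lemma kloosterman_real:
  assumes "odd p"
  shows "kloosterman b \<in> \<real>"
proof -
  have "odd (p - 2)"
    using assms prime_ge_2_nat[OF prime_p] by simp
  have "kloosterman b = (\<Sum>x\<in>{1..<int p}. psi (- (x + b * x ^ (p - 2))))"
    unfolding kloosterman_def
  proof (rule sum.reindex_bij_witness[of _ "\<lambda>x. int p - x" "\<lambda>x. int p - x"])
    fix x assume "x \<in> {1..<int p}"
    have x: "[int p - x = - x] (mod int p)"
      by (simp add: cong_iff_dvd_diff)
    have "[- (int p - x + b * (int p - x) ^ (p - 2)) = - (- x + b * (- x) ^ (p - 2))] (mod int p)"
      by (intro cong_minus_minus_iff[THEN iffD2] cong_add cong_mult cong_pow cong_refl x)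
    also have "- (- x + b * (- x) ^ (p - 2)) = x + b * x ^ (p - 2)"
      using \<open>odd (p - 2)\<close> by simp
    finally show "psi (- (int p - x + b * (int p - x) ^ (p - 2))) = psi (x + b * x ^ (p - 2))"
      by (rule psi_cong)
  qed auto
  also have "\<dots> = cnj (kloosterman b)"
    by (simp only: kloosterman_def cnj_sum cnj_psi)
  finally show ?thesis
    by (metis Reals_cnj_iff)
qed

theorem kloosterman_bound:
  assumes b: "\<not> int p dvd b" and "odd p"
  shows "cmod (kloosterman b) \<le> 2 * sqrt (real p)"
proof (rule ccontr)
  assume not_le: "\<not> ?thesis"
  obtain K where K: "kloosterman b = of_real K"
    using kloosterman_real[OF assms(2)] by (auto elim: Reals_cases)
  have "2 * sqrt (real p) < \<bar>K\<bar>"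
    using not_le K by simp
  then have "(2 * sqrt (real p))\<^sup>2 < \<bar>K\<bar>\<^sup>2"
    by (intro power_strict_mono) auto
  then have disc: "4 * real p < K\<^sup>2"
    by (simp add: power_mult_distrib)
  define D where "D = sqrt (K\<^sup>2 - 4 * real p)"
  define u v where "u = (- K + D) / 2" and "v = (- K - D) / 2"
  have D2: "D\<^sup>2 = K\<^sup>2 - 4 * real p"
    using disc by (simp add: D_def)
  have uv: "u + v = - K" "u * v = real p"
    using D2 by (simp_all add: u_def v_def field_simps power2_eq_square)
  have L1: "Lcoeff (kl_char b) 1 = of_real K"
    unfolding Lcoeff_1 K by simp
  have bound: "(u\<^sup>2) ^ s + (v\<^sup>2) ^ s \<le> 5 * real p * real p ^ s" if s: "1 \<le> s" for s
  proof -
    have "Psum (kl_char b) (2 * s) = - (of_real u ^ (2 * s) + of_real v ^ (2 * s))"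
    proof (rule Psum_kl_char_roots[OF b])
      show "complex_of_real u + of_real v = - Lcoeff (kl_char b) 1"
        unfolding L1 by (metis of_real_add of_real_minus uv(1))
      show "complex_of_real u * of_real v = of_nat p"
        by (metis of_real_mult of_real_of_nat_eq uv(2))
    qed (use s in simp)
    also have "\<dots> = - of_real ((u\<^sup>2) ^ s + (v\<^sup>2) ^ s)"
      by (simp add: power_mult)
    finally have "cmod (Psum (kl_char b) (2 * s)) = \<bar>(u\<^sup>2) ^ s + (v\<^sup>2) ^ s\<bar>"
      by (metis norm_minus_cancel norm_of_real)
    then show ?thesis
      using norm_Psum_kl_char[OF s, of b] by simp
  qed
  have p0: "0 < real p"
    using p_gt_0 by simp
  have "u\<^sup>2 \<le> real p"
  proof (rule le_of_power_bound[of _ _ "5 * real p", OF _ p0])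
    fix s :: nat assume s: "1 \<le> s"
    have "0 \<le> (v\<^sup>2) ^ s"
      by simp
    with bound[OF s] show "(u\<^sup>2) ^ s \<le> 5 * real p * real p ^ s"
      by linarith
  qed simp
  moreover have "v\<^sup>2 \<le> real p"
  proof (rule le_of_power_bound[of _ _ "5 * real p", OF _ p0])
    fix s :: nat assume s: "1 \<le> s"
    have "0 \<le> (u\<^sup>2) ^ s"
      by simp
    with bound[OF s] show "(v\<^sup>2) ^ s \<le> 5 * real p * real p ^ s"
      by linarith
  qed simp
  \<comment> \<open>As \<open>K^2 > 4 * p\<close>, this exceeds \<open>2 * p\<close>, whereas both
    squares are at most \<open>p\<close>.\<close>
  moreover have "u\<^sup>2 + v\<^sup>2 = K\<^sup>2 - 2 * real p"
  proof -
    have "u\<^sup>2 + v\<^sup>2 = (u + v)\<^sup>2 - 2 * (u * v)"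
      by (simp add: power2_eq_square algebra_simps)
    then show ?thesis
      by (simp add: uv)
  qed
  ultimately show False
    using disc by linarith
qed

end

section \<open>Correlations of the Legendre symbol\<close>

locale odd_prime_modulus = prime_modulus +
  assumes odd_p: "odd p"
begin

lemma p_gt_2: "2 < p"
  using prime_gt_1_nat[OF prime_p] odd_p by (cases "p = 2") auto

lemma not_dvd_mult: "\<lbrakk>\<not> int p dvd a; \<not> int p dvd b\<rbrakk> \<Longrightarrow> \<not> int p dvd a * b"
  using prime_p by (simp add: prime_dvd_mult_iff)

lemma cong_cancel: "\<lbrakk>[a * b = a * c] (mod int p); \<not> int p dvd a\<rbrakk> \<Longrightarrow> [b = c] (mod int p)"
  using prime_p by (simp add: cong_iff_dvd_diff right_diff_distrib[symmetric] prime_dvd_mult_iff)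

lemma not_dvd_2: "\<not> int p dvd 2"
  using p_gt_2 zdvd_imp_le[of "int p" 2] by auto

lemma half_exists:
  obtains h where "[2 * h = m] (mod int p)"
proof -
  have "[2 * (2 ^ (p - 2) * m) = m] (mod int p)"
    using cong_scalar_right[OF inverse_mod[OF not_dvd_2], of m] by (simp add: mult.assoc)
  then show thesis
    by (rule that)
qed

lemma residue_eqI: "\<lbrakk>a \<in> {0..<int p}; b \<in> {0..<int p}; [a = b] (mod int p)\<rbrakk> \<Longrightarrow> a = b"
  by (simp add: cong_def)

lemma Legendre_values: "Legendre a (int p) \<in> {-1, 0, 1}"
  by (simp add: Legendre_def)

text \<open>Both sides lie in \<open>{-1, 0, 1}\<close>, and a difference of absolute value at most
  \<open>2\<close> is not a nonzero multiple of \<open>p\<close>.\<close>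

lemma Legendre_eqI:
  assumes "[Legendre a (int p) = c] (mod int p)" "c \<in> {-1, 0, 1}"
  shows "Legendre a (int p) = c"
proof -
  have "int p dvd Legendre a (int p) - c"
    using assms(1) by (simp add: cong_iff_dvd_diff)
  moreover have "\<bar>Legendre a (int p) - c\<bar> \<le> 2"
    using Legendre_values[of a] assms(2) by auto
  ultimately show ?thesis
    using p_gt_2 dvd_imp_le_int[of "Legendre a (int p) - c" "int p"] by auto
qed

lemma Legendre_mult: "Legendre (a * b) (int p) = Legendre a (int p) * Legendre b (int p)"
proof (rule Legendre_eqI)
  have E: "[Legendre x (int p) = x ^ ((p - 1) div 2)] (mod int p)" for x
    by (rule euler_criterion[OF prime_p p_gt_2])
  show "[Legendre (a * b) (int p) = Legendre a (int p) * Legendre b (int p)] (mod int p)"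
    using cong_mult[OF E E, of a b] E[of "a * b"] by (simp add: power_mult_distrib cong_def)
  show "Legendre a (int p) * Legendre b (int p) \<in> {-1, 0, 1}"
    using Legendre_values[of a] Legendre_values[of b] by auto
qed

lemma Legendre_neg_1: "Legendre (- 1) (int p) = (if p mod 4 = 1 then 1 else - 1)"
proof (rule Legendre_eqI)
  have p: "p mod 4 = 1 \<or> p mod 4 = 3"
    using odd_p by presburger
  have "(- 1) ^ ((p - 1) div 2) = (if p mod 4 = 1 then 1 else - 1 :: int)"
  proof (cases "p mod 4 = 1")
    case True
    then have "even ((p - 1) div 2)"
      by presburger
    then show ?thesis
      using True by simp
  next
    case False
    then have "odd ((p - 1) div 2)"
      using p by presburger
    then show ?thesis
      using False by simp
  qed
  then show "[Legendre (- 1) (int p) = (if p mod 4 = 1 then 1 else - 1)] (mod int p)"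
    using euler_criterion[OF prime_p p_gt_2, of "- 1"] by simp
qed simp

lemma card_square_roots:
  "int (card {y \<in> {0..<int p}. [y\<^sup>2 = a] (mod int p)}) = Legendre a (int p) + 1"
proof -
  define R where "R = {y \<in> {0..<int p}. [y\<^sup>2 = a] (mod int p)}"
  consider "[a = 0] (mod int p)" | "\<not> [a = 0] (mod int p)" "QuadRes (int p) a"
    | "\<not> [a = 0] (mod int p)" "\<not> QuadRes (int p) a"
    by blast
  then have "int (card R) = Legendre a (int p) + 1"
  proof cases
    case 1
    have "R = {0}"
    proof (intro equalityI subsetI)
      fix y assume y: "y \<in> R"
      then have "[y\<^sup>2 = 0] (mod int p)"
        using 1 unfolding R_def by (auto intro: cong_trans)
      then have "int p dvd y"
        using prime_p by (simp add: cong_0_iff prime_dvd_power_iff)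
      then show "y \<in> {0}"
        using y residue_eqI[of y 0] by (simp add: R_def cong_0_iff)
    next
      fix y :: int assume "y \<in> {0}"
      then show "y \<in> R"
        using 1 p_gt_0 by (simp add: R_def cong_sym)
    qed
    then show ?thesis
      using 1 by (simp add: Legendre_def)
  next
    case 2
    then obtain z where z: "[z\<^sup>2 = a] (mod int p)"
      by (auto simp: QuadRes_def)
    have nz: "\<not> int p dvd z"
    proof
      assume "int p dvd z"
      then have "[z\<^sup>2 = 0] (mod int p)"
        by (simp add: cong_0_iff dvd_power_same power2_eq_square)
      then show False
        using 2(1) z cong_sym cong_trans by blast
    qed
    have "R = {z mod int p, (- z) mod int p}"
    proof (intro equalityI subsetI)
      fix y assume y: "y \<in> R"
      then have "[y\<^sup>2 = z\<^sup>2] (mod int p)"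
        using z unfolding R_def by (auto intro: cong_trans cong_sym)
      then have "int p dvd (y - z) * (y + z)"
        by (simp add: cong_iff_dvd_diff power2_eq_square algebra_simps)
      then have "int p dvd y - z \<or> int p dvd y - (- z)"
        using prime_p by (simp add: prime_dvd_mult_iff)
      then have "y mod int p = z mod int p \<or> y mod int p = (- z) mod int p"
        by (simp only: mod_eq_dvd_iff)
      moreover have "y mod int p = y"
        using y by (simp add: R_def)
      ultimately show "y \<in> {z mod int p, (- z) mod int p}"
        by simp
    next
      have sq: "[(c mod int p)\<^sup>2 = c\<^sup>2] (mod int p)" for c
        by (simp add: cong_def power_mod)
      fix y assume "y \<in> {z mod int p, (- z) mod int p}"
      then show "y \<in> R"
        using sq[of z] sq[of "- z"] z p_gt_0 by (auto simp: R_def intro: cong_trans)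
    qed
    moreover have "z mod int p \<noteq> (- z) mod int p"
    proof
      assume "z mod int p = (- z) mod int p"
      then have "int p dvd 2 * z"
        by (simp add: mod_eq_dvd_iff)
      then show False
        using not_dvd_mult[OF not_dvd_2 nz] by blast
    qed
    ultimately show ?thesis
      using 2 by (simp add: Legendre_def)
  next
    case 3
    then have "R = {}"
      by (auto simp: R_def QuadRes_def)
    then show ?thesis
      using 3 by (simp add: Legendre_def)
  qed
  then show ?thesis
    by (simp only: R_def)
qed

definition chi :: "int \<Rightarrow> complex" where
  "chi k = of_int (Legendre k (int p))"

lemma chi_mult: "chi (a * b) = chi a * chi b"
  by (simp add: chi_def Legendre_mult)

lemma chi_cong: "[a = b] (mod int p) \<Longrightarrow> chi a = chi b"
  by (simp add: chi_def Legendre_cong)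

lemma chi_0: "int p dvd a \<Longrightarrow> chi a = 0"
  by (simp add: chi_def Legendre_def cong_0_iff)

lemma chi_values: "\<not> int p dvd a \<Longrightarrow> chi a = 1 \<or> chi a = - 1"
  by (simp add: chi_def Legendre_def cong_0_iff)

lemma cnj_chi [simp]: "cnj (chi a) = chi a"
  by (simp add: chi_def)

lemma chi_minus: "chi (- a) = (if p mod 4 = 1 then 1 else - 1) * chi a"
  using chi_mult[of "- 1" a] by (simp add: chi_def Legendre_neg_1)

section \<open>The hyperbola and the correlation sums\<close>

definition conic :: "int \<Rightarrow> (int \<times> int) set" where
  "conic h = {(l, y) \<in> {0..<int p} \<times> {0..<int p}. [y\<^sup>2 = l\<^sup>2 - h\<^sup>2] (mod int p)}"

lemma conicD:
  assumes "(l, y) \<in> conic h"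
  shows "l \<in> {0..<int p}" "y \<in> {0..<int p}" "[(l + y) * (l - y) = h\<^sup>2] (mod int p)"
proof -
  have "[y\<^sup>2 = l\<^sup>2 - h\<^sup>2] (mod int p)"
    using assms by (simp add: conic_def)
  then have "int p dvd - (y\<^sup>2 - (l\<^sup>2 - h\<^sup>2))"
    unfolding dvd_minus_iff by (simp only: cong_iff_dvd_diff)
  then show "[(l + y) * (l - y) = h\<^sup>2] (mod int p)"
    by (simp add: cong_iff_dvd_diff power2_eq_square algebra_simps)
qed (use assms in \<open>auto simp: conic_def\<close>)

text \<open>Over a field of odd characteristic the hyperbola \<open>l\<^sup>2 - y\<^sup>2 = h\<^sup>2\<close> is parametrized by
  the factor \<open>l + y\<close>, a unit; the scaling by \<open>w\<close> is used to normalize the Kloosterman sum.\<close>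

lemma bij_conic:
  assumes h: "\<not> int p dvd h" and w: "\<not> int p dvd w"
  shows "bij_betw (\<lambda>(l, y). (w * (l + y)) mod int p) (conic h) {1..<int p}"
proof (rule bij_betw_imageI)
  have h2: "\<not> int p dvd h\<^sup>2"
    using h by (rule not_dvd_power)
  have unit: "\<not> int p dvd l + y" if "(l, y) \<in> conic h" for l y
  proof
    assume "int p dvd l + y"
    then have "int p dvd (l + y) * (l - y)"
      by simp
    then show False
      using h2 conicD(3)[OF that] cong_dvd_iff by blast
  qed
  show "inj_on (\<lambda>(l, y). (w * (l + y)) mod int p) (conic h)"
  proof (rule inj_onI)
    fix a a' assume a: "a \<in> conic h" "a' \<in> conic h"
      "(case a of (l, y) \<Rightarrow> (w * (l + y)) mod int p) = (case a' of (l, y) \<Rightarrow> (w * (l + y)) mod int p)"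
    obtain l y l' y' where ly: "a = (l, y)" "a' = (l', y')"
      by (metis prod.exhaust)
    note 1 = a(1)[unfolded ly] and 2 = a(2)[unfolded ly]
    have "[w * (l + y) = w * (l' + y')] (mod int p)"
      using a(3) by (simp add: ly cong_def)
    then have s: "[l + y = l' + y'] (mod int p)"
      using w by (rule cong_cancel)
    have "[(l + y) * (l - y) = h\<^sup>2] (mod int p)"
      by (rule conicD(3)[OF 1])
    also have "[h\<^sup>2 = (l' + y') * (l' - y')] (mod int p)"
      by (rule cong_sym[OF conicD(3)[OF 2]])
    also have "[(l' + y') * (l' - y') = (l + y) * (l' - y')] (mod int p)"
      by (intro cong_mult cong_sym[OF s] cong_refl)
    finally have d: "[l - y = l' - y'] (mod int p)"
      using unit[OF 1] by (rule cong_cancel)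
    have "[2 * l = 2 * l'] (mod int p)" "[2 * y = 2 * y'] (mod int p)"
      using cong_add[OF s d] cong_diff[OF s d] by (simp_all add: algebra_simps)
    then have "[l = l'] (mod int p)" "[y = y'] (mod int p)"
      using cong_cancel[OF _ not_dvd_2] by blast+
    then show "a = a'"
      using residue_eqI conicD(1,2)[OF 1] conicD(1,2)[OF 2] ly by blast
  qed
  show "(\<lambda>(l, y). (w * (l + y)) mod int p) ` conic h = {1..<int p}"
  proof (intro equalityI subsetI)
    fix x assume "x \<in> (\<lambda>(l, y). (w * (l + y)) mod int p) ` conic h"
    then obtain l y where ly: "(l, y) \<in> conic h" "x = (w * (l + y)) mod int p"
      by auto
    have "x \<noteq> 0"
      using not_dvd_mult[OF w unit[OF ly(1)]] ly(2) by (auto simp: mod_eq_0_iff_dvd)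
    moreover have "0 \<le> x" "x < int p"
      using p_gt_0 ly(2) by simp_all
    ultimately show "x \<in> {1..<int p}"
      by simp
  next
    fix x assume x: "x \<in> {1..<int p}"
    obtain i where i: "[2 * i = 1] (mod int p)"
      using half_exists by blast
    define s where "s = x * w ^ (p - 2)"
    define t where "t = h\<^sup>2 * s ^ (p - 2)"
    define l where "l = ((s + t) * i) mod int p"
    define y where "y = ((s - t) * i) mod int p"
    have l: "[l = (s + t) * i] (mod int p)" and y: "[y = (s - t) * i] (mod int p)"
      by (simp_all add: l_def y_def cong_def)
    have s: "\<not> int p dvd s"
      unfolding s_def by (intro not_dvd_mult not_dvd_power w units_dvd x)
    have st: "[s * t = h\<^sup>2] (mod int p)"
      using cong_mult[OF cong_refl[of "h\<^sup>2"] inverse_mod[OF s]] by (simp add: t_def mult_ac)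
    have ws: "[w * s = x] (mod int p)"
      using cong_mult[OF cong_refl[of x] inverse_mod[OF w]] by (simp add: s_def mult_ac)
    have "[l + y = (s + t) * i + (s - t) * i] (mod int p)"
      by (intro cong_add l y)
    also have "(s + t) * i + (s - t) * i = s * (2 * i)"
      by (simp add: algebra_simps)
    also have "[\<dots> = s * 1] (mod int p)"
      by (intro cong_mult cong_refl i)
    finally have ly: "[l + y = s] (mod int p)"
      by simp
    have "[l - y = (s + t) * i - (s - t) * i] (mod int p)"
      by (intro cong_diff l y)
    also have "(s + t) * i - (s - t) * i = t * (2 * i)"
      by (simp add: algebra_simps)
    also have "[\<dots> = t * 1] (mod int p)"
      by (intro cong_mult cong_refl i)
    finally have "[(l + y) * (l - y) = s * t] (mod int p)"
      using cong_mult[OF ly] by simp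
    also note st
    finally have "int p dvd - ((l + y) * (l - y) - h\<^sup>2)"
      unfolding dvd_minus_iff by (simp only: cong_iff_dvd_diff)
    then have "[y\<^sup>2 = l\<^sup>2 - h\<^sup>2] (mod int p)"
      by (simp add: cong_iff_dvd_diff power2_eq_square algebra_simps)
    then have "(l, y) \<in> conic h"
      using p_gt_0 by (simp add: conic_def l_def y_def)
    moreover have "(w * (l + y)) mod int p = x"
    proof -
      have "[w * (l + y) = x] (mod int p)"
        using cong_trans[OF cong_mult[OF cong_refl ly] ws] .
      then show ?thesis
        using x by (simp add: cong_def)
    qed
    ultimately show "x \<in> (\<lambda>(l, y). (w * (l + y)) mod int p) ` conic h"
      by (intro image_eqI[of _ _ "(l, y)"]) auto
  qed
qed

definition corr :: "int \<Rightarrow> int \<Rightarrow> complex" where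
  "corr m n = (\<Sum>k\<in>{0..<int p}. chi k * chi (k + m) * psi (- (k * n)))"

text \<open>The shift \<open>k = l - h\<close> turns \<open>k * (k + m)\<close> into
  \<open>l^2 - h^2\<close> and yields the phase; \<open>1 + chi\<close> counts square roots, which
  makes the sum over \<open>l\<close> one over the points of the conic.\<close>

lemma corr_conic:
  assumes h: "[2 * h = m] (mod int p)"
  shows "corr m n = psi (h * n) * ((\<Sum>(l, y)\<in>conic h. psi (- (l * n))) - (\<Sum>l\<in>{0..<int p}. psi (- (l * n))))"
proof -
  have "corr m n = (\<Sum>l\<in>{0..<int p}. chi (l + - h) * chi (l + - h + m) * psi (- ((l + - h) * n)))"
    unfolding corr_def
  proof (rule sum_shift[symmetric])
    fix a b assume ab: "[a = b] (mod int p)"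
    have "[- (a * n) = - (b * n)] (mod int p)"
      using ab by (intro cong_minus_minus_iff[THEN iffD2] cong_mult cong_refl)
    from psi_cong[OF this]
    show "chi a * chi (a + m) * psi (- (a * n)) = chi b * chi (b + m) * psi (- (b * n))"
      using chi_cong[OF ab] chi_cong[OF cong_add[OF ab cong_refl[of m]]] by simp
  qed
  also have "\<dots> = (\<Sum>l\<in>{0..<int p}. psi (h * n) * (chi (l\<^sup>2 - h\<^sup>2) * psi (- (l * n))))"
  proof (rule sum.cong[OF refl])
    fix l
    have "[l + - h + m = l + - h + 2 * h] (mod int p)"
      by (intro cong_add cong_refl cong_sym[OF h])
    from chi_cong[OF this] have "chi (l + - h + m) = chi (l + h)"
      by (simp add: add.commute)
    then have "chi (l + - h) * chi (l + - h + m) = chi (l\<^sup>2 - h\<^sup>2)"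
      by (simp add: chi_mult[symmetric] power2_eq_square algebra_simps)
    moreover have "psi (- ((l + - h) * n)) = psi (h * n) * psi (- (l * n))"
      unfolding psi_add[symmetric] by (simp add: algebra_simps)
    ultimately show "chi (l + - h) * chi (l + - h + m) * psi (- ((l + - h) * n)) =
        psi (h * n) * (chi (l\<^sup>2 - h\<^sup>2) * psi (- (l * n)))"
      by simp
  qed
  also have "\<dots> = psi (h * n) * (\<Sum>l\<in>{0..<int p}. chi (l\<^sup>2 - h\<^sup>2) * psi (- (l * n)))"
    by (simp add: sum_distrib_left)
  also have "(\<Sum>l\<in>{0..<int p}. chi (l\<^sup>2 - h\<^sup>2) * psi (- (l * n))) =
      (\<Sum>l\<in>{0..<int p}. \<Sum>y | y \<in> {0..<int p} \<and> [y\<^sup>2 = l\<^sup>2 - h\<^sup>2] (mod int p). psi (- (l * n))) -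
      (\<Sum>l\<in>{0..<int p}. psi (- (l * n)))"
    unfolding sum_subtractf[symmetric]
  proof (rule sum.cong[OF refl])
    fix l
    have "chi (l\<^sup>2 - h\<^sup>2) = of_int (int (card {y \<in> {0..<int p}. [y\<^sup>2 = l\<^sup>2 - h\<^sup>2] (mod int p)})) - 1"
      unfolding card_square_roots by (simp add: chi_def)
    then show "chi (l\<^sup>2 - h\<^sup>2) * psi (- (l * n)) =
        (\<Sum>y | y \<in> {0..<int p} \<and> [y\<^sup>2 = l\<^sup>2 - h\<^sup>2] (mod int p). psi (- (l * n))) - psi (- (l * n))"
      by (simp add: left_diff_distrib)
  qed
  also have "(\<Sum>l\<in>{0..<int p}. \<Sum>y | y \<in> {0..<int p} \<and> [y\<^sup>2 = l\<^sup>2 - h\<^sup>2] (mod int p). psi (- (l * n))) =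
      (\<Sum>(l, y)\<in>conic h. psi (- (l * n)))"
  proof -
    have fin: "\<forall>l\<in>{0..<int p}. finite {y \<in> {0..<int p}. [y\<^sup>2 = l\<^sup>2 - h\<^sup>2] (mod int p)}"
      by (intro ballI finite_subset[of "{y \<in> {0..<int p}. _ y}" "{0..<int p}"]) auto
    have eq: "conic h = (SIGMA l:{0..<int p}. {y \<in> {0..<int p}. [y\<^sup>2 = l\<^sup>2 - h\<^sup>2] (mod int p)})"
      by (auto simp: conic_def)
    show ?thesis
      unfolding eq by (rule sum.Sigma[OF finite_atLeastLessThan_int fin])
  qed
  finally show ?thesis .
qed

text \<open>Take \<open>w = - n / 2\<close> and \<open>x = w * (l + y)\<close>. On the conic
  \<open>b / x = w * (l - y)\<close> for \<open>b = (w * h)^2\<close>, so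
  \<open>x + b / x = 2 * w * l = - n * l\<close>, the exponent required.\<close>

lemma corr_kloosterman:
  assumes m: "\<not> int p dvd m" and n: "\<not> int p dvd n" and h: "[2 * h = m] (mod int p)"
  obtains b where "\<not> int p dvd b" "corr m n = psi (h * n) * kloosterman b"
proof -
  obtain w where w: "[2 * w = - n] (mod int p)"
    using half_exists by blast
  have nh: "\<not> int p dvd h" and nw: "\<not> int p dvd w"
    using m n cong_dvd_iff[OF h] cong_dvd_iff[OF w] by auto
  define b where "b = w\<^sup>2 * h\<^sup>2"
  have "(\<Sum>(l, y)\<in>conic h. psi (- (l * n))) =
      (\<Sum>a\<in>conic h. (\<lambda>x. psi (x + b * x ^ (p - 2))) ((\<lambda>(l, y). (w * (l + y)) mod int p) a))"
  proof (rule sum.cong[OF refl])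
    fix a assume a: "a \<in> conic h"
    obtain l y where ly: "a = (l, y)"
      by (cases a)
    define x where "x = (w * (l + y)) mod int p"
    have x: "[x = w * (l + y)] (mod int p)"
      by (simp add: x_def cong_def)
    have "x \<in> {1..<int p}"
      using bij_betwE[OF bij_conic[OF nh nw]] a by (force simp: ly x_def)
    then have nx: "\<not> int p dvd x"
      by (rule units_dvd)
    have "[x * (w * (l - y)) = (w * (l + y)) * (w * (l - y))] (mod int p)"
      by (intro cong_mult x cong_refl)
    also have "(w * (l + y)) * (w * (l - y)) = w\<^sup>2 * ((l + y) * (l - y))"
      by (simp add: power2_eq_square)
    also have "[\<dots> = b] (mod int p)"
      unfolding b_def by (intro cong_mult cong_refl conicD(3) a[unfolded ly])
    finally have xb: "[x * (w * (l - y)) = b] (mod int p)" .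
    have "[x + b * x ^ (p - 2) = w * (l + y) + (x * (w * (l - y))) * x ^ (p - 2)] (mod int p)"
      by (intro cong_add cong_mult x cong_sym[OF xb] cong_refl)
    also have "w * (l + y) + (x * (w * (l - y))) * x ^ (p - 2) = w * (l + y) + (w * (l - y)) * (x * x ^ (p - 2))"
      by (simp add: mult_ac)
    also have "[\<dots> = w * (l + y) + (w * (l - y)) * 1] (mod int p)"
      by (intro cong_add cong_mult cong_refl inverse_mod nx)
    also have "w * (l + y) + (w * (l - y)) * 1 = 2 * w * l"
      by (simp add: algebra_simps)
    also have "[\<dots> = - n * l] (mod int p)"
      by (intro cong_mult w cong_refl)
    finally have "psi (x + b * x ^ (p - 2)) = psi (- n * l)"
      by (rule psi_cong)
    then show "(case a of (l, y) \<Rightarrow> psi (- (l * n))) =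
        (\<lambda>x. psi (x + b * x ^ (p - 2))) ((\<lambda>(l, y). (w * (l + y)) mod int p) a)"
      by (simp add: ly x_def mult.commute)
  qed
  also have "\<dots> = kloosterman b"
    unfolding kloosterman_def by (rule sum.reindex_bij_betw[OF bij_conic[OF nh nw]])
  finally have "(\<Sum>(l, y)\<in>conic h. psi (- (l * n))) = kloosterman b" .
  moreover have "(\<Sum>l\<in>{0..<int p}. psi (- (l * n))) = 0"
    using sum_psi[of "- n"] n by (simp add: mult.commute)
  ultimately have "corr m n = psi (h * n) * kloosterman b"
    using corr_conic[OF h, of n] by simp
  moreover have "\<not> int p dvd b"
    unfolding b_def by (intro not_dvd_mult not_dvd_power nw nh)
  ultimately show thesis
    using that by blast
qed

text \<open>At frequency \<open>0\<close> the difference in \<open>corr_conic\<close> is the number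
  \<open>p - 1\<close> of points of the hyperbola minus \<open>p\<close>.\<close>

lemma corr_0:
  assumes m: "\<not> int p dvd m" and n: "int p dvd n"
  shows "corr m n = - 1"
proof -
  obtain h where h: "[2 * h = m] (mod int p)"
    using half_exists by blast
  have nh: "\<not> int p dvd h"
    using m cong_dvd_iff[OF h] by auto
  have psi: "psi (c * n) = 1" "psi (- (c * n)) = 1" for c
    using n by (simp_all add: psi_eq_1_iff)
  have "int (card (conic h)) = int p - 1"
    using bij_betw_same_card[OF bij_conic[OF nh, of 1]] p_gt_1 by (simp add: zdvd1_eq)
  then have "of_int (int (card (conic h))) = (of_int (int p - 1) :: complex)"
    by simp
  then show ?thesis
    using corr_conic[OF h, of n] by (simp add: psi case_prod_unfold)
qed

lemma corr_self: "int p dvd n \<Longrightarrow> corr 0 n = of_nat (p - 1)"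
proof -
  assume n: "int p dvd n"
  have "corr 0 n = (\<Sum>k\<in>{1..<int p}. chi k * chi k)"
    unfolding corr_def residues_split using n
    by (subst sum.insert) (auto simp: chi_0 psi_eq_1_iff[THEN iffD2])
  also have "\<dots> = (\<Sum>k\<in>{1..<int p}. 1)"
  proof (rule sum.cong[OF refl])
    fix k assume "k \<in> {1..<int p}"
    from chi_values[OF units_dvd[OF this]] show "chi k * chi k = 1"
      by auto
  qed
  finally show ?thesis
    by (simp add: nat_diff_distrib)
qed

section \<open>Gauss sums\<close>

definition gauss :: "int \<Rightarrow> complex" where
  "gauss n = (\<Sum>k\<in>{0..<int p}. chi k * psi (- (k * n)))"

text \<open>Expanding the square by the difference of the arguments gives correlations at frequency
  \<open>0\<close>: \<open>p - 1\<close> at shift \<open>0\<close> and \<open>- 1\<close> elsewhere,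
  that is, \<open>p\<close> times a delta minus \<open>1\<close>.\<close>

lemma gauss_sq: "gauss n * cnj (gauss n) = (if int p dvd n then 0 else of_nat p)"
proof -
  let ?R = "{0..<int p}"
  have "gauss n * cnj (gauss n) = (\<Sum>l\<in>?R. \<Sum>k\<in>?R. chi k * chi l * psi (- ((k - l) * n)))"
  proof -
    have "gauss n * cnj (gauss n) = (\<Sum>k\<in>?R. \<Sum>l\<in>?R. (chi k * psi (- (k * n))) * (chi l * psi (l * n)))"
      by (simp add: gauss_def cnj_sum cnj_psi sum_product)
    also have "\<dots> = (\<Sum>k\<in>?R. \<Sum>l\<in>?R. chi k * chi l * psi (- ((k - l) * n)))"
    proof (intro sum.cong refl)
      fix k l
      have "psi (- (k * n)) * psi (l * n) = psi (- ((k - l) * n))"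
        unfolding psi_add[symmetric] by (simp add: algebra_simps)
      then show "(chi k * psi (- (k * n))) * (chi l * psi (l * n)) = chi k * chi l * psi (- ((k - l) * n))"
        by (simp add: mult_ac)
    qed
    also have "\<dots> = (\<Sum>l\<in>?R. \<Sum>k\<in>?R. chi k * chi l * psi (- ((k - l) * n)))"
      by (rule sum.swap)
    finally show ?thesis .
  qed
  also have "\<dots> = (\<Sum>l\<in>?R. \<Sum>m\<in>?R. chi l * chi (l + m) * psi (- (m * n)))"
  proof (rule sum.cong[OF refl])
    fix l
    have "(\<Sum>k\<in>?R. chi k * chi l * psi (- ((k - l) * n))) =
        (\<Sum>m\<in>?R. chi (m + l) * chi l * psi (- ((m + l - l) * n)))"
    proof (rule sum_shift[symmetric])
      fix a b assume ab: "[a = b] (mod int p)"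
      have "[- ((a - l) * n) = - ((b - l) * n)] (mod int p)"
        using ab by (intro cong_minus_minus_iff[THEN iffD2] cong_mult cong_diff cong_refl)
      from psi_cong[OF this]
      show "chi a * chi l * psi (- ((a - l) * n)) = chi b * chi l * psi (- ((b - l) * n))"
        using chi_cong[OF ab] by simp
    qed
    then show "(\<Sum>k\<in>?R. chi k * chi l * psi (- ((k - l) * n))) = (\<Sum>m\<in>?R. chi l * chi (l + m) * psi (- (m * n)))"
      by (simp add: add.commute mult.commute)
  qed
  also have "\<dots> = (\<Sum>m\<in>?R. \<Sum>l\<in>?R. chi l * chi (l + m) * psi (- (m * n)))"
    by (rule sum.swap)
  also have "\<dots> = (\<Sum>m\<in>?R. corr m 0 * psi (- (m * n)))"
    by (simp add: corr_def sum_distrib_right)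
  also have "\<dots> = (\<Sum>m\<in>?R. (if m = 0 then of_nat p else 0) - psi (- (m * n)))"
  proof (rule sum.cong[OF refl])
    fix m assume "m \<in> ?R"
    then have "m \<noteq> 0 \<Longrightarrow> \<not> int p dvd m"
      by (intro units_dvd) auto
    then show "corr m 0 * psi (- (m * n)) = (if m = 0 then of_nat p else 0) - psi (- (m * n))"
      using corr_0[of m 0] corr_self[of 0] prime_gt_0_nat[OF prime_p] by (auto simp: of_nat_diff)
  qed
  also have "\<dots> = of_nat p - (\<Sum>m\<in>?R. psi (- (m * n)))"
    using p_gt_0 by (simp add: sum_subtractf sum.delta)
  also have "(\<Sum>m\<in>?R. psi (- (m * n))) = (if int p dvd n then of_nat p else 0)"
    using sum_psi[of "- n"] by (auto simp: mult.commute psi_eq_1_iff[THEN iffD2])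
  finally show ?thesis
    by simp
qed

lemma gauss_0: "int p dvd n \<Longrightarrow> gauss n = 0"
  using gauss_sq[of n] by simp

lemma norm_gauss: "\<not> int p dvd n \<Longrightarrow> cmod (gauss n) = sqrt (real p)"
proof -
  assume "\<not> int p dvd n"
  then have "complex_of_real ((cmod (gauss n))\<^sup>2) = of_nat p"
    unfolding complex_norm_square using gauss_sq[of n] by simp
  then have "(cmod (gauss n))\<^sup>2 = real p"
    by (metis of_real_eq_iff of_real_of_nat_eq)
  then show ?thesis
    by (metis norm_ge_zero real_sqrt_unique)
qed

text \<open>Here \<open>chi\<close> is odd, so replacing \<open>k\<close> by \<open>- k\<close>
  changes the sign of the conjugate. It is applied in the form that the Gauss sum is purely
  imaginary.\<close>

lemma cnj_gauss:
  assumes "p mod 4 \<noteq> 1"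
  shows "cnj (gauss n) = - gauss n"
proof -
  have "cnj (gauss n) = (\<Sum>k\<in>{0..<int p}. - (chi (- k) * psi (- ((- k) * n))))"
    using assms by (simp add: gauss_def cnj_psi chi_minus)
  also have "\<dots> = - (\<Sum>k\<in>{0..<int p}. chi (- k) * psi (- ((- k) * n)))"
    by (rule sum_negf)
  also have "(\<Sum>k\<in>{0..<int p}. chi (- k) * psi (- ((- k) * n))) = gauss n"
    unfolding gauss_def
  proof (rule sum_negate)
    fix a b assume ab: "[a = b] (mod int p)"
    have "[- (a * n) = - (b * n)] (mod int p)"
      using ab by (intro cong_minus_minus_iff[THEN iffD2] cong_mult cong_refl)
    from psi_cong[OF this] show "chi a * psi (- (a * n)) = chi b * psi (- (b * n))"
      using chi_cong[OF ab] by simp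
  qed
  finally show ?thesis .
qed

end

context odd_prime_modulus
begin

section \<open>The ambiguity function\<close>

lemma exp_eq_psi: "exp (- (2 * complex_of_real pi * \<i> * of_int k * of_int n / of_nat p)) = psi (- (k * n))"
  by (simp add: psi_def cis_conv_exp mult_ac)

lemma ambiguity_psi:
  "ambiguity p u m n = (\<Sum>k\<in>{0..<int p}. u (k + m) * cnj (u k) * psi (- (k * n))) / of_nat p"
  by (simp add: ambiguity_def exp_eq_psi)

definition dirac :: "int \<Rightarrow> complex" where
  "dirac k = (if int p dvd k then 1 else 0)"

lemma sum_dirac: "(\<Sum>k\<in>{0..<int p}. dirac k * f k) = f 0"
proof -
  have "(\<Sum>k\<in>{1..<int p}. dirac k * f k) = 0"
    using units_dvd by (intro sum.neutral) (auto simp: dirac_def)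
  then show ?thesis
    unfolding residues_split by (subst sum.insert) (auto simp: dirac_def)
qed

lemma psi_arg_cong: "[a = b] (mod int p) \<Longrightarrow> psi (- (a * n)) = psi (- (b * n))"
  by (intro psi_cong cong_minus_minus_iff[THEN iffD2] cong_mult cong_refl)

lemma dirac_cong: "[a = b] (mod int p) \<Longrightarrow> dirac a = dirac b"
  unfolding dirac_def by (drule cong_dvd_iff) simp

lemma sum_dirac_shift:
  assumes f: "\<And>a b. [a = b] (mod int p) \<Longrightarrow> f a = f b"
  shows "(\<Sum>k\<in>{0..<int p}. dirac (k + m) * f k) = f (- m)"
proof -
  have "(\<Sum>k\<in>{0..<int p}. dirac (k + m) * f (k + m - m)) = (\<Sum>k\<in>{0..<int p}. dirac k * f (k - m))"
  proof (rule sum_shift[of "\<lambda>k. dirac k * f (k - m)"])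
    fix a b assume ab: "[a = b] (mod int p)"
    show "dirac a * f (a - m) = dirac b * f (b - m)"
      using dirac_cong[OF ab] f[OF cong_diff[OF ab cong_refl]] by simp
  qed
  then show ?thesis
    by (simp add: sum_dirac)
qed

lemma sum_chi_shift: "(\<Sum>k\<in>{0..<int p}. chi (k + m) * psi (- (k * n))) = psi (m * n) * gauss n"
proof -
  have e: "psi (- (k * n)) = psi (m * n) * psi (- ((k + m) * n))" for k
    unfolding psi_add[symmetric] by (simp add: algebra_simps)
  have "(\<Sum>k\<in>{0..<int p}. chi (k + m) * psi (- (k * n))) =
      psi (m * n) * (\<Sum>k\<in>{0..<int p}. chi (k + m) * psi (- ((k + m) * n)))"
    unfolding sum_distrib_left by (rule sum.cong[OF refl]) (simp only: e mult_ac)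
  also have "(\<Sum>k\<in>{0..<int p}. chi (k + m) * psi (- ((k + m) * n))) = gauss n"
    unfolding gauss_def
  proof (rule sum_shift[of "\<lambda>k. chi k * psi (- (k * n))"])
    fix a b assume ab: "[a = b] (mod int p)"
    show "chi a * psi (- (a * n)) = chi b * psi (- (b * n))"
      using chi_cong[OF ab] psi_arg_cong[OF ab, of n] by simp
  qed
  finally show ?thesis .
qed

lemma correlation_expansion:
  assumes m: "\<not> int p dvd m" and u: "\<And>k. u k = a + b * chi k + d * dirac k"
  shows "(\<Sum>k\<in>{0..<int p}. u (k + m) * cnj (u k) * psi (- (k * n))) =
    a * cnj a * (if int p dvd n then of_nat p else 0) + a * cnj b * gauss n
    + b * cnj a * (psi (m * n) * gauss n) + b * cnj b * corr m n
    + a * cnj d + d * cnj a * psi (m * n)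
    + b * cnj d * chi m + d * cnj b * (chi (- m) * psi (m * n))"
proof -
  let ?R = "{0..<int p}"
  let ?F = "\<lambda>k. psi (- (k * n))"
  have cnju: "cnj (u k) = cnj a + cnj b * chi k + cnj d * dirac k" for k
    by (simp add: u dirac_def)
  \<comment> \<open>The product of the two delta terms vanishes because \<open>m\<close> is nonzero
    modulo \<open>p\<close>; this leaves eight of the nine products.\<close>
  have dd: "dirac (k + m) * dirac k = 0" for k
    using m by (auto simp: dirac_def dvd_add_right_iff)
  have expand: "u (k + m) * cnj (u k) * ?F k =
      a * cnj a * ?F k + a * cnj b * (chi k * ?F k)
      + b * cnj a * (chi (k + m) * ?F k) + b * cnj b * (chi k * chi (k + m) * ?F k)
      + a * cnj d * (dirac k * ?F k) + d * cnj a * (dirac (k + m) * ?F k)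
      + b * cnj d * (dirac k * (chi (k + m) * ?F k))
      + d * cnj b * (dirac (k + m) * (chi k * ?F k))" for k
  proof -
    have "u (k + m) * cnj (u k) * ?F k =
        a * cnj a * ?F k + a * cnj b * (chi k * ?F k)
        + b * cnj a * (chi (k + m) * ?F k) + b * cnj b * (chi k * chi (k + m) * ?F k)
        + a * cnj d * (dirac k * ?F k) + d * cnj a * (dirac (k + m) * ?F k)
        + b * cnj d * (dirac k * (chi (k + m) * ?F k))
        + d * cnj b * (dirac (k + m) * (chi k * ?F k))
        + d * cnj d * ((dirac (k + m) * dirac k) * ?F k)"
      unfolding cnju unfolding u by (simp only: algebra_simps)
    then show ?thesis
      by (simp only: dd mult_zero_left mult_zero_right add_0_right)
  qed
  have F_sum: "sum ?F ?R = (if int p dvd n then of_nat p else 0)"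
    using sum_psi[of "- n"] by (auto simp: mult.commute psi_eq_1_iff[THEN iffD2])
  have shift1: "(\<Sum>k\<in>?R. dirac (k + m) * ?F k) = psi (m * n)"
    using sum_dirac_shift[of ?F m] psi_arg_cong by simp
  have shift2: "(\<Sum>k\<in>?R. dirac (k + m) * (chi k * ?F k)) = chi (- m) * psi (m * n)"
  proof -
    have "chi a * ?F a = chi b * ?F b" if "[a = b] (mod int p)" for a b
      using chi_cong[OF that] psi_arg_cong[OF that, of n] by simp
    from sum_dirac_shift[of "\<lambda>k. chi k * ?F k" m, OF this] show ?thesis
      by simp
  qed
  have dirac1: "(\<Sum>k\<in>?R. dirac k * ?F k) = 1" "(\<Sum>k\<in>?R. dirac k * (chi (k + m) * ?F k)) = chi m"
    using sum_dirac[of ?F] sum_dirac[of "\<lambda>k. chi (k + m) * ?F k"] by simp_all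
  show ?thesis
    unfolding expand sum.distrib sum_distrib_left[symmetric] F_sum shift1 shift2 dirac1 sum_chi_shift
      gauss_def[symmetric] corr_def[symmetric]
    by simp
qed

section \<open>Norm estimates in the two classes of \<open>p\<close> modulo \<open>4\<close>\<close>

lemma norm_chi_le: "cmod (chi k) \<le> 1"
  using chi_values[of k] chi_0[of k] by (cases "int p dvd k") auto

lemma norm_corr_le:
  assumes m: "\<not> int p dvd m" and n: "\<not> int p dvd n"
  shows "cmod (corr m n) \<le> 2 * sqrt (real p)"
proof -
  obtain h where h: "[2 * h = m] (mod int p)"
    using half_exists by blast
  obtain b where "\<not> int p dvd b" "corr m n = psi (h * n) * kloosterman b"
    by (rule corr_kloosterman[OF m n h])
  then show ?thesis
    using kloosterman_bound[OF _ odd_p] by (simp add: norm_mult)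
qed

text \<open>Outside \<open>0\<close> this is Euler's formula with \<open>chi\<close> equal to
  \<open>1\<close> or \<open>- 1\<close>; the delta term raises the value at \<open>0\<close> from
  \<open>C\<close> to \<open>1\<close>.\<close>

lemma bjorck_1:
  assumes "p mod 4 = 1" and C: "C = 1 / (1 + sqrt (real p))" and S: "S = sqrt (1 - C\<^sup>2)"
  shows "bjorck p k = of_real C + \<i> * of_real S * chi k + of_real (1 - C) * dirac k"
proof -
  define \<theta> where "\<theta> = arccos C"
  have C01: "0 \<le> C" "C \<le> 1"
    unfolding C by (simp_all add: divide_le_eq_1 add_pos_nonneg)
  have cos: "cos \<theta> = C" and sin: "sin \<theta> = S"
    using C01 by (auto simp: \<theta>_def S cos_arccos_abs sin_arccos_abs)
  have ex: "exp (\<i> * complex_of_real \<theta> * of_int j) = cis (\<theta> * of_int j)" for j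
    by (simp add: cis_conv_exp mult_ac)
  have b: "bjorck p k = cis (\<theta> * of_int (Legendre k (int p)))"
    using assms(1) by (simp add: bjorck_def C[symmetric] \<theta>_def[symmetric] ex)
  show ?thesis
  proof (cases "int p dvd k")
    case True
    then show ?thesis
      unfolding b by (simp add: chi_0 dirac_def Legendre_def cong_0_iff)
  next
    case False
    then have "Legendre k (int p) = 1 \<or> Legendre k (int p) = - 1"
      by (simp add: Legendre_def cong_0_iff)
    then show ?thesis
      unfolding b using False cos sin by (auto simp: chi_def dirac_def complex_eq_iff)
  qed
qed

lemma bound_1:
  assumes p4: "p mod 4 = 1" and m: "\<not> int p dvd m"
  shows "cmod (\<Sum>k\<in>{0..<int p}. bjorck p (k + m) * cnj (bjorck p k) * psi (- (k * n))) < 2 * sqrt (real p) + 4"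
proof -
  define q where "q = sqrt (real p)"
  define C where "C = 1 / (1 + q)"
  define S where "S = sqrt (1 - C\<^sup>2)"
  define D where "D = 1 - C"
  have q: "0 < q" "q\<^sup>2 = real p"
    using p_gt_0 by (simp_all add: q_def)
  \<comment> \<open>\<open>Cq\<close> expresses the choice of the angle: the Gauss sum terms, of
    size \<open>C * S * q\<close>, become as large as the delta terms \<open>S * D\<close>.\<close>
  have C: "0 < C" "C \<le> 1" and Cq: "C * q = D"
    using q(1) by (simp_all add: C_def D_def field_simps)
  have D: "0 \<le> D" "D \<le> 1"
    using C by (simp_all add: D_def)
  have C2: "0 \<le> C\<^sup>2" "C\<^sup>2 \<le> 1"
    using C by (simp_all add: power_le_one)
  have S: "0 \<le> S" "S \<le> 1" and S2: "S\<^sup>2 \<le> 1"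
    using C2 by (simp_all add: S_def)
  have u: "bjorck p k = of_real C + (\<i> * of_real S) * chi k + of_real D * dirac k" for k
    unfolding D_def by (rule bjorck_1[OF p4]) (simp_all add: C_def S_def q_def)
  define N where "N = (if int p dvd n then real p else 0)"
  define G where "G = cmod (gauss n)"
  define T where "T = cmod (corr m n)"
  have "cmod (\<Sum>k\<in>{0..<int p}. bjorck p (k + m) * cnj (bjorck p k) * psi (- (k * n))) \<le>
      C * C * N + C * S * G + S * C * G + S * S * T + C * D + D * C + S * D + D * S"
    unfolding correlation_expansion[OF m u]
  proof (intro norm_triangle_mono)
    show "cmod (of_real C * cnj (of_real C) * (if int p dvd n then of_nat p else 0)) \<le> C * C * N"
      using C by (simp add: norm_mult N_def)
    show "cmod (of_real C * cnj (\<i> * of_real S) * gauss n) \<le> C * S * G"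
      using C S by (simp add: norm_mult G_def)
    show "cmod (\<i> * of_real S * cnj (of_real C) * (psi (m * n) * gauss n)) \<le> S * C * G"
      using C S by (simp add: norm_mult G_def)
    show "cmod (\<i> * of_real S * cnj (\<i> * of_real S) * corr m n) \<le> S * S * T"
      using S by (simp add: norm_mult T_def)
    show "cmod (of_real C * cnj (of_real D)) \<le> C * D"
      using C D by (simp add: norm_mult)
    show "cmod (of_real D * cnj (of_real C) * psi (m * n)) \<le> D * C"
      using C D by (simp add: norm_mult)
    show "cmod (\<i> * of_real S * cnj (of_real D) * chi m) \<le> S * D"
      using S D norm_chi_le by (simp add: norm_mult mult_left_le)
    show "cmod (of_real D * cnj (\<i> * of_real S) * (chi (- m) * psi (m * n))) \<le> D * S"
      using S D norm_chi_le by (simp add: norm_mult mult_left_le)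
  qed
  also have "\<dots> < 2 * q + 4"
  proof (cases "int p dvd n")
    case True
    have NG: "N = q * q" "G = 0" "T = 1"
      using True gauss_0 corr_0[OF m] q(2) by (simp_all add: N_def G_def T_def power2_eq_square)
    have "C * C * N = D * D"
      by (simp add: NG Cq[symmetric] mult_ac)
    moreover have "D * D \<le> 1" "S * S \<le> 1" "C * D \<le> 1" "S * D \<le> 1"
      using C D S mult_mono[of D 1 D 1] mult_mono[of S 1 S 1] mult_mono[of C 1 D 1] mult_mono[of S 1 D 1]
      by simp_all
    \<comment> \<open>Together with the bounds on \<open>D * D\<close> and \<open>S * S\<close> this
      keeps the total at most \<open>4\<close>, below \<open>2 * q + 4\<close>.\<close>
    moreover have "C * D + S * D \<le> 1"
    proof -
      have "C * D + S * D \<le> C * D + D"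
        using mult_right_mono[OF S(2) D(1)] by simp
      also have "\<dots> = 1 - C * C"
        by (simp add: D_def algebra_simps)
      finally show ?thesis
        using C by (smt (verit) mult_nonneg_nonneg)
    qed
    ultimately show ?thesis
      using NG q(1) by (simp add: mult.commute)
  next
    case False
    have NG: "N = 0" "G = q" "T \<le> 2 * q"
      using False norm_gauss norm_corr_le[OF m] by (simp_all add: N_def G_def T_def q_def)
    have "S * S * T \<le> 1 * (2 * q)"
      using S NG(3) S2 by (intro mult_mono) (simp_all add: power2_eq_square T_def)
    \<comment> \<open>The two Gauss terms and two of the delta terms contribute \<open>S * D\<close>
      each.\<close>
    moreover have "C * C * N + C * S * G + S * C * G + S * S * T + C * D + D * C + S * D + D * S =
        S * S * T + 4 * (S * D) + 2 * (C * D)"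
      by (simp add: NG Cq[symmetric] algebra_simps)
    moreover have "S * D \<le> D"
      using mult_right_mono[OF S(2) D(1)] by simp
    moreover have "4 * D + 2 * (C * D) < 4"
    proof -
      have "4 * D + 2 * (C * D) = 4 - 2 * C - 2 * (C * C)"
        by (simp add: D_def algebra_simps)
      moreover have "0 < C * C"
        using C by simp
      ultimately show ?thesis
        using C by linarith
    qed
    ultimately show ?thesis
      by linarith
  qed
  finally show ?thesis
    by (simp add: q_def)
qed

text \<open>The two constants are \<open>(1 + \<omega>) / 2\<close> and \<open>(1 - \<omega>) / 2\<close> for \<open>\<omega> = (1 + \<i> q)\<^sup>2 / (1 + q\<^sup>2)\<close>.\<close>

lemma bjorck_3:
  assumes "p mod 4 \<noteq> 1" and q: "q = sqrt (real p)"
  shows "bjorck p k = Complex (1 / (1 + q\<^sup>2)) (q / (1 + q\<^sup>2)) +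
    Complex (q\<^sup>2 / (1 + q\<^sup>2)) (- q / (1 + q\<^sup>2)) * chi k + Complex (q\<^sup>2 / (1 + q\<^sup>2)) (- q / (1 + q\<^sup>2)) * dirac k"
proof -
  have q2: "q\<^sup>2 = real p" "0 < q"
    using p_gt_0 by (simp_all add: q)
  define x where "x = (1 - q\<^sup>2) / (1 + q\<^sup>2)"
  define \<phi> where "\<phi> = arccos x"
  have pos: "0 < 1 + q\<^sup>2"
    by (simp add: add_pos_nonneg)
  have x: "- 1 \<le> x" "x \<le> 1"
    using pos by (simp_all add: x_def field_simps)
  have "1 - x\<^sup>2 = (2 * q / (1 + q\<^sup>2))\<^sup>2"
  proof -
    have "1 - (w / v)\<^sup>2 = (v\<^sup>2 - w\<^sup>2) / v\<^sup>2" if "0 < v" for v w :: real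
      using that by (simp add: power_divide diff_divide_distrib)
    from this[OF pos] have "1 - x\<^sup>2 = ((1 + q\<^sup>2)\<^sup>2 - (1 - q\<^sup>2)\<^sup>2) / (1 + q\<^sup>2)\<^sup>2"
      by (simp only: x_def)
    also have "(1 + q\<^sup>2)\<^sup>2 - (1 - q\<^sup>2)\<^sup>2 = (2 * q)\<^sup>2"
      by (simp add: power2_eq_square algebra_simps)
    finally show ?thesis
      by (simp only: power_divide)
  qed
  then have "sin \<phi> = 2 * q / (1 + q\<^sup>2)"
    using x q2(2) pos by (simp add: \<phi>_def sin_arccos)
  moreover have "cos \<phi> = x"
    using x by (simp add: \<phi>_def)
  ultimately have \<omega>: "exp (\<i> * complex_of_real \<phi>) = Complex x (2 * q / (1 + q\<^sup>2))"
    by (simp add: cis_conv_exp[symmetric] complex_eq_iff)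
  have b: "bjorck p k = (if Legendre k (int p) = - 1 then Complex x (2 * q / (1 + q\<^sup>2)) else 1)"
    using assms(1) \<omega> by (simp add: bjorck_def \<phi>_def x_def q2(1))
  show ?thesis
  proof (cases "int p dvd k")
    \<comment> \<open>The value at \<open>0\<close> is that at the squares, which is why the delta
      term has the same coefficient as \<open>chi\<close>.\<close>
    case True
    then have "Legendre k (int p) = 0"
      by (simp add: Legendre_def cong_0_iff)
    then show ?thesis
      unfolding b using True pos by (simp add: chi_def dirac_def complex_eq_iff add_divide_distrib[symmetric])
  next
    case False
    then have "Legendre k (int p) = 1 \<or> Legendre k (int p) = - 1"
      by (simp add: Legendre_def cong_0_iff)
    then show ?thesis
      unfolding b using False pos
      by (auto simp: chi_def dirac_def complex_eq_iff x_def add_divide_distrib[symmetric] diff_divide_distrib[symmetric])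
  qed
qed

text \<open>The triangle inequality would not suffice here. Up to the common phase \<open>e\<close> the Kloosterman
  sum is real, while the corrections of order \<open>1\<close> are purely imaginary.\<close>

lemma bound_3:
  assumes p4: "p mod 4 \<noteq> 1" and m: "\<not> int p dvd m"
  shows "cmod (\<Sum>k\<in>{0..<int p}. bjorck p (k + m) * cnj (bjorck p k) * psi (- (k * n))) <
    2 * sqrt (real p) + 4 / sqrt (real p)"
proof -
  define q where "q = sqrt (real p)"
  have q: "0 < q" "q\<^sup>2 = real p"
    using p_gt_0 by (simp_all add: q_def)
  define r where "r = 1 / (1 + q\<^sup>2)"
  have r: "0 < r" "r * q\<^sup>2 < 1"
    using q(1) by (simp_all add: r_def add_pos_nonneg)
  have r1: "r * (1 + q\<^sup>2) = 1"
    using q(1) by (simp add: r_def add_pos_nonneg[THEN less_imp_neq, symmetric])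
  define A where "A = Complex r (q * r)"
  define B where "B = Complex (q\<^sup>2 * r) (- (q * r))"
  have u: "bjorck p k = A + B * chi k + B * dirac k" for k
    using bjorck_3[OF p4 q_def, of k] by (simp add: A_def B_def r_def)
  have AA: "A * cnj A = of_real r"
    and AB: "A * cnj B = \<i> * of_real (q * r)"
    and BA: "B * cnj A = - \<i> * of_real (q * r)"
    and BB: "B * cnj B = of_real (q\<^sup>2 * r)"
  proof -
    have e: "r * r + q * r * (q * r) = r" "q\<^sup>2 * r * (q\<^sup>2 * r) + q * r * (q * r) = q\<^sup>2 * r"
        "q * r * (q\<^sup>2 * r) + r * (q * r) = q * r" "r * (q\<^sup>2 * r) - q * r * (q * r) = 0"
    proof -
      have "r * r + q * r * (q * r) = r * (r * (1 + q\<^sup>2))"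
        "q\<^sup>2 * r * (q\<^sup>2 * r) + q * r * (q * r) = q\<^sup>2 * r * (r * (1 + q\<^sup>2))"
        "q * r * (q\<^sup>2 * r) + r * (q * r) = q * r * (r * (1 + q\<^sup>2))"
        "r * (q\<^sup>2 * r) - q * r * (q * r) = 0"
        by (simp_all add: power2_eq_square algebra_simps)
      then show "r * r + q * r * (q * r) = r" "q\<^sup>2 * r * (q\<^sup>2 * r) + q * r * (q * r) = q\<^sup>2 * r"
        "q * r * (q\<^sup>2 * r) + r * (q * r) = q * r" "r * (q\<^sup>2 * r) - q * r * (q * r) = 0"
        by (simp_all only: r1 mult_1_right)
    qed
    show "A * cnj A = of_real r" "B * cnj B = of_real (q\<^sup>2 * r)"
      using e by (simp_all add: A_def B_def complex_eq_iff)
    show "A * cnj B = \<i> * of_real (q * r)" "B * cnj A = - \<i> * of_real (q * r)"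
      using e by (simp_all add: A_def B_def complex_eq_iff algebra_simps)
  qed
  have pc: "of_nat p = complex_of_real (q\<^sup>2)"
    by (simp add: q(2))
  have chim: "chi (- m) = - chi m"
    using chi_minus[of m] p4 by simp
  define \<Sigma> where "\<Sigma> = (\<Sum>k\<in>{0..<int p}. bjorck p (k + m) * cnj (bjorck p k) * psi (- (k * n)))"
  have \<Sigma>: "\<Sigma> = of_real r * (if int p dvd n then of_nat p else 0) +
      \<i> * of_real (q * r) * ((1 - psi (m * n)) * (gauss n + 1)) +
      of_real (q\<^sup>2 * r) * (corr m n + chi m * (1 - psi (m * n)))"
    unfolding \<Sigma>_def correlation_expansion[OF m u] AA AB BA BB chim
    by (simp add: algebra_simps)
  have "cmod \<Sigma> < 2 * q + 4 / q"
  proof (cases "int p dvd n")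
    case True
    then have "psi (m * n) = 1" "corr m n = - 1"
      using corr_0[OF m] by (simp_all add: psi_eq_1_iff)
    \<comment> \<open>The constant term \<open>r * p\<close> cancels
      \<open>q^2 * r * corr m n\<close>, so at frequency \<open>0\<close> the correlation vanishes
      exactly.\<close>
    then have "\<Sigma> = 0"
      unfolding \<Sigma> pc using True by simp
    then show ?thesis
      using q(1) by (simp add: add_pos_pos)
  next
    case False
    obtain h where h: "[2 * h = m] (mod int p)"
      using half_exists by blast
    obtain b where b: "\<not> int p dvd b" "corr m n = psi (h * n) * kloosterman b"
      by (rule corr_kloosterman[OF m False h])
    obtain R where R: "kloosterman b = of_real R"
      using kloosterman_real[OF odd_p] by (auto elim: Reals_cases)
    have R_le: "\<bar>R\<bar> \<le> 2 * q"
      using kloosterman_bound[OF b(1) odd_p] by (simp add: R q_def)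
    define e where "e = psi (h * n)"
    define \<sigma> where "\<sigma> = Im e"
    have e1: "e * cnj e = 1" "cmod e = 1"
      by (simp_all add: e_def complex_norm_square[symmetric])
    have \<sigma>_le: "\<bar>\<sigma>\<bar> \<le> 1"
      using abs_Im_le_cmod[of e] e1 by (simp add: \<sigma>_def)
    have "2 * h * n = h * n + h * n"
      by simp
    then have "psi (m * n) = psi (h * n + h * n)"
      using psi_cong[OF cong_mult[OF h cong_refl[of n]]] by metis
    \<comment> \<open>With \<open>e\<close> of modulus \<open>1\<close>,
      \<open>1 - e^2 = e * (cnj e - e)\<close>: the phase \<open>e\<close> of the Kloosterman term
      factors out of the corrections as well.\<close>
    then have "1 - psi (m * n) = e * cnj e - e * e"
      unfolding e1(1) unfolding e_def by (simp only: psi_add)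
    also have "\<dots> = e * (- 2 * \<i> * of_real \<sigma>)"
      by (simp add: \<sigma>_def complex_eq_iff algebra_simps)
    finally have psi: "1 - psi (m * n) = e * (- 2 * \<i> * of_real \<sigma>)" .
    define \<gamma> where "\<gamma> = Im (gauss n)"
    have "Re (gauss n) = 0"
      using arg_cong[OF cnj_gauss[OF p4, of n], of Re] by simp
    then have g: "gauss n = \<i> * of_real \<gamma>"
      by (simp add: \<gamma>_def complex_eq_iff)
    have \<gamma>: "\<bar>\<gamma>\<bar> = q"
      using norm_gauss[OF False] by (simp add: g norm_mult q_def)
    define x where "x = Re (chi m)"
    have x: "chi m = of_real x" "\<bar>x\<bar> \<le> 1"
      using chi_values[OF m] by (auto simp: x_def)
    \<comment> \<open>\<open>a\<close> and \<open>c\<close> are the real and imaginary part of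
      \<open>\<Sigma>\<close> after removal of the factors \<open>r\<close> and \<open>e\<close>;
      the Kloosterman term goes into \<open>a\<close>, the Gauss sum and \<open>chi m\<close> into
      \<open>c\<close>.\<close>
    define a where "a = 2 * q * \<sigma> + q\<^sup>2 * R"
    define c where "c = 2 * q * \<sigma> * \<gamma> - 2 * q\<^sup>2 * \<sigma> * x"
    have "\<Sigma> = of_real r * (e * Complex a c)"
    proof -
      have "\<Sigma> = of_real r * (e * (\<i> * of_real q * (- 2 * \<i> * of_real \<sigma> * (\<i> * of_real \<gamma> + 1)) +
          of_real (q\<^sup>2) * (of_real R + of_real x * (- 2 * \<i> * of_real \<sigma>))))"
        unfolding \<Sigma> psi g b(2) R x(1) e_def[symmetric] using False
        by (simp add: algebra_simps)
      also have "\<i> * of_real q * (- 2 * \<i> * of_real \<sigma> * (\<i> * of_real \<gamma> + 1)) +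
          of_real (q\<^sup>2) * (of_real R + of_real x * (- 2 * \<i> * of_real \<sigma>)) = Complex a c"
        by (simp add: a_def c_def complex_eq_iff power2_eq_square)
      finally show ?thesis .
    qed
    then have norm: "cmod \<Sigma> = r * sqrt (a\<^sup>2 + c\<^sup>2)"
      using r e1 by (simp add: norm_mult complex_norm)
    have "\<bar>a\<bar> \<le> 2 * q * 1 + q\<^sup>2 * (2 * q)"
      unfolding a_def using q(1) \<sigma>_le R_le
      by (intro order.trans[OF abs_triangle_ineq] add_mono) (simp_all add: abs_mult)
    also have "\<dots> = 2 * q * (1 + q\<^sup>2)"
      by (simp add: algebra_simps)
    finally have "a\<^sup>2 \<le> (2 * q * (1 + q\<^sup>2))\<^sup>2"
      using q(1) by (intro abs_le_square_iff[THEN iffD1]) (simp add: abs_mult)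
    have "\<bar>c\<bar> \<le> 2 * q * 1 * q + 2 * q\<^sup>2 * 1 * 1"
      unfolding c_def using q(1) \<sigma>_le \<gamma> x(2)
      by (intro order.trans[OF abs_triangle_ineq4] add_mono)
        (auto simp: abs_mult intro!: mult_mono mult_le_one)
    also have "\<dots> = 4 * q\<^sup>2"
      by (simp add: power2_eq_square)
    finally have "c\<^sup>2 \<le> (4 * q\<^sup>2)\<^sup>2"
      using q(1) by (intro abs_le_square_iff[THEN iffD1]) (simp add: abs_mult)
    have "(cmod \<Sigma>)\<^sup>2 = r\<^sup>2 * (a\<^sup>2 + c\<^sup>2)"
      by (simp add: norm power_mult_distrib)
    also have "\<dots> \<le> r\<^sup>2 * ((2 * q * (1 + q\<^sup>2))\<^sup>2 + (4 * q\<^sup>2)\<^sup>2)"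
      using \<open>a\<^sup>2 \<le> _\<close> \<open>c\<^sup>2 \<le> _\<close> by (intro mult_left_mono add_mono) simp_all
    also have "\<dots> = (2 * q * (r * (1 + q\<^sup>2)))\<^sup>2 + (4 * (r * q\<^sup>2))\<^sup>2"
    proof -
      have "r\<^sup>2 * ((2 * q * v)\<^sup>2 + (4 * q\<^sup>2)\<^sup>2) = (2 * q * (r * v))\<^sup>2 + (4 * (r * q\<^sup>2))\<^sup>2" for v
        by (simp add: power_mult_distrib algebra_simps)
      then show ?thesis .
    qed
    also have "\<dots> = 4 * q\<^sup>2 + 16 * (r * q\<^sup>2)\<^sup>2"
      by (simp add: r1 power_mult_distrib)
    also have "\<dots> \<le> 4 * q\<^sup>2 + 16"
      using r q(1) by (simp add: power_le_one)
    \<comment> \<open>The square on the right is \<open>4 * q^2 + 16 + 16 / q^2\<close>.\<close>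
    also have "\<dots> < (2 * q + 4 / q)\<^sup>2"
      using q(1) by (simp add: power2_sum power_mult_distrib power_divide)
    finally show ?thesis
      using q(1) by (intro power_less_imp_less_base[of "cmod \<Sigma>" 2]) simp_all
  qed
  then show ?thesis
    by (simp add: \<Sigma>_def q_def)
qed

lemma norm_bjorck: "cmod (bjorck p k) = 1"
proof -
  have "cmod (exp (\<i> * of_real x)) = 1" for x
    by (simp add: norm_exp_eq_Re)
  then have *: "cmod (exp (\<i> * of_real x * of_int j)) = 1" for x j
    by (simp add: norm_exp_eq_Re)
  show ?thesis
    using * *[of _ 1] by (auto simp: bjorck_def)
qed

end

theorem theorem3p8:
  fixes p :: nat and m n :: int
  assumes "prime p" and "odd p"
    and "\<not> ([m = 0] (mod int p) \<and> [n = 0] (mod int p))"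
  shows "cmod (ambiguity p (bjorck p) m n) <
    2 / sqrt (real p) + (if p mod 4 = 1 then 4 / real p else 4 / real p powr (3/2))"
proof -
  interpret odd_prime_modulus p
    by unfold_locales (rule assms)+
  let ?A = "\<Sum>k\<in>{0..<int p}. bjorck p (k + m) * cnj (bjorck p k) * psi (- (k * n))"
  have p: "0 < real p"
    using p_gt_0 by simp
  have amb: "cmod (ambiguity p (bjorck p) m n) = cmod ?A / real p"
    by (simp add: ambiguity_psi norm_divide)
  show ?thesis
  proof (cases "int p dvd m")
    case True
    then have n: "\<not> int p dvd n"
      using assms(3) by (simp add: cong_0_iff)
    \<comment> \<open>All values of the sequence have modulus \<open>1\<close>, so at shift
      \<open>0\<close> only the sum of a nontrivial additive character remains.\<close>
    have "bjorck p (k + m) * cnj (bjorck p k) = 1" for k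
    proof -
      have "bjorck p (k + m) = bjorck p k"
        using True by (intro bjorck_cong) (simp add: cong_iff_dvd_diff)
      then show ?thesis
        using norm_bjorck[of k] by (simp add: complex_norm_square[symmetric])
    qed
    then have "?A = (\<Sum>k\<in>{0..<int p}. psi (- n * k))"
      by (simp add: mult.commute)
    then have "?A = 0"
      using sum_psi[of "- n"] n by simp
    then show ?thesis
      unfolding amb using p by (simp add: add_pos_pos)
  next
    case False
    have "cmod ?A / real p < (2 * sqrt (real p) + (if p mod 4 = 1 then 4 else 4 / sqrt (real p))) / real p"
      using bound_1[OF _ False] bound_3[OF _ False] p by (simp add: divide_strict_right_mono)
    also have "\<dots> = 2 / sqrt (real p) + (if p mod 4 = 1 then 4 / real p else 4 / real p powr (3/2))"
    proof -
      have "real p powr (3/2) = real p powr (1 + 1/2)"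
        by simp
      also have "\<dots> = real p * sqrt (real p)"
        using p by (simp only: powr_add powr_one powr_half_sqrt less_imp_le)
      finally have "real p powr (3/2) = sqrt (real p) * real p"
        by (simp only: mult.commute)
      moreover have "2 * sqrt (real p) / real p = 2 / sqrt (real p)"
        using real_div_sqrt[of "real p"] p by (simp add: field_simps)
      ultimately show ?thesis
        by (simp add: add_divide_distrib)
    qed
    finally show ?thesis
      unfolding amb .
  qed
qed

end
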